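(* Let $1<p<\infty$. For any positive integer $n$ there exist a function $\hat{g} \in JN_p(\mathbb{R}^n) \setminus VJN_p(\mathbb{R}^n)$ and a function $\hat{g}_0 \in CJN_p(\mathbb{R}^n) \setminus \left( L^p(\mathbb{R}^n)/\mathbb{R} \right)$.
   Context: All cubes in $\mathbb{R}^n$ have edges parallel to the coordinate axes. For an integrable function $h$ on a cube $Q$ write $h_Q := \frac{1}{|Q|}\int_Q h$. A function $f$ belongs to $JN_p(\mathbb{R}^n)$ if $f \in L^1_{loc}(\mathbb{R}^n)$ and there is a constant $K<\infty$ such that $\sum_{i=1}^\infty |Q_i| \left( \frac{1}{|Q_i|}\int_{Q_i} |f - f_{Q_i}| \right)^p \leq K^p$ for all countable collections of pairwise disjoint (bounded) cubes $(Q_i)_{i=1}^\infty$ in $\mathbb{R}^n$; the smallest such $K$ is $\|f\|_{JN_p(\mathbb{R}^n)}$ (a seminorm, vanishing on constants). $VJN_p(\mathbb{R}^n)$ is the closure in $JN_p(\mathbb{R}^n)$, with respect to $\|\cdot\|_{JN_p(\mathbb{R}^n)}$, of $D_p(\mathbb{R}^n) \cap JN_p(\mathbb{R}^n)$, where $D_p(\mathbb{R}^n) := \{ f \in C^\infty(\mathbb{R}^n) : |\nabla f| \in L^p(\mathbb{R}^n) \}$. $CJN_p(\mathbb{R}^n)$ is the closure in $JN_p(\mathbb{R}^n)$, with respect to $\|\cdot\|_{JN_p(\mathbb{R}^n)}$, of $C_c^\infty(\mathbb{R}^n)$, the smooth functions with compact support. $L^p(\mathbb{R}^n)/\mathbb{R}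 := \{ f \in L^1_{loc}(\mathbb{R}^n) : \exists\, c \in \mathbb{R} \text{ such that } f - c \in L^p(\mathbb{R}^n) \}$. *)

theory Defs
  imports "HOL-Analysis.Analysis"
begin

definition L1_loc :: "('a::euclidean_space \<Rightarrow> real) set" where
  "L1_loc = {f. \<forall>K. compact K \<longrightarrow> set_integrable lebesgue K f}"

definition L_space :: "real \<Rightarrow> ('a::euclidean_space \<Rightarrow> real) set" where
  "L_space p = {f. f \<in> borel_measurable lebesgue \<and> integrable lebesgue (\<lambda>x. \<bar>f x\<bar> powr p)}"

definition L_space_mod_const :: "real \<Rightarrow> ('a::euclidean_space \<Rightarrow> real) set" where
  "L_space_mod_const p = {f \<in> L1_loc. \<exists>c. (\<lambda>x. f x - c) \<in> L_space p}"

text \<open>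
  Cubes are taken open.  Adding part of the boundary changes no integral over a cube, and
  pairwise disjoint closed or half-open cubes have pairwise disjoint interiors, so the
  families of open cubes include all the others up to null sets.
\<close>

definition is_cube :: "'a::euclidean_space set \<Rightarrow> bool" where
  "is_cube Q \<longleftrightarrow> (\<exists>a l. l > 0 \<and> Q = box a (a + l *\<^sub>R One))"

definition avg :: "'a::euclidean_space set \<Rightarrow> ('a \<Rightarrow> real) \<Rightarrow> real" where
  "avg Q h = (LINT x:Q|lebesgue. h x) / measure lebesgue Q"

text \<open>
  The sums are formed in \<^typ>\<open>ennreal\<close>, where a divergent series has value \<open>\<infinity>\<close>, so the
  inequality includes the convergence of the series.
\<close>

definition JN_bound :: "real \<Rightarrow> ('a::euclidean_space \<Rightarrow> real) \<Rightarrow> real \<Rightarrow> bool" where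
  "JN_bound p f K \<longleftrightarrow> K \<ge> 0 \<and>
     (\<forall>Q :: nat \<Rightarrow> 'a set. (\<forall>i. is_cube (Q i)) \<and> disjoint_family Q \<longrightarrow>
        (\<Sum>i. ennreal (measure lebesgue (Q i) * avg (Q i) (\<lambda>x. \<bar>f x - avg (Q i) f\<bar>) powr p))
          \<le> ennreal (K powr p))"

definition JN_space :: "real \<Rightarrow> ('a::euclidean_space \<Rightarrow> real) set" where
  "JN_space p = {f \<in> L1_loc. \<exists>K. JN_bound p f K}"

definition JN_norm :: "real \<Rightarrow> ('a::euclidean_space \<Rightarrow> real) \<Rightarrow> real" where
  "JN_norm p f = Inf {K. JN_bound p f K}"

text \<open>
  Restricting the approximants to \<^term>\<open>JN_space p\<close> keeps \<^const>\<open>JN_norm\<close> away from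
  arguments outside the space, where the infimum is over the empty set.
\<close>

definition JN_closure ::
  "real \<Rightarrow> ('a::euclidean_space \<Rightarrow> real) set \<Rightarrow> ('a \<Rightarrow> real) set" where
  "JN_closure p A =
     {f \<in> JN_space p. \<forall>e>0. \<exists>g \<in> A \<inter> JN_space p. JN_norm p (\<lambda>x. f x - g x) < e}"

definition partial_deriv ::
  "'a::euclidean_space \<Rightarrow> ('a \<Rightarrow> real) \<Rightarrow> 'a \<Rightarrow> real" where
  "partial_deriv i f x = frechet_derivative f (at x) i"

primrec C_k :: "nat \<Rightarrow> ('a::euclidean_space \<Rightarrow> real) set" where
  "C_k 0 = {f. continuous_on UNIV f}"
| "C_k (Suc k) = {f. (\<forall>x. f differentiable (at x)) \<and> (\<forall>i\<in>Basis. partial_deriv i f \<in> C_k k)}"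

definition C_inf :: "('a::euclidean_space \<Rightarrow> real) set" where
  "C_inf = (\<Inter>k. C_k k)"

definition C_inf_c :: "('a::euclidean_space \<Rightarrow> real) set" where
  "C_inf_c = {f \<in> C_inf. compact (closure {x. f x \<noteq> 0})}"

definition gradient :: "('a::euclidean_space \<Rightarrow> real) \<Rightarrow> 'a \<Rightarrow> 'a" where
  "gradient f x = (\<Sum>i\<in>Basis. partial_deriv i f x *\<^sub>R i)"

definition D_space :: "real \<Rightarrow> ('a::euclidean_space \<Rightarrow> real) set" where
  "D_space p = {f \<in> C_inf. (\<lambda>x. norm (gradient f x)) \<in> L_space p}"

definition VJN_space :: "real \<Rightarrow> ('a::euclidean_space \<Rightarrow> real) set" where
  "VJN_space p = JN_closure p (D_space p \<inter> JN_space p)"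

definition CJN_space :: "real \<Rightarrow> ('a::euclidean_space \<Rightarrow> real) set" where
  "CJN_space p = JN_closure p C_inf_c"

end

theory Submission
  imports Defs
begin

text \<open>
  Both functions are built from one multiplicative cascade on the real line.  Among the four
  quarters of every four-adic interval, the two outer ones carry a factor \<open>A\<close> and the two inner
  ones a factor \<open>B\<close>, where \<open>0 < B < 1 < A\<close>, \<open>A\<^sup>p + B\<^sup>p = 2\<close> and \<open>A + B < 2\<close>.  Let \<open>W\<^sub>j\<close> be the
  product of the first \<open>j\<close> factors.  Over a unit interval, \<open>\<integral> W\<^sub>j\<^sup>p = 1\<close> for every \<open>j\<close>, whereas
  \<open>\<integral> W\<^sub>j = r\<^sup>j\<close> with \<open>r = (A + B) / 2 < 1\<close>.  Take a series \<open>f = \<Sum>c\<^sub>j W\<^sub>j\<close> with \<open>0 \<le> c\<^sub>j \<le> a\<close>, evaluate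
  it at one coordinate of a point of the space, and multiply by a smooth cutoff.

  The result has \<open>JN\<close> bound \<open>C a\<close>, with \<open>C\<close> independent of the coefficients.  Let \<open>Q\<close> be a cube of
  side about \<open>1 / 4\<^sup>k\<close>.  By the geometric decay of \<open>r\<^sup>j\<close>, the terms with \<open>j > k\<close> have average at most
  a multiple of \<open>a W\<^sub>k\<close> on \<open>Q\<close>.  The terms with \<open>j \<le> k\<close> are constant on the intervals of level \<open>k\<close>,
  and their sum changes between neighbouring intervals by at most a multiple of \<open>a W\<^sub>k\<close>: at an
  endpoint of a coarser interval all finer factors on both sides are outer ones, so that the jumps
  of the successive terms there are dominated by a geometric series with ratio \<open>1 / A\<close> ending in
  the weight of level \<open>k\<close>.  Hence the \<open>p\<close>-th power of the oscillation is at most a multiple of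
  \<open>a\<^sup>p W\<^sub>k\<^sup>p\<close>, and \<open>|Q| W\<^sub>k\<^sup>p\<close> is at most a multiple of \<open>\<integral>\<^sub>Q W\<^sub>K\<^sup>p\<close> for all large \<open>K\<close>, because \<open>Q\<close>
  contains an interval of level \<open>k + 2\<close> in the direction of the chosen coordinate.  For finitely
  many disjoint cubes one \<open>K\<close> serves them all, and the sum is bounded by the integral of
  \<open>W\<^sub>K\<^sup>p\<close> over a bounded region, which does not depend on \<open>K\<close>.  The cutoff adds a multiple of
  \<open>a\<^sup>p |Q|\<close>, and cubes with side above \<open>1\<close> are controlled by the \<open>L\<^sup>1\<close> norm.

  For \<open>c\<^sub>j = 1\<close> the oscillation on a four-adic cube of level \<open>m\<close> is at least a fixed multiple of
  \<open>W\<^sub>m\<close>, so the sums over the four-adic cubes inside the unit cube stay above a positive constant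
  as \<open>m\<close> grows.  A continuously differentiable function has oscillation of order \<open>1 / 4\<^sup>m\<close> on
  these cubes, so it cannot be close in \<open>JN\<close> norm, and the function lies outside the
  \<open>VJN\<close> space.

  For \<open>c\<^sub>j = (j + 1) powr (- 1 / p)\<close> the tails of the series tend to \<open>0\<close> in \<open>JN\<close> norm.  The partial
  sums are bounded, and for uniformly bounded functions \<open>L\<^sup>1\<close> convergence implies \<open>JN\<close> convergence,
  so products of the cutoff with polynomials approximate them.  Thus the function is in the
  \<open>CJN\<close> space.  On the other hand \<open>f\<^sup>p \<ge> \<Sum>c\<^sub>j\<^sup>p W\<^sub>j\<^sup>p\<close>, whose integral is the harmonic series.
\<close>

section \<open>Smooth functions and a cutoff\<close>

lemma partial_deriv_eq:
  assumes "(f has_derivative f') (at x)"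
  shows "partial_deriv i f x = f' i"
  using frechet_derivative_at[OF assms] by (simp add: partial_deriv_def)

lemma C_k_SucI:
  assumes "\<And>x. (f has_derivative f' x) (at x)" and "\<And>i. i \<in> Basis \<Longrightarrow> (\<lambda>x. f' x i) \<in> C_k k"
  shows "f \<in> C_k (Suc k)"
proof -
  have "partial_deriv i f = (\<lambda>x. f' x i)" for i
    using partial_deriv_eq[OF assms(1)] by blast
  then show ?thesis
    using assms by (auto simp: differentiable_def)
qed

lemma C_k_SucD_has_derivative:
  assumes "f \<in> C_k (Suc k)"
  shows "(f has_derivative frechet_derivative f (at x)) (at x)"
  using assms by (auto simp: frechet_derivative_works[symmetric])

lemma C_k_SucD_partial:
  assumes "f \<in> C_k (Suc k)" "i \<in> Basis"
  shows "(\<lambda>x. frechet_derivative f (at x) i) \<in> C_k k"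
  using assms by (auto simp: partial_deriv_def[abs_def])

lemma C_k_Suc_subset: "f \<in> C_k (Suc k) \<Longrightarrow> f \<in> C_k k"
proof (induction k arbitrary: f)
  case 0
  then show ?case
    by (auto simp: continuous_on_eq_continuous_at intro: differentiable_imp_continuous_within)
next
  case (Suc k)
  then show ?case by (auto simp del: C_k.simps(1))
qed

lemma C_k_const: "(\<lambda>x. c) \<in> C_k k"
proof (induction k arbitrary: c)
  case (Suc k)
  show ?case by (rule C_k_SucI[where f' = "\<lambda>_ _. 0"]) (use Suc in auto)
qed auto

lemma C_k_bounded_linear:
  assumes "bounded_linear f" shows "f \<in> C_k k"
proof (cases k)
  case 0
  with assms show ?thesis by (auto intro: linear_continuous_on)
next
  case (Suc m)
  show ?thesis unfolding Suc
    by (rule C_k_SucI[where f' = "\<lambda>_. f"]) (auto intro: assms bounded_linear_imp_has_derivative C_k_const)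
qed

lemma C_k_add:
  assumes "f \<in> C_k k" "g \<in> C_k k" shows "(\<lambda>x. f x + g x) \<in> C_k k"
  using assms
proof (induction k arbitrary: f g)
  case 0
  then show ?case by (auto intro: continuous_intros)
next
  case (Suc k)
  show ?case
    by (rule C_k_SucI[OF has_derivative_add[OF Suc.prems[THEN C_k_SucD_has_derivative]]])
       (intro Suc.IH Suc.prems[THEN C_k_SucD_partial])
qed

lemma C_k_mult:
  assumes "f \<in> C_k k" "g \<in> C_k k" shows "(\<lambda>x. f x * g x) \<in> C_k k"
  using assms
proof (induction k arbitrary: f g)
  case 0
  then show ?case by (auto intro: continuous_intros)
next
  case (Suc k)
  show ?case
    by (rule C_k_SucI[OF has_derivative_mult[OF Suc.prems[THEN C_k_SucD_has_derivative]]])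
       (intro C_k_add Suc.IH Suc.prems[THEN C_k_SucD_partial] Suc.prems[THEN C_k_Suc_subset])
qed

lemma C_k_inverse:
  assumes "f \<in> C_k k" "\<And>x. f x \<noteq> 0" shows "(\<lambda>x. inverse (f x)) \<in> C_k k"
  using assms
proof (induction k)
  case 0
  then show ?case by (auto intro: continuous_intros)
next
  case (Suc k)
  have inv: "(\<lambda>x. inverse (f x)) \<in> C_k k"
    using Suc C_k_Suc_subset by blast
  show ?case
  proof (rule C_k_SucI)
    show "((\<lambda>x. inverse (f x)) has_derivative
        (\<lambda>h. (-1) * (inverse (f x) * frechet_derivative f (at x) h * inverse (f x)))) (at x)" for x
      using Deriv.has_derivative_inverse[OF Suc.prems(2) Suc.prems(1)[THEN C_k_SucD_has_derivative], of x]
      by simp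
    show "(\<lambda>x. (-1) * (inverse (f x) * frechet_derivative f (at x) i * inverse (f x))) \<in> C_k k"
      if "i \<in> Basis" for i
      by (intro C_k_mult C_k_const inv C_k_SucD_partial[OF Suc.prems(1) that])
  qed
qed

lemma C_k_prod:
  assumes "finite I" "\<And>i. i \<in> I \<Longrightarrow> f i \<in> C_k k"
  shows "(\<lambda>x. \<Prod>i\<in>I. f i x) \<in> C_k k"
  using assms by (induction I rule: finite_induct) (auto intro: C_k_mult C_k_const)

lemma real_polynomial_function_C_k: "real_polynomial_function P \<Longrightarrow> P \<in> C_k k"
  by (induction P rule: real_polynomial_function.induct)
     (auto intro: C_k_bounded_linear C_k_const C_k_add C_k_mult)

lemma C_k_imp_continuous_on: "f \<in> C_k k \<Longrightarrow> continuous_on S f"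
proof -
  assume "f \<in> C_k k"
  then have "f \<in> C_k 0" by (induction k) (auto simp del: C_k.simps dest: C_k_Suc_subset)
  then show ?thesis by (auto intro: continuous_on_subset)
qed

lemma C_k_Lipschitz_on_compact_convex:
  assumes f: "f \<in> C_k (Suc 0)" and S: "compact S" "convex S"
  obtains L where "L \<ge> 0" "\<And>x y. x \<in> S \<Longrightarrow> y \<in> S \<Longrightarrow> \<bar>f x - f y\<bar> \<le> L * norm (x - y)"
proof -
  let ?D = "\<lambda>x. frechet_derivative f (at x)"
  let ?G = "\<lambda>x. \<Sum>i\<in>Basis. \<bar>?D x i\<bar>"
  have "continuous_on S ?G"
    by (intro continuous_intros C_k_imp_continuous_on[of _ 0] C_k_SucD_partial[OF f])
  then have "bounded (?G ` S)"
    using S compact_continuous_image compact_imp_bounded by blast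
  then obtain L where L: "L > 0" "\<And>x. x \<in> S \<Longrightarrow> \<bar>?G x\<bar> \<le> L"
    unfolding bounded_pos by auto
  have on: "onorm (?D x) \<le> L" if "x \<in> S" for x
  proof (rule onorm_bound)
    show "0 \<le> L" using L by simp
    fix h
    have lin: "linear (?D x)"
      using C_k_SucD_has_derivative[OF f] has_derivative_linear by blast
    have "?D x h = ?D x (\<Sum>i\<in>Basis. (h \<bullet> i) *\<^sub>R i)" by (simp add: euclidean_representation)
    also have "\<dots> = (\<Sum>i\<in>Basis. (h \<bullet> i) * ?D x i)"
      using lin by (simp add: linear_sum linear_scale)
    finally have "norm (?D x h) \<le> (\<Sum>i\<in>Basis. \<bar>h \<bullet> i\<bar> * \<bar>?D x i\<bar>)"
      by (simp add: abs_mult[symmetric])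
    also have "\<dots> \<le> (\<Sum>i\<in>Basis. norm h * \<bar>?D x i\<bar>)"
      by (intro sum_mono mult_right_mono Basis_le_norm) auto
    also have "\<dots> = norm h * ?G x" by (simp add: sum_distrib_left)
    also have "\<dots> \<le> norm h * L"
      using L(2)[OF that] by (intro mult_left_mono) auto
    finally show "norm (?D x h) \<le> L * norm h" by (simp add: mult.commute)
  qed
  have "norm (f x - f y) \<le> L * norm (x - y)" if "x \<in> S" "y \<in> S" for x y
    by (rule differentiable_bound[OF S(2) _ on that])
       (rule has_derivative_at_withinI[OF C_k_SucD_has_derivative[OF f]])
  with L(1) that[of L] show thesis by auto
qed

text \<open>
  These are \<open>exp (- 1 / t)\<close>, extended by \<open>0\<close> to \<open>t \<le> 0\<close>, and its multiples by powers of \<open>1 / t\<close>.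
  The linear span of the family is closed under differentiation, so one induction on the order of
  differentiability, for all \<open>m\<close> at once, shows that its members are smooth.
\<close>

definition flat :: "nat \<Rightarrow> real \<Rightarrow> real" where
  "flat m t = (if t > 0 then exp (- inverse t) * inverse t ^ m else 0)"

lemma flat_tendsto_0: "(flat m \<longlongrightarrow> 0) (at 0)"
proof -
  have "((\<lambda>t. t ^ m * exp (- t)) \<longlongrightarrow> (0::real)) at_top"
    using tendsto_power_div_exp_0[of m] by (simp add: exp_minus field_simps)
  then have "((\<lambda>t. inverse t ^ m * exp (- inverse t)) \<longlongrightarrow> (0::real)) (at_right 0)"
    by (rule filterlim_compose) (rule filterlim_inverse_at_top_right)
  then have r: "(flat m \<longlongrightarrow> 0) (at_right 0)"
    by (rule Lim_transform_eventually)
       (auto simp: flat_def eventually_at_right_field mult.commute intro: exI[of _ 1])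
  have l: "(flat m \<longlongrightarrow> 0) (at_left 0)"
    by (rule Lim_transform_eventually[OF tendsto_const])
       (auto simp: flat_def eventually_at_left_field intro: exI[of _ "-1"])
  from l r show ?thesis by (simp add: filterlim_split_at)
qed

lemma flat_has_derivative:
  "(flat m has_real_derivative flat (m + 2) t - of_nat m * flat (m + 1) t) (at t)"
proof -
  consider "t > 0" | "t < 0" | "t = 0" by linarith
  then show ?thesis
  proof cases
    case 1
    have "((\<lambda>t. exp (- inverse t) * inverse t ^ m) has_real_derivative
            flat (m + 2) t - of_nat m * flat (m + 1) t) (at t)"
    proof -
      have "((\<lambda>t. exp (- inverse t) * inverse t ^ m) has_real_derivative
          exp (- inverse t) * (inverse t * inverse t) * inverse t ^ m
          + exp (- inverse t) * (of_nat m * inverse t ^ (m - 1) * (- (inverse t * inverse t)))) (at t)"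
        using 1 by (auto intro!: derivative_eq_intros)
      moreover have "exp (- inverse t) * (inverse t * inverse t) * inverse t ^ m
          + exp (- inverse t) * (of_nat m * inverse t ^ (m - 1) * (- (inverse t * inverse t)))
          = flat (m + 2) t - of_nat m * flat (m + 1) t"
        using 1 by (cases m) (auto simp: flat_def)
      ultimately show ?thesis by simp
    qed
    then show ?thesis
      by (rule has_field_derivative_transform_within_open[where S = "{0<..}"])
         (use 1 in \<open>auto simp: flat_def\<close>)
  next
    case 2
    have "((\<lambda>t. 0) has_real_derivative flat (m + 2) t - of_nat m * flat (m + 1) t) (at t)"
      using 2 by (auto simp: flat_def)
    then show ?thesis
      by (rule has_field_derivative_transform_within_open[where S = "{..<0}"])
         (use 2 in \<open>auto simp: flat_def\<close>)
  next
    case 3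
    have "(flat m has_real_derivative 0) (at 0)"
      unfolding has_field_derivative_iff
      by (rule Lim_transform_eventually[OF flat_tendsto_0[of "Suc m"]])
         (auto simp: flat_def eventually_at_filter field_simps)
    with 3 show ?thesis by (simp add: flat_def)
  qed
qed

lemma flat_C_k: "(\<lambda>x. flat m (b \<bullet> x + c)) \<in> C_k k"
proof (induction k arbitrary: m)
  case 0
  have "continuous_on UNIV (flat m)"
    by (meson DERIV_isCont continuous_at_imp_continuous_on flat_has_derivative)
  then have "continuous_on UNIV (flat m \<circ> (\<lambda>x. b \<bullet> x + c))"
    by (intro continuous_on_compose continuous_intros) (auto intro: continuous_on_subset)
  then show ?case by (simp add: o_def)
next
  case (Suc k)
  let ?g = "\<lambda>x. flat (m + 2) (b \<bullet> x + c) + (- of_nat m) * flat (m + 1) (b \<bullet> x + c)"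
  show ?case
  proof (rule C_k_SucI)
    show "((\<lambda>x. flat m (b \<bullet> x + c)) has_derivative (\<lambda>h. (b \<bullet> h) * ?g x)) (at x)" for x
    proof -
      have inner: "((\<lambda>x. b \<bullet> x + c) has_derivative (\<lambda>h. b \<bullet> h)) (at x)"
        by (auto intro!: derivative_eq_intros)
      show ?thesis
        using has_derivative_compose[OF inner flat_has_derivative[THEN has_field_derivative_imp_has_derivative], of m]
        by (simp add: mult.commute)
    qed
    show "(\<lambda>x. (b \<bullet> i) * ?g x) \<in> C_k k" for i
      by (intro C_k_mult C_k_const C_k_add Suc.IH)
  qed
qed

definition smooth_step :: "real \<Rightarrow> real" where
  "smooth_step t = flat 0 t * inverse (flat 0 t + flat 0 (1 - t))"

lemma flat_nonneg: "flat m t \<ge> 0" by (auto simp: flat_def)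
lemma flat_pos: "t > 0 \<Longrightarrow> flat m t > 0" by (auto simp: flat_def)
lemma flat_zero: "t \<le> 0 \<Longrightarrow> flat m t = 0" by (auto simp: flat_def)

lemma flat_sum_pos: "flat m t + flat m (1 - t) > 0"
  using flat_pos[of t m] flat_pos[of "1 - t" m] flat_nonneg[of m t] flat_nonneg[of m "1 - t"]
  by (cases "t > 0") (auto intro: add_pos_nonneg add_nonneg_pos)

lemma smooth_step_bounds: "0 \<le> smooth_step t" "smooth_step t \<le> 1"
  using flat_sum_pos[of 0 t] flat_nonneg[of 0 t] flat_nonneg[of 0 "1 - t"]
  by (auto simp: smooth_step_def field_simps)

lemma smooth_step_1: "t \<ge> 1 \<Longrightarrow> smooth_step t = 1"
  using flat_pos[of t 0] by (auto simp: smooth_step_def flat_zero)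

lemma smooth_step_0: "t \<le> 0 \<Longrightarrow> smooth_step t = 0"
  by (auto simp: smooth_step_def flat_zero)

lemma smooth_step_C_k: "(\<lambda>x. smooth_step (b \<bullet> x + c)) \<in> C_k k"
proof -
  have "(\<lambda>x. flat 0 (1 - (b \<bullet> x + c))) \<in> C_k k"
    using flat_C_k[of 0 "-b" "1 - c" k] by (simp add: algebra_simps)
  then have "(\<lambda>x. inverse (flat 0 (b \<bullet> x + c) + flat 0 (1 - (b \<bullet> x + c)))) \<in> C_k k"
    by (intro C_k_inverse C_k_add flat_C_k) (use flat_sum_pos less_irrefl in metis)+
  then show ?thesis
    unfolding smooth_step_def by (intro C_k_mult flat_C_k)
qed

text \<open>
  Along each coordinate the factors rise on the interval from \<open>-1\<close> to \<open>0\<close> and fall on the interval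
  from \<open>1\<close> to \<open>2\<close>.
\<close>

definition cutoff :: "'a::euclidean_space \<Rightarrow> real" where
  "cutoff x = (\<Prod>b\<in>Basis. smooth_step (x \<bullet> b + 1) * smooth_step (2 - x \<bullet> b))"

lemma cutoff_C_k: "(cutoff :: 'a::euclidean_space \<Rightarrow> real) \<in> C_k k"
proof -
  have "(\<lambda>x::'a. smooth_step (x \<bullet> b + 1)) \<in> C_k k" "(\<lambda>x::'a. smooth_step (2 - x \<bullet> b)) \<in> C_k k" for b
    using smooth_step_C_k[of b 1 k] smooth_step_C_k[of "- b" 2 k] by (simp_all add: inner_commute)
  then show ?thesis
    unfolding cutoff_def[abs_def] by (intro C_k_prod C_k_mult) auto
qed

lemma cutoff_bounds: "0 \<le> cutoff x" "cutoff x \<le> 1"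
  unfolding cutoff_def
  by (auto intro!: prod_nonneg prod_le_1 mult_nonneg_nonneg mult_le_one smooth_step_bounds)

lemma cutoff_eq_1: "x \<in> cbox 0 One \<Longrightarrow> cutoff x = 1"
  unfolding cutoff_def by (auto simp: mem_box smooth_step_1 intro!: prod.neutral)

lemma cutoff_eq_0: "x \<notin> box (- One) (2 *\<^sub>R One) \<Longrightarrow> cutoff x = 0"
proof -
  assume "x \<notin> box (- One) (2 *\<^sub>R One)"
  then obtain b where b: "b \<in> Basis" "x \<bullet> b \<le> -1 \<or> 2 \<le> x \<bullet> b"
    by (auto simp: mem_box not_less)
  then have "smooth_step (x \<bullet> b + 1) * smooth_step (2 - x \<bullet> b) = 0"
    using smooth_step_0[of "x \<bullet> b + 1"] smooth_step_0[of "2 - x \<bullet> b"] by auto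
  with b(1) show ?thesis unfolding cutoff_def by (auto intro!: prod_zero)
qed

lemma C_inf_c_cutoff_mult:
  assumes "\<And>k. f \<in> C_k k"
  shows "(\<lambda>x. cutoff x * f x) \<in> C_inf_c"
proof -
  have "{x. cutoff x * f x \<noteq> 0} \<subseteq> box (- One) (2 *\<^sub>R One)"
    using cutoff_eq_0 by fastforce
  then have "bounded {x. cutoff x * f x \<noteq> 0}"
    using bounded_box bounded_subset by blast
  then show ?thesis
    unfolding C_inf_c_def C_inf_def using C_k_mult[OF cutoff_C_k assms] by auto
qed

lemma cutoff_Lipschitz:
  obtains L where "L \<ge> 0" "\<And>x y::'a::euclidean_space. x \<in> cbox (-2 *\<^sub>R One) (3 *\<^sub>R One) \<Longrightarrow>
     y \<in> cbox (-2 *\<^sub>R One) (3 *\<^sub>R One) \<Longrightarrow> \<bar>cutoff x - cutoff y\<bar> \<le> L * norm (x - y)"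
  using C_k_Lipschitz_on_compact_convex[OF cutoff_C_k compact_cbox convex_box(1)] by metis

section \<open>The four-adic cascade\<close>

text \<open>
  The integer \<open>m\<close> numbers the interval from \<open>m / 4\<^sup>k\<close> to \<open>(m + 1) / 4\<^sup>k\<close>.  Both outer quarters get
  the same factor: two neighbouring intervals with different parents then get equal factors, which
  keeps neighbouring weights comparable.
\<close>

definition digit :: "real \<Rightarrow> real \<Rightarrow> int \<Rightarrow> real" where
  "digit A B m = (if m mod 4 = 0 \<or> m mod 4 = 3 then A else B)"

primrec weight :: "real \<Rightarrow> real \<Rightarrow> nat \<Rightarrow> int \<Rightarrow> real" where
  "weight A B 0 m = 1"
| "weight A B (Suc k) m = digit A B m * weight A B k (m div 4)"

definition cascade :: "real \<Rightarrow> real \<Rightarrow> nat \<Rightarrow> real \<Rightarrow> real" where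
  "cascade A B k t = weight A B k \<lfloor>4 ^ k * t\<rfloor>"

lemma digit_pos: "0 < A \<Longrightarrow> 0 < B \<Longrightarrow> 0 < digit A B m"
  by (simp add: digit_def)

lemma weight_pos: "0 < A \<Longrightarrow> 0 < B \<Longrightarrow> 0 < weight A B k m"
  by (induction k arbitrary: m) (auto simp: digit_pos)

lemma cascade_pos: "0 < A \<Longrightarrow> 0 < B \<Longrightarrow> 0 < cascade A B k t"
  by (simp add: cascade_def weight_pos)

lemma weight_powr:
  assumes "0 < A" "0 < B"
  shows "weight A B k m powr p = weight (A powr p) (B powr p) k m"
proof (induction k arbitrary: m)
  case (Suc k)
  have "digit A B m powr p = digit (A powr p) (B powr p) m" by (simp add: digit_def)
  with Suc show ?case
    using assms by (simp add: powr_mult less_imp_le digit_pos weight_pos)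
qed simp

lemma cascade_powr:
  "0 < A \<Longrightarrow> 0 < B \<Longrightarrow> cascade A B k t powr p = cascade (A powr p) (B powr p) k t"
  by (simp add: cascade_def weight_powr)

lemma floor_four_power_div: "\<lfloor>4 ^ k * t\<rfloor> = \<lfloor>4 ^ Suc k * t\<rfloor> div 4" for t :: real
  using floor_divide_real_eq_div[of 4 "4 ^ Suc k * t"] by simp

lemma weight_le_power:
  assumes "0 < B" "B \<le> A" shows "weight A B k m \<le> A ^ k"
proof (induction k arbitrary: m)
  case (Suc k)
  have "digit A B m * weight A B k (m div 4) \<le> A * A ^ k"
    using assms Suc by (intro mult_mono) (auto simp: digit_def less_imp_le weight_pos)
  then show ?case by simp
qed simp

lemma cascade_measurable [measurable]: "cascade A B k \<in> borel_measurable borel"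
proof -
  have "(\<lambda>t. weight A B k \<lfloor>4 ^ k * t\<rfloor>) \<in> borel_measurable (borel :: real measure)"
    by (rule measurable_compose[where N = "count_space UNIV"]) measurable
  then show ?thesis by (simp add: cascade_def[abs_def])
qed

lemma div_four_succ:
  fixes m :: int
  shows "(m + 1) div 4 = m div 4 \<or> (m + 1) div 4 = m div 4 + 1 \<and> m mod 4 = 3 \<and> (m + 1) mod 4 = 0"
  by presburger

text \<open>
  Going down one level, neighbours either have a common parent, so that only the last factors differ,
  or have neighbouring parents and the same last factor \<open>A\<close>, so that the ratio is inherited.
\<close>

lemma weight_adjacent:
  assumes "0 < B" "B < A"
  shows "weight A B k (m + 1) \<le> A / B * weight A B k m"
    and "weight A B k m \<le> A / B * weight A B k (m + 1)"
proof -
  have dig: "digit A B x \<le> A / B * digit A B y" for x y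
    using assms by (auto simp: digit_def field_simps intro: mult_mono)
  have AB: "1 \<le> A / B" using assms by simp
  have "weight A B k (m + 1) \<le> A / B * weight A B k m \<and> weight A B k m \<le> A / B * weight A B k (m + 1)"
  proof (induction k arbitrary: m)
    case 0
    show ?case using AB by simp
  next
    case (Suc k)
    show ?case using div_four_succ[of m]
    proof
      assume eq: "(m + 1) div 4 = m div 4"
      have w: "0 \<le> weight A B k (m div 4)" using assms by (simp add: less_imp_le weight_pos)
      show ?thesis
        using mult_right_mono[OF dig[of "m + 1" m] w] mult_right_mono[OF dig[of m "m + 1"] w]
        by (simp add: eq)
    next
      assume eq: "(m + 1) div 4 = m div 4 + 1 \<and> m mod 4 = 3 \<and> (m + 1) mod 4 = 0"
      then have "digit A B (m + 1) = A" "digit A B m = A" by (simp_all add: digit_def)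
      moreover have "A * weight A B k (m div 4 + 1) \<le> A * (A / B * weight A B k (m div 4))"
        "A * weight A B k (m div 4) \<le> A * (A / B * weight A B k (m div 4 + 1))"
        using Suc[of "m div 4"] assms by (auto intro!: mult_left_mono simp del: times_divide_eq_left)
      ultimately show ?thesis using eq by (simp add: mult.left_commute)
    qed
  qed
  then show "weight A B k (m + 1) \<le> A / B * weight A B k m"
    and "weight A B k m \<le> A / B * weight A B k (m + 1)" by auto
qed

text \<open>
  This is the value of \<open>\<Sum>j\<le>k. c\<^sub>j W\<^sub>j\<close> on the interval of level \<open>k\<close> with number \<open>m\<close>.
\<close>

primrec cell_partial_sum :: "real \<Rightarrow> real \<Rightarrow> (nat \<Rightarrow> real) \<Rightarrow> nat \<Rightarrow> int \<Rightarrow> real" where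
  "cell_partial_sum A B c 0 m = c 0"
| "cell_partial_sum A B c (Suc k) m = cell_partial_sum A B c k (m div 4) + c (Suc k) * weight A B (Suc k) m"

lemma sum_cascade_eq_cell_partial_sum:
  "(\<Sum>j\<le>k. c j * cascade A B j t) = cell_partial_sum A B c k \<lfloor>4 ^ k * t\<rfloor>"
proof (induction k)
  case 0
  then show ?case by (simp add: cascade_def)
next
  case (Suc k)
  then show ?case
    by (simp add: cascade_def floor_four_power_div[of k] del: weight.simps power_Suc)
qed

lemma cell_partial_sum_bounds:
  assumes "0 < B" "B < A" "1 < A" "0 \<le> a" "\<And>j. 0 \<le> c j \<and> c j \<le> a"
  shows "0 \<le> cell_partial_sum A B c k m" "cell_partial_sum A B c k m \<le> a * (of_nat k + 1) * A ^ k"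
proof -
  have "0 \<le> cell_partial_sum A B c k m \<and> cell_partial_sum A B c k m \<le> a * (of_nat k + 1) * A ^ k"
  proof (induction k arbitrary: m)
    case 0
    with assms show ?case by simp
  next
    case (Suc k)
    have w: "0 \<le> c (Suc k) * weight A B (Suc k) m" "c (Suc k) * weight A B (Suc k) m \<le> a * A ^ Suc k"
      using assms weight_le_power[of B A "Suc k" m] weight_pos[of A B "Suc k" m]
      by (auto intro!: mult_mono mult_nonneg_nonneg simp del: weight.simps power_Suc)
    have "a * (of_nat k + 1) * A ^ k \<le> a * (of_nat k + 1) * A ^ Suc k"
      using assms by (intro mult_left_mono power_increasing) auto
    with Suc[of "m div 4"] w show ?case
      by (auto simp: algebra_simps simp del: weight.simps power_Suc)
  qed
  then show "0 \<le> cell_partial_sum A B c k m" "cell_partial_sum A B c k m \<le> a * (of_nat k + 1) * A ^ k" by auto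
qed

text \<open>
  Let \<open>D\<close> be the constant.  For neighbours with a common parent only the last term differs, which
  costs \<open>1 + A / B\<close>.  Otherwise the difference at the parents is inherited, but the weight has been
  multiplied by \<open>A\<close>, so \<open>D\<close> only has to satisfy \<open>D / A + (1 + A / B) \<le> D\<close>; the constant below
  gives equality.  Here \<open>A > 1\<close> is essential.
\<close>

lemma cell_partial_sum_adjacent:
  assumes "0 < B" "B < A" "1 < A" "0 \<le> a" "\<And>j. 0 \<le> c j \<and> c j \<le> a"
  shows "\<bar>cell_partial_sum A B c k (m + 1) - cell_partial_sum A B c k m\<bar>
    \<le> (1 + A / B) * A / (A - 1) * a * weight A B k m"
proof (induction k arbitrary: m)
  case 0
  show ?case using assms by (auto intro!: mult_nonneg_nonneg divide_nonneg_pos)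
next
  case (Suc k)
  define D where "D = (1 + A / B) * A / (A - 1)"
  have D: "D * (A - 1) = (1 + A / B) * A" and D0: "D \<ge> 1 + A / B"
    using assms by (auto simp: D_def field_simps)
  let ?w = "weight A B (Suc k)"
  have wp: "0 < ?w x" for x using assms by (intro weight_pos) auto
  have "\<bar>?w (m + 1) - ?w m\<bar> \<le> (1 + A / B) * ?w m"
    using weight_adjacent(1)[OF assms(1,2), of "Suc k" m] wp[of m] wp[of "m + 1"]
    by (simp add: algebra_simps del: weight.simps)
  then have cw: "\<bar>c (Suc k) * (?w (m + 1) - ?w m)\<bar> \<le> a * ((1 + A / B) * ?w m)"
    unfolding abs_mult using assms(5)[of "Suc k"] by (intro mult_mono) auto
  have aw: "0 \<le> a * ?w m" using assms(4) wp[of m] by simp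
  show ?case using div_four_succ[of m]
  proof
    assume eq: "(m + 1) div 4 = m div 4"
    have "\<bar>cell_partial_sum A B c (Suc k) (m + 1) - cell_partial_sum A B c (Suc k) m\<bar> = \<bar>c (Suc k) * (?w (m + 1) - ?w m)\<bar>"
      by (simp only: cell_partial_sum.simps eq) (simp add: right_diff_distrib del: weight.simps)
    also have "\<dots> \<le> (1 + A / B) * (a * ?w m)" using cw by (simp add: mult_ac)
    also have "\<dots> \<le> D * (a * ?w m)" by (intro mult_right_mono D0 aw)
    finally show ?thesis by (simp add: D_def mult_ac)
  next
    assume eq: "(m + 1) div 4 = m div 4 + 1 \<and> m mod 4 = 3 \<and> (m + 1) mod 4 = 0"
    then have w: "?w m = A * weight A B k (m div 4)" by (simp add: digit_def)
    have "\<bar>cell_partial_sum A B c (Suc k) (m + 1) - cell_partial_sum A B c (Suc k) m\<bar>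
       = \<bar>(cell_partial_sum A B c k (m div 4 + 1) - cell_partial_sum A B c k (m div 4)) + c (Suc k) * (?w (m + 1) - ?w m)\<bar>"
      using eq by (simp only: cell_partial_sum.simps) (simp add: right_diff_distrib del: weight.simps)
    also have "\<dots> \<le> D * a * weight A B k (m div 4) + a * ((1 + A / B) * ?w m)"
      using Suc[of "m div 4"] cw unfolding D_def by linarith
    also have "\<dots> = (D + (1 + A / B) * A) * a * weight A B k (m div 4)"
      by (simp add: w algebra_simps del: weight.simps)
    also have "D + (1 + A / B) * A = D * A" using D by (simp add: right_diff_distrib)
    also have "D * A * a * weight A B k (m div 4) = D * a * ?w m" unfolding w by simp
    finally show ?thesis by (simp add: D_def)
  qed
qed

definition cell :: "nat \<Rightarrow> int \<Rightarrow> real set" where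
  "cell k m = {of_int m / 4 ^ k ..< (of_int m + 1) / 4 ^ k}"

lemma mem_cell_iff: "t \<in> cell k m \<longleftrightarrow> \<lfloor>4 ^ k * t\<rfloor> = m"
  by (auto simp: cell_def floor_eq_iff field_simps)

lemma cell_borel [measurable]: "cell k m \<in> sets borel" by (simp add: cell_def)

lemma emeasure_cell: "emeasure lborel (cell k m) = ennreal (1 / 4 ^ k)"
  by (simp add: cell_def divide_right_mono emeasure_lborel_Ico diff_divide_distrib[symmetric])

lemma indicator_cell_split:
  "(indicator (cell k m) t :: ennreal) = (\<Sum>d\<in>{0..<4}. indicator (cell (Suc k) (4 * m + d)) t)"
proof -
  let ?n = "\<lfloor>4 ^ Suc k * t\<rfloor>"
  have "(\<Sum>d\<in>{0..<4}. indicator (cell (Suc k) (4 * m + d)) t :: ennreal)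
      = (\<Sum>d\<in>{0..<4}. if d = ?n - 4 * m then 1 else 0)"
    by (intro sum.cong refl) (auto simp: indicator_def mem_cell_iff simp del: power_Suc)
  also have "\<dots> = (if ?n - 4 * m \<in> {0..<4} then 1 else 0)" by simp
  also have "?n - 4 * m \<in> {0..<4} \<longleftrightarrow> ?n div 4 = m" by auto
  finally show ?thesis by (auto simp: indicator_def mem_cell_iff floor_four_power_div[of k] simp del: power_Suc)
qed

text \<open>
  Each refinement step multiplies the integral by the mean of the four factors of the quarters.
\<close>

lemma nn_integral_cascade_cell:
  assumes "0 < A" "0 < B"
  shows "(\<integral>\<^sup>+t. ennreal (cascade A B (k + d) t) * indicator (cell k m) t \<partial>lborel)
    = ennreal (weight A B k m * ((A + B) / 2) ^ d / 4 ^ k)"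
proof (induction d arbitrary: k m)
  case 0
  have "(\<integral>\<^sup>+t. ennreal (cascade A B k t) * indicator (cell k m) t \<partial>lborel)
      = (\<integral>\<^sup>+t. ennreal (weight A B k m) * indicator (cell k m) t \<partial>lborel)"
    by (intro nn_integral_cong) (auto simp: indicator_def cascade_def mem_cell_iff)
  also have "\<dots> = ennreal (weight A B k m) * ennreal (1 / 4 ^ k)"
    by (subst nn_integral_cmult_indicator) (auto simp: emeasure_cell)
  also have "\<dots> = ennreal (weight A B k m * (1 / 4 ^ k))"
    using assms by (subst ennreal_mult) (auto simp: less_imp_le weight_pos)
  finally show ?case by simp
next
  case (Suc d)
  let ?w = "weight A B k m * ((A + B) / 2) ^ d / 4 ^ Suc k"
  have "(\<integral>\<^sup>+t. ennreal (cascade A B (k + Suc d) t) * indicator (cell k m) t \<partial>lborel)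
      = (\<integral>\<^sup>+t. (\<Sum>e\<in>{0..<4}. ennreal (cascade A B (Suc k + d) t) * indicator (cell (Suc k) (4 * m + e)) t) \<partial>lborel)"
    by (subst indicator_cell_split) (simp add: sum_distrib_left del: power_Suc)
  also have "\<dots> = (\<Sum>e\<in>{0..<4}. ennreal (weight A B (Suc k) (4 * m + e) * ((A + B) / 2) ^ d / 4 ^ Suc k))"
    by (subst nn_integral_sum) (measurable, simp only: Suc)
  also have "\<dots> = ennreal (\<Sum>e\<in>{0..<4}. weight A B (Suc k) (4 * m + e) * ((A + B) / 2) ^ d / 4 ^ Suc k)"
    using assms by (intro sum_ennreal divide_nonneg_pos mult_nonneg_nonneg less_imp_le[OF weight_pos]) auto
  also have "(\<Sum>e\<in>{0..<4}. weight A B (Suc k) (4 * m + e) * ((A + B) / 2) ^ d / 4 ^ Suc k)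
      = (\<Sum>e\<in>{0..<4::int}. digit A B e * ?w)"
  proof (rule sum.cong[OF refl])
    fix e :: int assume "e \<in> {0..<4}"
    then have "(4 * m + e) div 4 = m" "digit A B (4 * m + e) = digit A B e"
      by (auto simp: digit_def)
    then show "weight A B (Suc k) (4 * m + e) * ((A + B) / 2) ^ d / 4 ^ Suc k = digit A B e * ?w" by simp
  qed
  also have "\<dots> = (\<Sum>e\<in>{0,1,2,3::int}. digit A B e) * ?w"
    by (subst sum_distrib_right) (intro sum.cong, auto)
  also have "\<dots> = weight A B k m * ((A + B) / 2) ^ Suc d / 4 ^ k"
    by (simp add: digit_def field_simps)
  finally show ?case .
qed

lemma nn_integral_cascade_block:
  assumes "0 < A" "0 < B"
  shows "(\<integral>\<^sup>+t. ennreal (cascade A B j t) * indicator {of_int M ..< of_int M + of_nat N} t \<partial>lborel)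
    = ennreal (of_nat N * ((A + B) / 2) ^ j)"
proof (induction N)
  case 0
  show ?case by simp
next
  case (Suc N)
  have "(\<integral>\<^sup>+t. ennreal (cascade A B j t) * indicator {of_int M ..< of_int M + of_nat (Suc N)} t \<partial>lborel)
    = (\<integral>\<^sup>+t. ennreal (cascade A B j t) * indicator {of_int M ..< of_int M + of_nat N} t
       + ennreal (cascade A B (0 + j) t) * indicator (cell 0 (M + int N)) t \<partial>lborel)"
  proof (rule nn_integral_cong)
    fix t :: real
    have "indicator {of_int M ..< of_int M + of_nat (Suc N)} t
        = (indicator {of_int M ..< of_int M + of_nat N} t + indicator (cell 0 (M + int N)) t :: ennreal)"
      by (auto simp: indicator_def cell_def)
    then show "ennreal (cascade A B j t) * indicator {of_int M ..< of_int M + of_nat (Suc N)} t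
      = ennreal (cascade A B j t) * indicator {of_int M ..< of_int M + of_nat N} t
       + ennreal (cascade A B (0 + j) t) * indicator (cell 0 (M + int N)) t"
      by (simp only: distrib_left add_0)
  qed
  also have "\<dots> = ennreal (of_nat N * ((A + B) / 2) ^ j) + ennreal (((A + B) / 2) ^ j)"
    using nn_integral_cascade_cell[OF assms, of 0 j "M + int N"]
    by (subst nn_integral_add) (measurable, simp only: Suc weight.simps power_0 mult_1 div_by_1)
  also have "\<dots> = ennreal (of_nat (Suc N) * ((A + B) / 2) ^ j)"
    using assms by (subst ennreal_plus[symmetric]) (auto simp: algebra_simps intro!: mult_nonneg_nonneg)
  finally show ?case .
qed

text \<open>
  Let \<open>B\<close> be half the gap between \<open>s = 2 powr (1 / p)\<close> and \<open>2\<close>.  Since \<open>A\<^sup>p < 2\<close> gives \<open>A < s\<close>, the sum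
  \<open>A + B\<close> is below \<open>2\<close>.
\<close>

lemma obtain_factors:
  assumes "1 < (p::real)"
  obtains A B :: real where "0 < B" "B < 1" "1 < A" "A < 2" "A + B < 2" "A powr p + B powr p = 2"
proof -
  define s where "s = 2 powr (1 / p)"
  define B where "B = (2 - s) / 2"
  define A where "A = (2 - B powr p) powr (1 / p)"
  have s: "1 < s" "s < 2"
    unfolding s_def using assms powr_less_mono[of 0 "1 / p" 2] powr_less_mono[of "1 / p" 1 2] by simp_all
  then have B: "0 < B" "B < 1 / 2" by (auto simp: B_def)
  have Bp: "0 < B powr p" "B powr p < 1" using B assms powr_less_mono2[of p B 1] by simp_all
  have "A powr p = 2 - B powr p" using Bp assms by (simp add: A_def powr_powr)
  moreover have "1 < A"
    using Bp assms powr_less_mono2[of "1/p" 1 "2 - B powr p"] by (auto simp: A_def)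
  moreover have "A < s"
    using Bp assms powr_less_mono2[of "1/p" "2 - B powr p" 2] by (auto simp: A_def s_def)
  moreover have "A + B < 2" using \<open>A < s\<close> s by (simp add: B_def field_simps)
  ultimately show thesis using that[of B A] B s by auto
qed

section \<open>Oscillation and JN bounds\<close>

definition osc :: "'a::euclidean_space set \<Rightarrow> ('a \<Rightarrow> real) \<Rightarrow> real" where
  "osc Q f = avg Q (\<lambda>x. \<bar>f x - avg Q f\<bar>)"

lemma is_cubeE:
  assumes "is_cube Q"
  obtains a l where "0 < l" "Q = box a (a + l *\<^sub>R One)"
  using assms by (auto simp: is_cube_def)

lemma measure_cube:
  "0 < l \<Longrightarrow> measure lebesgue (box a (a + l *\<^sub>R One :: 'a::euclidean_space)) = l ^ DIM('a)"
  by (simp add: measure_completion measure_lborel_box_eq inner_add_left)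

lemma emeasure_cube:
  "0 < l \<Longrightarrow> emeasure lborel (box a (a + l *\<^sub>R One :: 'a::euclidean_space)) = ennreal (l ^ DIM('a))"
  by (simp add: emeasure_lborel_box_eq inner_add_left)

lemma measure_cube_pos: "is_cube Q \<Longrightarrow> 0 < measure lebesgue Q"
  by (erule is_cubeE) (simp only: measure_cube zero_less_power)

lemma cube_borel: "is_cube Q \<Longrightarrow> Q \<in> sets borel"
  by (auto elim!: is_cubeE)

lemma cube_lmeasurable: "is_cube Q \<Longrightarrow> Q \<in> lmeasurable"
  by (auto elim!: is_cubeE)

lemma set_integrable_cube_const: "is_cube Q \<Longrightarrow> set_integrable lebesgue Q (\<lambda>x. c::real)"
proof -
  assume "is_cube Q"
  then have "integrable lebesgue (indicat_real Q)"
    using cube_lmeasurable by (simp only: lmeasurable_iff_integrable)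
  then show ?thesis by (simp add: set_integrable_def)
qed

lemma L1_loc_cube: "f \<in> L1_loc \<Longrightarrow> is_cube Q \<Longrightarrow> set_integrable lebesgue Q f"
proof -
  assume f: "f \<in> L1_loc" and "is_cube Q"
  then obtain a l where Q: "Q = box a (a + l *\<^sub>R One)" by (auto elim: is_cubeE)
  have "set_integrable lebesgue (cbox a (a + l *\<^sub>R One)) f"
    using f by (auto simp: L1_loc_def)
  then show ?thesis
    unfolding Q by (rule set_integrable_subset) (auto simp: box_subset_cbox)
qed

lemma L1_loc_integrable: "integrable lebesgue f \<Longrightarrow> f \<in> L1_loc"
  unfolding L1_loc_def set_integrable_def
  using integrable_mult_indicator[of _ lebesgue f] by (auto simp: lmeasurable_compact fmeasurableD)

lemma L1_loc_add: "f \<in> L1_loc \<Longrightarrow> g \<in> L1_loc \<Longrightarrow> (\<lambda>x. f x + g x) \<in> L1_loc"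
  by (auto simp: L1_loc_def intro: set_integral_add)

lemma L1_loc_diff: "f \<in> L1_loc \<Longrightarrow> g \<in> L1_loc \<Longrightarrow> (\<lambda>x. f x - g x) \<in> L1_loc"
  by (auto simp: L1_loc_def intro: set_integral_diff)

context
  fixes Q :: "'a::euclidean_space set"
  assumes Q: "is_cube Q"
begin

lemma avg_const: "avg Q (\<lambda>x. c) = c"
  using measure_cube_pos[OF Q] cube_lmeasurable[OF Q]
  by (simp add: avg_def set_lebesgue_integral_def fmeasurable_def)

lemma avg_add:
  "set_integrable lebesgue Q f \<Longrightarrow> set_integrable lebesgue Q g \<Longrightarrow> avg Q (\<lambda>x. f x + g x) = avg Q f + avg Q g"
  by (simp add: avg_def set_integral_add add_divide_distrib)

lemma avg_diff:
  "set_integrable lebesgue Q f \<Longrightarrow> set_integrable lebesgue Q g \<Longrightarrow> avg Q (\<lambda>x. f x - g x) = avg Q f - avg Q g"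
  by (simp add: avg_def set_integral_diff diff_divide_distrib)

lemma avg_mono:
  "set_integrable lebesgue Q f \<Longrightarrow> set_integrable lebesgue Q g \<Longrightarrow> (\<And>x. x \<in> Q \<Longrightarrow> f x \<le> g x)
    \<Longrightarrow> avg Q f \<le> avg Q g"
  unfolding avg_def by (intro divide_right_mono set_integral_mono) auto

lemma avg_nonneg: "(\<And>x. 0 \<le> f x) \<Longrightarrow> 0 \<le> avg Q f"
  unfolding avg_def set_lebesgue_integral_def by (intro divide_nonneg_nonneg integral_nonneg_AE) auto

lemma abs_avg_le: "set_integrable lebesgue Q f \<Longrightarrow> \<bar>avg Q f\<bar> \<le> avg Q (\<lambda>x. \<bar>f x\<bar>)"
proof -
  assume f: "set_integrable lebesgue Q f"
  then have "avg Q f \<le> avg Q (\<lambda>x. \<bar>f x\<bar>)" "avg Q (\<lambda>x. - f x) \<le> avg Q (\<lambda>x. \<bar>f x\<bar>)"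
    by (auto intro!: avg_mono set_integrable_abs simp: set_integrable_def)
  then show ?thesis by (simp add: avg_def set_lebesgue_integral_def)
qed

lemma osc_nonneg: "0 \<le> osc Q f"
  unfolding osc_def by (rule avg_nonneg) auto

lemma osc_le_avg_diff:
  assumes f: "set_integrable lebesgue Q f"
  shows "osc Q f \<le> 2 * avg Q (\<lambda>x. \<bar>f x - c\<bar>)"
proof -
  note [simp] = set_integrable_cube_const[OF Q]
  have i: "set_integrable lebesgue Q (\<lambda>x. f x - b)" for b using f by (intro set_integral_diff) simp_all
  have "avg Q f - c = avg Q (\<lambda>x. f x - c)" using f by (simp add: avg_diff avg_const)
  then have d: "\<bar>avg Q f - c\<bar> \<le> avg Q (\<lambda>x. \<bar>f x - c\<bar>)" using abs_avg_le[OF i[of c]] by simp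
  have "osc Q f \<le> avg Q (\<lambda>x. \<bar>f x - c\<bar> + \<bar>avg Q f - c\<bar>)"
    unfolding osc_def by (intro avg_mono set_integrable_abs set_integral_add i) auto
  also have "\<dots> = avg Q (\<lambda>x. \<bar>f x - c\<bar>) + \<bar>avg Q f - c\<bar>"
    using set_integrable_abs[OF i] by (simp add: avg_add avg_const)
  finally show ?thesis using d by linarith
qed

lemma osc_add_le:
  assumes f: "set_integrable lebesgue Q f" and g: "set_integrable lebesgue Q g"
  shows "osc Q (\<lambda>x. f x + g x) \<le> osc Q f + osc Q g"
proof -
  note [simp] = set_integrable_cube_const[OF Q]
  have i: "set_integrable lebesgue Q (\<lambda>x. \<bar>f x - avg Q f\<bar>)" "set_integrable lebesgue Q (\<lambda>x. \<bar>g x - avg Q g\<bar>)"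
    using f g by (auto intro!: set_integrable_abs set_integral_diff)
  have "osc Q (\<lambda>x. f x + g x) \<le> avg Q (\<lambda>x. \<bar>f x - avg Q f\<bar> + \<bar>g x - avg Q g\<bar>)"
    unfolding osc_def avg_add[OF f g]
    using f g i by (intro avg_mono set_integrable_abs set_integral_diff set_integral_add) auto
  also have "\<dots> = osc Q f + osc Q g" using i by (simp add: avg_add osc_def)
  finally show ?thesis .
qed

end

lemma JN_bound_alt:
  "JN_bound p f K \<longleftrightarrow> K \<ge> 0 \<and> (\<forall>Q :: nat \<Rightarrow> 'a::euclidean_space set. (\<forall>i. is_cube (Q i)) \<and> disjoint_family Q \<longrightarrow>
        (\<Sum>i. ennreal (measure lebesgue (Q i) * osc (Q i) f powr p)) \<le> ennreal (K powr p))"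
  by (simp add: JN_bound_def osc_def)

lemma sum_indicator_disjoint_le:
  assumes "disjoint_family Q"
  shows "(\<Sum>i<(M::nat). indicator (Q i) x :: ennreal) \<le> 1"
proof (cases "\<exists>i<M. x \<in> Q i")
  case True
  then obtain i where i: "i < M" "x \<in> Q i" by auto
  then have "(\<Sum>j<M. indicator (Q j) x :: ennreal) = (\<Sum>j<M. if j = i then 1 else 0)"
    using assms by (intro sum.cong) (auto simp: indicator_def disjoint_family_on_def)
  with i show ?thesis by simp
next
  case False
  then show ?thesis by (simp add: indicator_def)
qed

text \<open>
  The density \<open>w K\<close> may depend on a parameter \<open>K\<close> that has to be large in terms of the cube.
  A partial sum of the series over a family of cubes involves finitely many cubes, so that one \<open>K\<close>
  serves them all, and disjointness bounds the partial sum by the total mass of \<open>w K\<close>.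
\<close>

lemma JN_bound_by_density:
  fixes f :: "'a::euclidean_space \<Rightarrow> real" and w :: "nat \<Rightarrow> 'a \<Rightarrow> ennreal"
  assumes [measurable]: "\<And>K. w K \<in> borel_measurable borel"
    and loc: "\<And>Q. is_cube Q \<Longrightarrow> \<exists>K\<^sub>0. \<forall>K\<ge>K\<^sub>0.
        ennreal (measure lebesgue Q * osc Q f powr p) \<le> (\<integral>\<^sup>+x. w K x * indicator Q x \<partial>lborel)"
    and total: "\<And>K. (\<integral>\<^sup>+x. w K x \<partial>lborel) \<le> ennreal (C powr p)"
    and "0 \<le> C"
  shows "JN_bound p f C"
  unfolding JN_bound_alt
proof (intro conjI allI impI)
  show "0 \<le> C" by fact
  fix Q :: "nat \<Rightarrow> 'a set"
  assume Q: "(\<forall>i. is_cube (Q i)) \<and> disjoint_family Q"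
  have [measurable]: "Q i \<in> sets borel" for i using Q cube_borel by auto
  have "\<forall>i. \<exists>K\<^sub>0. \<forall>K\<ge>K\<^sub>0.
        ennreal (measure lebesgue (Q i) * osc (Q i) f powr p) \<le> (\<integral>\<^sup>+x. w K x * indicator (Q i) x \<partial>lborel)"
    using loc Q by blast
  then obtain K0 where K0: "\<And>i K. K \<ge> K0 i \<Longrightarrow>
        ennreal (measure lebesgue (Q i) * osc (Q i) f powr p) \<le> (\<integral>\<^sup>+x. w K x * indicator (Q i) x \<partial>lborel)"
    by metis
  have "(\<Sum>i<M. ennreal (measure lebesgue (Q i) * osc (Q i) f powr p)) \<le> ennreal (C powr p)" for M
  proof -
    define K where "K = Max (insert 0 (K0 ` {..<M}))"
    have K: "K0 i \<le> K" if "i < M" for i using that by (auto simp: K_def intro!: Max_ge)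
    have "(\<Sum>i<M. ennreal (measure lebesgue (Q i) * osc (Q i) f powr p))
        \<le> (\<Sum>i<M. \<integral>\<^sup>+x. w K x * indicator (Q i) x \<partial>lborel)"
      using K0 K by (intro sum_mono) auto
    also have "\<dots> = (\<integral>\<^sup>+x. w K x * (\<Sum>i<M. indicator (Q i) x) \<partial>lborel)"
      by (simp add: nn_integral_sum[symmetric] sum_distrib_left)
    also have "\<dots> \<le> (\<integral>\<^sup>+x. w K x * 1 \<partial>lborel)"
      using Q by (intro nn_integral_mono mult_left_mono sum_indicator_disjoint_le) auto
    also have "\<dots> \<le> ennreal (C powr p)" using total by simp
    finally show ?thesis .
  qed
  then show "(\<Sum>i. ennreal (measure lebesgue (Q i) * osc (Q i) f powr p)) \<le> ennreal (C powr p)"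
    by (intro suminf_le_const summableI)
qed

lemma powr_add_le:
  assumes "0 \<le> (x::real)" "0 \<le> y" "0 < p"
  shows "(x + y) powr p \<le> 2 powr p * (x powr p + y powr p)"
proof -
  have "(x + y) powr p \<le> (2 * max x y) powr p" using assms by (intro powr_mono2) auto
  also have "\<dots> = 2 powr p * max x y powr p" using assms by (simp add: powr_mult)
  also have "\<dots> \<le> 2 powr p * (x powr p + y powr p)"
    by (intro mult_left_mono) (auto simp: max_def)
  finally show ?thesis .
qed

text \<open>
  Each of \<open>x\<close> and \<open>y\<close> is at most \<open>x + y\<close>, so \<open>x\<^sup>p \<le> x (x + y) powr (p - 1)\<close>, and likewise for \<open>y\<close>.
\<close>

lemma powr_superadditive:
  assumes "0 \<le> (x::real)" "0 \<le> y" "1 \<le> p"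
  shows "x powr p + y powr p \<le> (x + y) powr p"
proof (cases "x + y = 0")
  case True
  then have "x = 0" "y = 0" using assms by linarith+
  then show ?thesis by simp
next
  case False
  then have s: "0 < x + y" using assms by auto
  have "z powr p \<le> z * (x + y) powr (p - 1)" if z: "0 \<le> z" "z \<le> x + y" for z
  proof (cases "z = 0")
    case False
    then have "z powr p = z * z powr (p - 1)" using z by (simp add: powr_diff)
    also have "\<dots> \<le> z * (x + y) powr (p - 1)" using z assms by (intro mult_left_mono powr_mono2) auto
    finally show ?thesis .
  qed (use assms in auto)
  from this[of x] this[of y] have "x powr p + y powr p \<le> (x + y) * (x + y) powr (p - 1)"
    using assms by (simp add: distrib_right)
  also have "\<dots> = (x + y) powr p" using s by (simp add: powr_diff)
  finally show ?thesis .
qed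

lemma JN_bound_add:
  fixes f g :: "'a::euclidean_space \<Rightarrow> real"
  assumes p: "1 < p" and L: "f \<in> L1_loc" "g \<in> L1_loc" and f: "JN_bound p f K" and g: "JN_bound p g K'"
  shows "JN_bound p (\<lambda>x. f x + g x) (2 * (K + K'))"
  unfolding JN_bound_alt
proof (intro conjI allI impI)
  have K: "0 \<le> K" "0 \<le> K'" using f g by (auto simp: JN_bound_def)
  then show "0 \<le> 2 * (K + K')" by simp
  fix Q :: "nat \<Rightarrow> 'a set"
  assume Q: "(\<forall>i. is_cube (Q i)) \<and> disjoint_family Q"
  let ?t = "\<lambda>f i. measure lebesgue (Q i) * osc (Q i) f powr p"
  have t: "?t (\<lambda>x. f x + g x) i \<le> 2 powr p * (?t f i + ?t g i)" for i
  proof -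
    have c: "is_cube (Q i)" using Q by auto
    have "osc (Q i) (\<lambda>x. f x + g x) powr p \<le> (osc (Q i) f + osc (Q i) g) powr p"
      using p by (intro powr_mono2 osc_add_le L1_loc_cube osc_nonneg c L) auto
    also have "\<dots> \<le> 2 powr p * (osc (Q i) f powr p + osc (Q i) g powr p)"
      using p by (intro powr_add_le osc_nonneg c) auto
    finally have "?t (\<lambda>x. f x + g x) i \<le> measure lebesgue (Q i) * (2 powr p * (osc (Q i) f powr p + osc (Q i) g powr p))"
      by (intro mult_left_mono) auto
    then show ?thesis by (simp add: algebra_simps)
  qed
  have "(\<Sum>i. ennreal (?t (\<lambda>x. f x + g x) i)) \<le> (\<Sum>i. ennreal (2 powr p) * (ennreal (?t f i) + ennreal (?t g i)))"
    by (intro suminf_le summableI) (use t in \<open>auto simp: ennreal_plus[symmetric] ennreal_mult[symmetric] simp del: ennreal_plus\<close>)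
  also have "\<dots> = ennreal (2 powr p) * ((\<Sum>i. ennreal (?t f i)) + (\<Sum>i. ennreal (?t g i)))"
    by (subst ennreal_suminf_cmult) (auto simp: suminf_add[symmetric])
  also have "\<dots> \<le> ennreal (2 powr p) * (ennreal (K powr p) + ennreal (K' powr p))"
    using f g Q unfolding JN_bound_alt by (intro mult_left_mono add_mono) auto
  also have "\<dots> = ennreal (2 powr p * (K powr p + K' powr p))"
    by (simp add: ennreal_plus[symmetric] ennreal_mult[symmetric] del: ennreal_plus)
  also have "\<dots> \<le> ennreal (2 powr p * (K + K') powr p)"
    using p K by (intro ennreal_leI mult_left_mono powr_superadditive) auto
  also have "\<dots> = ennreal ((2 * (K + K')) powr p)" using K by (simp only: powr_mult)
  finally show "(\<Sum>i. ennreal (?t (\<lambda>x. f x + g x) i)) \<le> ennreal ((2 * (K + K')) powr p)" .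
qed

lemma measure_mult_avg_abs:
  assumes Q: "is_cube Q" and f: "set_integrable lebesgue Q f"
  shows "ennreal (measure lebesgue Q * avg Q (\<lambda>x. \<bar>f x\<bar>)) = (\<integral>\<^sup>+x. ennreal \<bar>f x\<bar> * indicator Q x \<partial>lborel)"
proof -
  have "measure lebesgue Q * avg Q (\<lambda>x. \<bar>f x\<bar>) = (\<integral>x. \<bar>indicator Q x *\<^sub>R f x\<bar> \<partial>lebesgue)"
    using measure_cube_pos[OF Q] by (simp add: avg_def set_lebesgue_integral_def abs_mult)
  then have "ennreal (measure lebesgue Q * avg Q (\<lambda>x. \<bar>f x\<bar>)) = ennreal (\<integral>x. \<bar>indicator Q x *\<^sub>R f x\<bar> \<partial>lebesgue)"
    by simp
  also have "\<dots> = (\<integral>\<^sup>+x. ennreal \<bar>indicator Q x *\<^sub>R f x\<bar> \<partial>lebesgue)"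
    using f unfolding set_integrable_def by (intro nn_integral_eq_integral[symmetric]) auto
  also have "\<dots> = (\<integral>\<^sup>+x. ennreal \<bar>f x\<bar> * indicator Q x \<partial>lborel)"
    unfolding nn_integral_completion by (intro nn_integral_cong) (auto simp: indicator_def)
  finally show ?thesis .
qed

text \<open>
  If \<open>|u| \<le> M\<close>, then the oscillation on a cube is at most \<open>2 M\<close>, so its \<open>p\<close>-th power is at most
  \<open>(2 M) powr (p - 1)\<close> times the oscillation itself.  The latter is controlled by the integral of
  \<open>|u|\<close>, which is additive over disjoint cubes.
\<close>

lemma JN_bound_bounded_integrable:
  fixes u :: "'a::euclidean_space \<Rightarrow> real"
  assumes p: "1 < p" and [measurable]: "u \<in> borel_measurable borel"
    and M: "0 < M" "\<And>x. \<bar>u x\<bar> \<le> M" and s: "(\<integral>\<^sup>+x. ennreal \<bar>u x\<bar> \<partial>lborel) \<le> ennreal s" "0 \<le> s"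
  shows "JN_bound p u ((2 * (2 * M) powr (p - 1) * s) powr (1 / p))"
proof (rule JN_bound_by_density)
  let ?w = "\<lambda>K::nat. \<lambda>x. ennreal (2 * (2 * M) powr (p - 1)) * ennreal \<bar>u x\<bar>"
  show "(\<lambda>x. ?w K x) \<in> borel_measurable borel" for K :: nat by measurable
  show "0 \<le> (2 * (2 * M) powr (p - 1) * s) powr (1 / p)" by simp
  have "integrable lborel u"
    using s by (intro integrableI_bounded) (auto simp: le_less_trans[OF _ ennreal_less_top])
  then have "integrable lebesgue u" by (simp add: integrable_completion)
  then have L: "u \<in> L1_loc" by (rule L1_loc_integrable)
  show "(\<integral>\<^sup>+x. ?w K x \<partial>lborel) \<le> ennreal (((2 * (2 * M) powr (p - 1) * s) powr (1 / p)) powr p)" for K :: nat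
  proof -
    have "(\<integral>\<^sup>+x. ?w K x \<partial>lborel) = ennreal (2 * (2 * M) powr (p - 1)) * (\<integral>\<^sup>+x. ennreal \<bar>u x\<bar> \<partial>lborel)"
      by (rule nn_integral_cmult) measurable
    also have "\<dots> \<le> ennreal (2 * (2 * M) powr (p - 1)) * ennreal s" by (intro mult_left_mono s) auto
    also have "\<dots> = ennreal (2 * (2 * M) powr (p - 1) * s)" using s by (simp add: ennreal_mult)
    finally show ?thesis using s p by (simp add: powr_powr)
  qed
  fix Q :: "'a set" assume Q: "is_cube Q"
  have [measurable]: "Q \<in> sets borel" using cube_borel Q by auto
  have iQ: "set_integrable lebesgue Q u" by (rule L1_loc_cube[OF L Q])
  have o: "osc Q u \<le> 2 * avg Q (\<lambda>x. \<bar>u x\<bar>)" using osc_le_avg_diff[OF Q iQ, of 0] by simp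
  also have "avg Q (\<lambda>x. \<bar>u x\<bar>) \<le> M"
    using avg_mono[OF Q set_integrable_abs[OF iQ] set_integrable_cube_const[OF Q, of M]] M
    by (simp add: avg_const[OF Q])
  finally have oM: "osc Q u \<le> 2 * M" by simp
  have "osc Q u powr p \<le> (2 * M) powr (p - 1) * osc Q u"
  proof (cases "osc Q u = 0")
    case False
    then have "osc Q u powr p = osc Q u powr (p - 1) * osc Q u"
      using osc_nonneg[OF Q, of u] by (simp add: powr_diff)
    also have "\<dots> \<le> (2 * M) powr (p - 1) * osc Q u"
      using p osc_nonneg[OF Q, of u] oM by (intro mult_right_mono powr_mono2) auto
    finally show ?thesis .
  qed simp
  also have "\<dots> \<le> (2 * M) powr (p - 1) * (2 * avg Q (\<lambda>x. \<bar>u x\<bar>))" by (intro mult_left_mono o) auto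
  finally have "measure lebesgue Q * osc Q u powr p \<le> measure lebesgue Q * ((2 * M) powr (p - 1) * (2 * avg Q (\<lambda>x. \<bar>u x\<bar>)))"
    by (intro mult_left_mono) auto
  then have "ennreal (measure lebesgue Q * osc Q u powr p)
      \<le> ennreal ((2 * (2 * M) powr (p - 1)) * (measure lebesgue Q * avg Q (\<lambda>x. \<bar>u x\<bar>)))"
    by (intro ennreal_leI) (simp add: mult_ac)
  also have "\<dots> = ennreal (2 * (2 * M) powr (p - 1)) * (\<integral>\<^sup>+x. ennreal \<bar>u x\<bar> * indicator Q x \<partial>lborel)"
    unfolding measure_mult_avg_abs[OF Q iQ, symmetric]
    by (rule ennreal_mult) (auto intro!: mult_nonneg_nonneg avg_nonneg[OF Q])
  also have "\<dots> = (\<integral>\<^sup>+x. ?w 0 x * indicator Q x \<partial>lborel)"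
    by (subst nn_integral_cmult[symmetric]) (auto simp: mult_ac)
  finally show "\<exists>K\<^sub>0. \<forall>K\<ge>K\<^sub>0. ennreal (measure lebesgue Q * osc Q u powr p) \<le> (\<integral>\<^sup>+x. ?w K x * indicator Q x \<partial>lborel)"
    by auto
qed

lemma JN_norm_less:
  assumes "JN_bound p f K" "K < e" shows "JN_norm p f < e"
proof -
  have "bdd_below {K. JN_bound p f K}" by (rule bdd_belowI[of _ 0]) (auto simp: JN_bound_def)
  then have "JN_norm p f \<le> K" unfolding JN_norm_def using assms by (intro cInf_lower) auto
  with assms show ?thesis by simp
qed

lemma JN_norm_lessD:
  assumes "f \<in> JN_space p" "JN_norm p f < e" obtains K where "JN_bound p f K" "K < e"
proof -
  have "{K. JN_bound p f K} \<noteq> {}" using assms by (auto simp: JN_space_def)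
  from cInf_lessD[OF this assms(2)[unfolded JN_norm_def]] that show thesis by auto
qed

lemma JN_space_add:
  "1 < p \<Longrightarrow> f \<in> JN_space p \<Longrightarrow> g \<in> JN_space p \<Longrightarrow> (\<lambda>x. f x + g x) \<in> JN_space p"
  using JN_bound_add L1_loc_add unfolding JN_space_def by fast

lemma osc_uminus: "osc Q (\<lambda>x. - f x) = osc Q f"
proof -
  have "avg Q (\<lambda>x. - f x) = - avg Q f" by (simp add: avg_def set_lebesgue_integral_def)
  then have "\<bar>- f x - avg Q (\<lambda>x. - f x)\<bar> = \<bar>f x - avg Q f\<bar>" for x by linarith
  then show ?thesis by (simp add: osc_def)
qed

lemma JN_space_diff:
  assumes "1 < p" "f \<in> JN_space p" "g \<in> JN_space p" shows "(\<lambda>x. f x - g x) \<in> JN_space p"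
proof -
  have "(\<lambda>x. - g x) \<in> L1_loc" using assms L1_loc_diff[of "\<lambda>x. 0" g] L1_loc_integrable[of "\<lambda>x. 0"]
    by (auto simp: JN_space_def)
  then have "(\<lambda>x. - g x) \<in> JN_space p" using assms by (auto simp: JN_space_def JN_bound_alt osc_uminus)
  from JN_space_add[OF assms(1,2) this] show ?thesis by simp
qed

text \<open>
  Fubini's theorem for a function of one coordinate; the other coordinates contribute the area of
  a face of the cube.
\<close>

lemma nn_integral_slab:
  fixes u :: "real \<Rightarrow> real" and a :: "'a::euclidean_space"
  assumes [measurable]: "u \<in> borel_measurable borel" and u: "\<And>t. 0 \<le> u t" and i: "i \<in> Basis" and l: "0 < l"
  shows "(\<integral>\<^sup>+x. ennreal (u (x \<bullet> i)) * indicator (box a (a + l *\<^sub>R One)) x \<partial>lborel)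
    = ennreal (l ^ (DIM('a) - 1)) * (\<integral>\<^sup>+t. ennreal (u t) * indicator {a \<bullet> i <..< a \<bullet> i + l} t \<partial>lborel)"
proof -
  define f where "f b t = (if b = i then u t else 1) * indicator {a \<bullet> b <..< a \<bullet> b + l} t" for b t
  have [measurable]: "f b \<in> borel_measurable borel" for b unfolding f_def by measurable
  have f0: "0 \<le> f b t" for b t using u by (simp add: f_def)
  have prod: "(\<Prod>b\<in>Basis. f b (x \<bullet> b)) = u (x \<bullet> i) * indicator (box a (a + l *\<^sub>R One)) x" for x
  proof -
    have "(\<Prod>b\<in>Basis. f b (x \<bullet> b)) = (\<Prod>b\<in>Basis. if b = i then u (x \<bullet> i) else 1)
        * (\<Prod>b\<in>Basis. indicator {a \<bullet> b <..< a \<bullet> b + l} (x \<bullet> b))"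
      unfolding f_def prod.distrib[symmetric] by (intro prod.cong) auto
    also have "(\<Prod>b\<in>Basis. indicator {a \<bullet> b <..< a \<bullet> b + l} (x \<bullet> b)) = (indicator (box a (a + l *\<^sub>R One)) x :: real)"
    proof (cases "x \<in> box a (a + l *\<^sub>R One)")
      case True
      then show ?thesis by (auto simp: mem_box inner_add_left intro!: prod.neutral)
    next
      case False
      then obtain b where b: "b \<in> Basis" "x \<bullet> b \<notin> {a \<bullet> b <..< a \<bullet> b + l}"
        by (auto simp: mem_box inner_add_left)
      then have "(\<Prod>b\<in>Basis. indicator {a \<bullet> b <..< a \<bullet> b + l} (x \<bullet> b)) = (0 :: real)"
        by (intro prod_zero) (auto intro!: bexI[of _ b])
      with False show ?thesis by simp
    qed
    finally show ?thesis using i by (simp add: prod.delta)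
  qed
  have "(\<integral>\<^sup>+x. ennreal (u (x \<bullet> i)) * indicator (box a (a + l *\<^sub>R One)) x \<partial>lborel)
      = (\<integral>\<^sup>+x. ennreal (\<Prod>b\<in>Basis. f b (x \<bullet> b)) \<partial>lborel)"
    unfolding prod by (intro nn_integral_cong) (auto simp: indicator_def)
  also have "\<dots> = (\<integral>\<^sup>+x. (\<Prod>b\<in>Basis. ennreal (f b (x \<bullet> b))) \<partial>(lborel::'a measure))"
    using f0 by (simp add: prod_ennreal)
  also have "\<dots> = (\<Prod>b\<in>(Basis::'a set). \<integral>\<^sup>+t. ennreal (f b t) \<partial>lborel)"
    using f0 by (intro nn_integral_lborel_prod) auto
  also have "\<dots> = (\<integral>\<^sup>+t. ennreal (f i t) \<partial>lborel) * (\<Prod>b\<in>Basis - {i}. \<integral>\<^sup>+t. ennreal (f b t) \<partial>lborel)"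
    using i by (simp add: prod.remove)
  also have "(\<integral>\<^sup>+t. ennreal (f i t) \<partial>lborel) = (\<integral>\<^sup>+t. ennreal (u t) * indicator {a \<bullet> i <..< a \<bullet> i + l} t \<partial>lborel)"
    by (intro nn_integral_cong) (auto simp: f_def indicator_def)
  also have "(\<Prod>b\<in>Basis - {i}. \<integral>\<^sup>+t. ennreal (f b t) \<partial>lborel) = (\<Prod>b\<in>Basis - {i}. ennreal l)"
    using l by (intro prod.cong) (auto simp: f_def ennreal_indicator)
  also have "\<dots> = ennreal (l ^ (DIM('a) - 1))"
    using i l by (simp add: card_Diff_singleton ennreal_power)
  finally show ?thesis by (simp add: mult.commute)
qed

section \<open>Integrals of cascades over cubes\<close>

text \<open>
  The side is at most the length of an interval of level \<open>k\<close>, so the projection of the cube meets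
  only the interval \<open>m\<close> that contains its left endpoint and the next one.
\<close>

lemma nn_integral_cascade_cube_le:
  fixes q :: "'a::euclidean_space"
  assumes AB: "0 < A" "0 < B" and i: "i \<in> Basis" and l: "0 < l" "l \<le> 1 / 4 ^ k"
  defines "m \<equiv> \<lfloor>4 ^ k * (q \<bullet> i)\<rfloor>"
  shows "(\<integral>\<^sup>+x. ennreal (cascade A B (k + d) (x \<bullet> i)) * indicator (box q (q + l *\<^sub>R One)) x \<partial>lborel)
    \<le> ennreal (l ^ (DIM('a) - 1) * ((weight A B k m + weight A B k (m + 1)) * ((A + B) / 2) ^ d / 4 ^ k))"
proof -
  let ?W = "\<lambda>t. ennreal (cascade A B (k + d) t)"
  have "indicator {q \<bullet> i <..< q \<bullet> i + l} t \<le> (indicator (cell k m) t + indicator (cell k (m + 1)) t :: ennreal)" for t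
  proof (cases "t \<in> {q \<bullet> i <..< q \<bullet> i + l}")
    case True
    have *: "4 ^ k * (q \<bullet> i) < 4 ^ k * t" "4 ^ k * t < 4 ^ k * (q \<bullet> i) + 1"
    proof -
      have "4 ^ k * t < 4 ^ k * (q \<bullet> i + l)" using True by (intro mult_strict_left_mono) auto
      also have "\<dots> \<le> 4 ^ k * (q \<bullet> i) + 1" using l by (simp add: field_simps)
      finally show "4 ^ k * t < 4 ^ k * (q \<bullet> i) + 1" .
    qed (use True in simp)
    then have "m \<le> \<lfloor>4 ^ k * t\<rfloor>" "\<lfloor>4 ^ k * t\<rfloor> \<le> m + 1"
      unfolding m_def by linarith+
    then have "\<lfloor>4 ^ k * t\<rfloor> = m \<or> \<lfloor>4 ^ k * t\<rfloor> = m + 1" by linarith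
    then show ?thesis by (auto simp: indicator_def mem_cell_iff)
  qed simp
  then have "(\<integral>\<^sup>+t. ?W t * indicator {q \<bullet> i <..< q \<bullet> i + l} t \<partial>lborel)
      \<le> (\<integral>\<^sup>+t. ?W t * indicator (cell k m) t + ?W t * indicator (cell k (m + 1)) t \<partial>lborel)"
    unfolding distrib_left[symmetric] by (intro nn_integral_mono mult_left_mono) auto
  also have "\<dots> = (\<integral>\<^sup>+t. ?W t * indicator (cell k m) t \<partial>lborel) + (\<integral>\<^sup>+t. ?W t * indicator (cell k (m + 1)) t \<partial>lborel)"
    by (rule nn_integral_add) measurable
  also have "\<dots> = ennreal ((weight A B k m + weight A B k (m + 1)) * ((A + B) / 2) ^ d / 4 ^ k)"
    unfolding nn_integral_cascade_cell[OF AB]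
    using weight_pos[OF AB] AB by (subst ennreal_plus[symmetric]) (auto simp: less_imp_le field_simps)
  finally have "ennreal (l ^ (DIM('a) - 1)) * (\<integral>\<^sup>+t. ?W t * indicator {q \<bullet> i <..< q \<bullet> i + l} t \<partial>lborel)
      \<le> ennreal (l ^ (DIM('a) - 1)) * ennreal ((weight A B k m + weight A B k (m + 1)) * ((A + B) / 2) ^ d / 4 ^ k)"
    by (rule mult_left_mono) auto
  moreover have "ennreal (l ^ (DIM('a) - 1) * ((weight A B k m + weight A B k (m + 1)) * ((A + B) / 2) ^ d / 4 ^ k))
      = ennreal (l ^ (DIM('a) - 1)) * ennreal ((weight A B k m + weight A B k (m + 1)) * ((A + B) / 2) ^ d / 4 ^ k)"
    using AB l weight_pos[OF AB, of k m] weight_pos[OF AB, of k "m + 1"] by (intro ennreal_mult) auto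
  ultimately show ?thesis
    using AB l by (subst nn_integral_slab[OF _ _ i]) (auto simp: less_imp_le cascade_pos)
qed

lemma nn_integral_cascade_cube_ge:
  fixes q :: "'a::euclidean_space"
  assumes AB: "0 < A" "0 < B" and i: "i \<in> Basis" and l: "0 < l"
    and m: "q \<bullet> i \<le> of_int m / 4 ^ k" "(of_int m + 1) / 4 ^ k \<le> q \<bullet> i + l"
  shows "ennreal (l ^ (DIM('a) - 1) * (weight A B k m * ((A + B) / 2) ^ d / 4 ^ k))
    \<le> (\<integral>\<^sup>+x. ennreal (cascade A B (k + d) (x \<bullet> i)) * indicator (box q (q + l *\<^sub>R One)) x \<partial>lborel)"
proof -
  let ?W = "\<lambda>t. ennreal (cascade A B (k + d) t)"
  have "ennreal (weight A B k m * ((A + B) / 2) ^ d / 4 ^ k) = (\<integral>\<^sup>+t. ?W t * indicator (cell k m) t \<partial>lborel)"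
    by (simp only: nn_integral_cascade_cell[OF AB])
  also have "\<dots> \<le> (\<integral>\<^sup>+t. ?W t * indicator {q \<bullet> i <..< q \<bullet> i + l} t \<partial>lborel)"
    using AE_lborel_singleton[of "q \<bullet> i"]
    by (intro nn_integral_mono_AE, eventually_elim) (use m in \<open>auto simp: indicator_def cell_def\<close>)
  finally have "ennreal (l ^ (DIM('a) - 1)) * ennreal (weight A B k m * ((A + B) / 2) ^ d / 4 ^ k)
      \<le> ennreal (l ^ (DIM('a) - 1)) * (\<integral>\<^sup>+t. ?W t * indicator {q \<bullet> i <..< q \<bullet> i + l} t \<partial>lborel)"
    by (rule mult_left_mono) auto
  moreover have "ennreal (l ^ (DIM('a) - 1) * (weight A B k m * ((A + B) / 2) ^ d / 4 ^ k))
      = ennreal (l ^ (DIM('a) - 1)) * ennreal (weight A B k m * ((A + B) / 2) ^ d / 4 ^ k)"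
    using AB l weight_pos[OF AB, of k m] by (intro ennreal_mult) auto
  ultimately show ?thesis
    using AB l by (subst nn_integral_slab[OF _ _ i]) (auto simp: less_imp_le cascade_pos)
qed

lemma nn_integral_cascade_cell_cube:
  fixes q :: "'a::euclidean_space"
  assumes AB: "0 < A" "0 < B" and i: "i \<in> Basis" and q: "q \<bullet> i = of_int m / 4 ^ k"
  shows "(\<integral>\<^sup>+x. ennreal (cascade A B (k + d) (x \<bullet> i)) * indicator (box q (q + (1 / 4 ^ k) *\<^sub>R One)) x \<partial>lborel)
    = ennreal (weight A B k m * ((A + B) / 2) ^ d * (1 / 4 ^ k) ^ DIM('a))"
proof -
  let ?W = "\<lambda>t. ennreal (cascade A B (k + d) t)" and ?l = "1 / 4 ^ k :: real"
  have "(\<integral>\<^sup>+t. ?W t * indicator {q \<bullet> i <..< q \<bullet> i + ?l} t \<partial>lborel) = (\<integral>\<^sup>+t. ?W t * indicator (cell k m) t \<partial>lborel)"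
    using AE_lborel_singleton[of "q \<bullet> i"]
    by (intro nn_integral_cong_AE, eventually_elim) (auto simp: q indicator_def cell_def add_divide_distrib)
  also have "\<dots> = ennreal (weight A B k m * ((A + B) / 2) ^ d / 4 ^ k)"
    by (simp only: nn_integral_cascade_cell[OF AB])
  finally have "(\<integral>\<^sup>+x. ?W (x \<bullet> i) * indicator (box q (q + ?l *\<^sub>R One)) x \<partial>lborel)
      = ennreal (?l ^ (DIM('a) - 1) * (weight A B k m * ((A + B) / 2) ^ d / 4 ^ k))"
    using AB by (subst nn_integral_slab[OF _ _ i])
      (auto simp: less_imp_le cascade_pos weight_pos ennreal_mult''[symmetric])
  also have "?l ^ (DIM('a) - 1) * (weight A B k m * ((A + B) / 2) ^ d / 4 ^ k)
      = weight A B k m * ((A + B) / 2) ^ d * (?l ^ (DIM('a) - 1) * ?l)" by simp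
  also have "?l ^ (DIM('a) - 1) * ?l = ?l ^ DIM('a)"
    using DIM_positive[where 'a='a] by (metis power_minus_mult)
  finally show ?thesis .
qed

lemma nn_integral_cascade_integer_cube_le:
  fixes q :: "'a::euclidean_space"
  assumes AB: "0 < A" "0 < B" and i: "i \<in> Basis" and q: "q \<bullet> i = of_int M" and N: "0 < N"
  shows "(\<integral>\<^sup>+x. ennreal (cascade A B j (x \<bullet> i)) * indicator (box q (q + of_nat N *\<^sub>R One)) x \<partial>lborel)
    \<le> ennreal (of_nat N ^ DIM('a) * ((A + B) / 2) ^ j)"
proof -
  let ?W = "\<lambda>t. ennreal (cascade A B j t)"
  have "(\<integral>\<^sup>+t. ?W t * indicator {q \<bullet> i <..< q \<bullet> i + of_nat N} t \<partial>lborel)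
      \<le> (\<integral>\<^sup>+t. ?W t * indicator {of_int M ..< of_int M + of_nat N} t \<partial>lborel)"
    by (intro nn_integral_mono) (auto simp: q indicator_def)
  also have "\<dots> = ennreal (of_nat N * ((A + B) / 2) ^ j)" by (rule nn_integral_cascade_block[OF AB])
  finally have "(\<integral>\<^sup>+x. ?W (x \<bullet> i) * indicator (box q (q + of_nat N *\<^sub>R One)) x \<partial>lborel)
      \<le> ennreal (of_nat N ^ (DIM('a) - 1)) * ennreal (of_nat N * ((A + B) / 2) ^ j)"
    using AB N by (subst nn_integral_slab[OF _ _ i]) (auto simp: less_imp_le cascade_pos intro!: mult_left_mono)
  also have "\<dots> = ennreal ((of_nat N ^ (DIM('a) - 1) * of_nat N) * ((A + B) / 2) ^ j)"
    using AB by (subst ennreal_mult[symmetric]) (auto simp: mult_ac)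
  also have "of_nat N ^ (DIM('a) - 1) * of_nat N = (of_nat N ^ DIM('a) :: real)"
    using DIM_positive[where 'a='a] by (metis power_minus_mult)
  finally show ?thesis .
qed

definition localized :: "'a::euclidean_space \<Rightarrow> (real \<Rightarrow> real) \<Rightarrow> 'a \<Rightarrow> real" where
  "localized i f x = cutoff x * f (x \<bullet> i)"

lemma cutoff_measurable [measurable]: "(cutoff :: 'a::euclidean_space \<Rightarrow> real) \<in> borel_measurable borel"
  using C_k_imp_continuous_on[OF cutoff_C_k] by (rule borel_measurable_continuous_onI)

text \<open>
  The series may diverge on a null set.  This relation says that \<open>f\<close> is its sum, in a form that makes
  sense at every point: where the series diverges the bound is infinite.  It turns subtraction of a
  partial sum into omission of coefficients without any exceptional set.
\<close>

definition represents :: "real \<Rightarrow> real \<Rightarrow> (nat \<Rightarrow> real) \<Rightarrow> (real \<Rightarrow> real) \<Rightarrow> bool" where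
  "represents A B c f \<longleftrightarrow> f \<in> borel_measurable borel \<and>
     (\<forall>k t. ennreal \<bar>f t - (\<Sum>j<k. c j * cascade A B j t)\<bar> \<le> (\<Sum>j. ennreal (c (j + k) * cascade A B (j + k) t)))"

definition cascade_sum :: "real \<Rightarrow> real \<Rightarrow> (nat \<Rightarrow> real) \<Rightarrow> real \<Rightarrow> real" where
  "cascade_sum A B c t = enn2real (\<Sum>j. ennreal (c j * cascade A B j t))"

lemma suminf_split_ennreal: "(\<Sum>j. f j :: ennreal) = (\<Sum>j<k. f j) + (\<Sum>j. f (j + k))"
  by (subst suminf_offset[of f k]) (auto simp: add.commute)

text \<open>
  Where the series diverges, \<^const>\<open>cascade_sum\<close> is \<open>0\<close>, and every tail is infinite.
\<close>

lemma represents_cascade_sum: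
  assumes AB: "0 < A" "0 < B" and c: "\<And>j. 0 \<le> c j"
  shows "represents A B c (cascade_sum A B c)"
  unfolding represents_def
proof (intro conjI allI)
  show "cascade_sum A B c \<in> borel_measurable borel" unfolding cascade_sum_def[abs_def] by measurable
  fix k t
  define S where "S = (\<Sum>j<k. c j * cascade A B j t)"
  define T where "T = (\<Sum>j. ennreal (c (j + k) * cascade A B (j + k) t))"
  have pos: "0 \<le> c j * cascade A B j t" for j using c cascade_pos[OF AB] by (simp add: less_imp_le)
  then have S0: "0 \<le> S" by (simp add: S_def sum_nonneg)
  have split: "(\<Sum>j. ennreal (c j * cascade A B j t)) = ennreal S + T"
    using suminf_split_ennreal[of "\<lambda>j. ennreal (c j * cascade A B j t)" k] pos by (simp add: S_def T_def sum_ennreal)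
  show "ennreal \<bar>cascade_sum A B c t - (\<Sum>j<k. c j * cascade A B j t)\<bar>
    \<le> (\<Sum>j. ennreal (c (j + k) * cascade A B (j + k) t))"
    unfolding S_def[symmetric] T_def[symmetric] cascade_sum_def split
    using S0 by (cases T) (auto simp: ennreal_plus[symmetric] simp del: ennreal_plus)
qed

lemma represents_tail:
  assumes AB: "0 < A" "0 < B" and c: "\<And>j. 0 \<le> c j" and f: "represents A B c f"
  shows "represents A B (\<lambda>j. if j < m then 0 else c j) (\<lambda>t. f t - (\<Sum>j<m. c j * cascade A B j t))"
    (is "represents A B ?c ?f")
  unfolding represents_def
proof (intro conjI allI)
  have [measurable]: "f \<in> borel_measurable borel" using f by (simp add: represents_def)
  show "?f \<in> borel_measurable borel" by measurable
  fix k t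
  have R: "ennreal \<bar>f t - (\<Sum>j<k. c j * cascade A B j t)\<bar> \<le> (\<Sum>j. ennreal (c (j + k) * cascade A B (j + k) t))" for k
    using f by (simp add: represents_def)
  show "ennreal \<bar>?f t - (\<Sum>j<k. ?c j * cascade A B j t)\<bar> \<le> (\<Sum>j. ennreal (?c (j + k) * cascade A B (j + k) t))"
  proof (cases "k \<le> m")
    case True
    have "(\<Sum>j<k. ?c j * cascade A B j t) = 0" using True by (intro sum.neutral) auto
    moreover have "(\<Sum>j. ennreal (?c (j + k) * cascade A B (j + k) t)) = (\<Sum>j. ennreal (c (j + m) * cascade A B (j + m) t))"
      using True by (subst suminf_split_ennreal[of _ "m - k"]) auto
    ultimately show ?thesis using R[of m] by simp
  next
    case False
    have "(\<Sum>j<k. c j * cascade A B j t) = (\<Sum>j<m. c j * cascade A B j t) + (\<Sum>j<k. ?c j * cascade A B j t)"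
    proof -
      have "(\<Sum>j<k. c j * cascade A B j t) = (\<Sum>j<k. (if j < m then c j * cascade A B j t else 0) + ?c j * cascade A B j t)"
        by (intro sum.cong) auto
      moreover have "(\<Sum>j<k. (if j < m then c j * cascade A B j t else 0)) = (\<Sum>j<m. c j * cascade A B j t)"
        using False by (intro sum.mono_neutral_cong_right) auto
      ultimately show ?thesis by (simp add: sum.distrib)
    qed
    moreover have "?c (j + k) = c (j + k)" for j using False by simp
    ultimately show ?thesis using R[of k] by (simp add: diff_diff_eq)
  qed
qed

section \<open>The JN bound for cascade series\<close>

text \<open>
  The condition on the means of the factors makes \<open>\<integral> W\<^sub>j\<close> decay geometrically; the condition on the
  means of their \<open>p\<close>-th powers makes \<open>\<integral> W\<^sub>j\<^sup>p\<close> over an interval of level \<open>k\<close> independent of \<open>j \<ge> k\<close>.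
\<close>

locale cascade_factors =
  fixes p A B :: real
  assumes p: "1 < p" and B: "0 < B" "B < 1" and A: "1 < A" "A < 2" and mean: "A + B < 2"
    and mean_powr: "A powr p + B powr p = 2"
begin

definition ratio :: real where "ratio = (A + B) / 2"

lemma ratio_bounds: "0 < ratio" "ratio < 1"
  using A B mean by (auto simp: ratio_def)

lemma AB_pos: "0 < A" "0 < B" using A B by auto

lemma powr_pos: "0 < A powr p" "0 < B powr p" using A B by auto

lemma nn_integral_series_le:
  fixes Q :: "'a::euclidean_space set"
  assumes [measurable]: "Q \<in> sets borel"
    and Q: "\<And>j. (\<integral>\<^sup>+x. ennreal (cascade A B (j + k) (x \<bullet> i)) * indicator Q x \<partial>lborel) \<le> ennreal (X * ratio ^ j)"
    and X: "0 \<le> X" and c: "\<And>j. 0 \<le> c j \<and> c j \<le> a"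
  shows "(\<integral>\<^sup>+x. (\<Sum>j. ennreal (c (j + k) * cascade A B (j + k) (x \<bullet> i))) * indicator Q x \<partial>lborel)
    \<le> ennreal (a * X / (1 - ratio))"
proof -
  have a: "0 \<le> a" using c[of 0] by linarith
  have "(\<integral>\<^sup>+x. (\<Sum>j. ennreal (c (j + k) * cascade A B (j + k) (x \<bullet> i))) * indicator Q x \<partial>lborel)
      = (\<integral>\<^sup>+x. (\<Sum>j. ennreal (c (j + k)) * (ennreal (cascade A B (j + k) (x \<bullet> i)) * indicator Q x)) \<partial>lborel)"
    using c by (intro nn_integral_cong) (simp add: ennreal_suminf_multc[symmetric] ennreal_mult' mult.assoc)
  also have "\<dots> = (\<Sum>j. \<integral>\<^sup>+x. ennreal (c (j + k)) * (ennreal (cascade A B (j + k) (x \<bullet> i)) * indicator Q x) \<partial>lborel)"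
    by (rule nn_integral_suminf) measurable
  also have "\<dots> = (\<Sum>j. ennreal (c (j + k)) * (\<integral>\<^sup>+x. ennreal (cascade A B (j + k) (x \<bullet> i)) * indicator Q x \<partial>lborel))"
    by (subst nn_integral_cmult) auto
  also have "\<dots> \<le> (\<Sum>j. ennreal a * ennreal (X * ratio ^ j))"
    using c Q by (intro suminf_le summableI mult_mono ennreal_leI) auto
  also have "\<dots> = (\<Sum>j. ennreal (a * X * ratio ^ j))"
    using a X ratio_bounds by (simp add: ennreal_mult[symmetric] mult.assoc)
  also have "\<dots> = ennreal (a * X * (1 / (1 - ratio)))"
    using a X ratio_bounds by (intro suminf_ennreal_eq sums_mult geometric_sums) auto
  finally show ?thesis by simp
qed

definition jump :: real where "jump = (1 + A / B) * A / (A - 1)"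

lemma jump_pos: "0 < jump" using A B by (auto simp: jump_def intro!: divide_pos_pos mult_pos_pos add_pos_pos)

lemma obtain_scale:
  assumes "0 < l" "l \<le> (1::real)"
  obtains k where "1 / 4 ^ Suc k < l" "l \<le> 1 / 4 ^ k"
proof -
  obtain n where n: "(1 / 4) ^ n < l" using real_arch_pow_inv[OF assms(1), of "1 / 4"] by auto
  define N where "N = (LEAST n. (1 / 4 :: real) ^ n < l)"
  have N: "(1 / 4) ^ N < l" unfolding N_def by (rule LeastI) (rule n)
  have "N \<noteq> 0" using N assms by (intro notI) auto
  then obtain k where k: "N = Suc k" by (cases N) auto
  have "\<not> (1 / 4) ^ k < l" using not_less_Least[of k "\<lambda>n. (1 / 4 :: real) ^ n < l"] k by (simp add: N_def)
  with N k that[of k] show thesis by (simp add: power_one_over)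
qed

definition osc_const :: "real \<Rightarrow> nat \<Rightarrow> real" where
  "osc_const L n = 2 * (jump + 4 * (1 + A / B) / (1 - ratio) + L * real n)"

lemma osc_const_pos: "0 \<le> L \<Longrightarrow> 0 < osc_const L n"
  unfolding osc_const_def using jump_pos A B ratio_bounds
  by (intro mult_pos_pos add_pos_nonneg) (auto intro!: mult_nonneg_nonneg divide_nonneg_pos add_nonneg_nonneg)

definition density_const :: "real \<Rightarrow> nat \<Rightarrow> real" where
  "density_const L n = (2 * osc_const L n) powr p * (16 * (A / B ^ 3) powr p + 1)"

definition JN_const :: "real \<Rightarrow> nat \<Rightarrow> real" where
  "JN_const L n = (density_const L n * (2 * 5 ^ n) + 2 powr p * (3 ^ n / (1 - ratio)) powr p) powr (1 / p)"

text \<open>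
  Two levels down, the ancestor of the interval \<open>m\<close> has number \<open>m div 16\<close>.  Passing to it costs at most
  two factors \<open>B\<close>, and passing to its left neighbour at most a factor \<open>A / B\<close>.
\<close>

lemma weight_Suc_Suc_ge:
  assumes "m div 16 = m' \<or> m div 16 = m' + 1"
  shows "weight A B k m' \<le> A / B ^ 3 * weight A B (k + 2) m"
proof -
  have "weight A B k m' \<le> A / B * weight A B k (m div 16)"
    using assms
  proof
    assume "m div 16 = m'"
    then show ?thesis using A B weight_pos[OF AB_pos, of k m'] by (simp add: field_simps)
  next
    assume "m div 16 = m' + 1"
    then show ?thesis using weight_adjacent(2)[of B A k m'] A B by simp
  qed
  also have "\<dots> \<le> A / B * (weight A B (k + 2) m / B ^ 2)"
  proof (intro mult_left_mono)
    have "B \<le> digit A B m" "B \<le> digit A B (m div 4)" using A B by (auto simp: digit_def)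
    then have "B * B \<le> digit A B m * digit A B (m div 4)" using B by (intro mult_mono) auto
    then have "B * B * weight A B k (m div 4 div 4) \<le> digit A B m * digit A B (m div 4) * weight A B k (m div 4 div 4)"
      using weight_pos[OF AB_pos] by (intro mult_right_mono) (auto simp: less_imp_le)
    moreover have "m div 4 div 4 = m div 16" using div_mult2_eq'[of m 4 4] by (simp add: zdiv_zmult2_eq[symmetric])
    ultimately show "weight A B k (m div 16) \<le> weight A B (k + 2) m / B ^ 2"
      using B by (simp add: field_simps power2_eq_square)
  qed (use A B in auto)
  also have "\<dots> = A / B ^ 3 * weight A B (k + 2) m" by (simp add: power2_eq_square power3_eq_cube)
  finally show ?thesis .
qed

text \<open>
  A cube with side above \<open>1 / 4\<^sup>k\<^sup>+\<^sup>1\<close> contains, in direction \<open>i\<close>, an interval of level \<open>k + 2\<close>, over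
  which \<open>\<integral> W\<^sub>K\<^sup>p\<close> does not depend on \<open>K\<close>.  The weight of that interval is comparable to the weight at
  level \<open>k\<close>.
\<close>

lemma cube_weight_powr_le:
  fixes q :: "'a::euclidean_space"
  assumes i: "i \<in> Basis" and l: "0 < l" "1 / 4 ^ Suc k < l" "l \<le> 1 / 4 ^ k" and K: "k + 2 \<le> K"
  shows "ennreal (l ^ DIM('a) * weight A B k \<lfloor>4 ^ k * (q \<bullet> i)\<rfloor> powr p)
    \<le> ennreal (16 * (A / B ^ 3) powr p)
       * (\<integral>\<^sup>+x. ennreal (cascade A B K (x \<bullet> i) powr p) * indicator (box q (q + l *\<^sub>R One)) x \<partial>lborel)"
proof -
  \<comment> \<open>the first interval of level \<open>k + 2\<close> that starts inside the cube\<close>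
  define M where "M = \<lceil>4 ^ (k + 2) * (q \<bullet> i)\<rceil>"
  define m where "m = \<lfloor>4 ^ k * (q \<bullet> i)\<rfloor>"
  define W where "W = weight (A powr p) (B powr p) (k + 2) M"
  have W0: "0 < W" unfolding W_def by (rule weight_pos[OF powr_pos])
  have four: "(4::real) ^ (k + 2) = 16 * 4 ^ k" by (simp add: power_add)
  have M1: "4 ^ (k + 2) * (q \<bullet> i) \<le> of_int M" "of_int M < 4 ^ (k + 2) * (q \<bullet> i) + 1"
    unfolding M_def by linarith+
  have l4: "4 < 4 ^ (k + 2) * l" using l(2) by (simp add: field_simps)
  have cell1: "q \<bullet> i \<le> of_int M / 4 ^ (k + 2)" using M1(1) by (simp add: field_simps)
  have "of_int M + 1 \<le> 4 ^ (k + 2) * (q \<bullet> i + l)" using M1(2) l4 unfolding distrib_left by linarith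
  then have cell2: "(of_int M + 1) / 4 ^ (k + 2) \<le> q \<bullet> i + l" by (simp add: field_simps)
  have "M div 16 = m \<or> M div 16 = m + 1"
  proof -
    have "of_int m \<le> 4 ^ k * (q \<bullet> i)" "4 ^ k * (q \<bullet> i) < of_int m + 1" unfolding m_def by linarith+
    with M1 have "of_int (16 * m) \<le> (of_int M :: real)" "(of_int M :: real) < of_int (16 * m + 17)"
      unfolding four by simp_all
    then have "16 * m \<le> M" "M < 16 * m + 17" by (simp_all only: of_int_le_iff of_int_less_iff)
    then have "m \<le> M div 16" "M div 16 \<le> m + 1"
      using zdiv_mono1[of "16 * m" M 16] zdiv_mono1[of M "16 * (m + 1)" 16] by simp_all
    then show ?thesis by linarith
  qed
  then have "weight A B k m \<le> A / B ^ 3 * weight A B (k + 2) M" by (rule weight_Suc_Suc_ge)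
  then have "weight A B k m powr p \<le> (A / B ^ 3 * weight A B (k + 2) M) powr p"
    using p weight_pos[OF AB_pos, of k m] by (intro powr_mono2) auto
  also have "\<dots> = (A / B ^ 3) powr p * W"
    using weight_pos[OF AB_pos, of "k + 2" M] A B
    by (simp only: W_def weight_powr[OF AB_pos, symmetric]) (rule powr_mult)
  finally have w: "weight A B k m powr p \<le> (A / B ^ 3) powr p * W" .
  obtain d where d: "K = k + 2 + d" using K by (metis le_add_diff_inverse)
  have "l ^ DIM('a) = l ^ (DIM('a) - 1) * l" using DIM_positive[where 'a='a] by (metis power_minus_mult)
  also have "\<dots> \<le> l ^ (DIM('a) - 1) * (16 / 4 ^ (k + 2))" using l unfolding four by (intro mult_left_mono) auto
  finally have "l ^ DIM('a) * weight A B k m powr p \<le> l ^ (DIM('a) - 1) * (16 / 4 ^ (k + 2)) * ((A / B ^ 3) powr p * W)"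
    using w l by (intro mult_mono) auto
  also have "\<dots> = 16 * (A / B ^ 3) powr p * (l ^ (DIM('a) - 1) * (W * ((A powr p + B powr p) / 2) ^ d / 4 ^ (k + 2)))"
    by (simp add: mean_powr)
  finally have "ennreal (l ^ DIM('a) * weight A B k m powr p)
    \<le> ennreal (16 * (A / B ^ 3) powr p * (l ^ (DIM('a) - 1) * (W * ((A powr p + B powr p) / 2) ^ d / 4 ^ (k + 2))))"
    by (rule ennreal_leI)
  also have "\<dots> = ennreal (16 * (A / B ^ 3) powr p) * ennreal (l ^ (DIM('a) - 1) * (W * ((A powr p + B powr p) / 2) ^ d / 4 ^ (k + 2)))"
    using l W0 by (intro ennreal_mult) (auto simp: mean_powr)
  also have "\<dots> \<le> ennreal (16 * (A / B ^ 3) powr p)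
      * (\<integral>\<^sup>+x. ennreal (cascade (A powr p) (B powr p) (k + 2 + d) (x \<bullet> i)) * indicator (box q (q + l *\<^sub>R One)) x \<partial>lborel)"
    unfolding W_def by (intro mult_left_mono nn_integral_cascade_cube_ge[OF powr_pos i l(1) cell1 cell2]) auto
  finally show ?thesis unfolding d m_def cascade_powr[OF AB_pos] .
qed

context
  fixes i :: "'a::euclidean_space" and a :: real and c :: "nat \<Rightarrow> real" and f :: "real \<Rightarrow> real" and L :: real
  assumes i: "i \<in> Basis" and c: "\<And>j. 0 \<le> c j \<and> c j \<le> a" and f: "represents A B c f"
    and L: "0 \<le> L" "\<And>x y::'a. x \<in> cbox (-2 *\<^sub>R One) (3 *\<^sub>R One) \<Longrightarrow>
     y \<in> cbox (-2 *\<^sub>R One) (3 *\<^sub>R One) \<Longrightarrow> \<bar>cutoff x - cutoff y\<bar> \<le> L * norm (x - y)"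
begin

lemma a_nonneg: "0 \<le> a" using c[of 0] by linarith

abbreviation h :: "'a \<Rightarrow> real" where "h \<equiv> localized i f"

lemma f_measurable [measurable]: "f \<in> borel_measurable borel"
  using f by (simp add: represents_def)

lemma h_measurable [measurable]: "h \<in> borel_measurable borel"
  unfolding localized_def[abs_def] by measurable

lemma nn_integral_h: "(\<integral>\<^sup>+x. ennreal \<bar>h x\<bar> \<partial>lborel) \<le> ennreal (a * 3 ^ DIM('a) / (1 - ratio))"
proof -
  let ?Q = "box (- One) (- One + of_nat 3 *\<^sub>R One) :: 'a set"
  have "(\<integral>\<^sup>+x. ennreal \<bar>h x\<bar> \<partial>lborel)
      \<le> (\<integral>\<^sup>+x. (\<Sum>j. ennreal (c (j + 0) * cascade A B (j + 0) (x \<bullet> i))) * indicator ?Q x \<partial>lborel)"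
  proof (rule nn_integral_mono)
    fix x :: 'a
    have "- One + of_nat 3 *\<^sub>R One = (-1 + 3) *\<^sub>R (One :: 'a)" by (simp only: scaleR_left_distrib) simp
    then have Q: "?Q = box (- One) (2 *\<^sub>R One)" by simp
    show "ennreal \<bar>h x\<bar> \<le> (\<Sum>j. ennreal (c (j + 0) * cascade A B (j + 0) (x \<bullet> i))) * indicator ?Q x"
    proof (cases "x \<in> ?Q")
      case True
      have "\<bar>h x\<bar> \<le> \<bar>f (x \<bullet> i)\<bar>"
        using cutoff_bounds[of x] by (simp add: localized_def abs_mult mult_left_le_one_le)
      then have "ennreal \<bar>h x\<bar> \<le> ennreal \<bar>f (x \<bullet> i) - (\<Sum>j<0. c j * cascade A B j (x \<bullet> i))\<bar>"
        by (simp add: ennreal_leI)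
      also have "\<dots> \<le> (\<Sum>j. ennreal (c (j + 0) * cascade A B (j + 0) (x \<bullet> i)))"
        using f unfolding represents_def by blast
      finally show ?thesis using True by simp
    next
      case False
      then show ?thesis using cutoff_eq_0[OF False[unfolded Q]] by (simp add: localized_def)
    qed
  qed
  also have "\<dots> \<le> ennreal (a * 3 ^ DIM('a) / (1 - ratio))"
  proof (rule nn_integral_series_le[OF _ _ _ c])
    show "(\<integral>\<^sup>+x. ennreal (cascade A B (j + 0) (x \<bullet> i)) * indicator ?Q x \<partial>lborel) \<le> ennreal (3 ^ DIM('a) * ratio ^ j)" for j
      using nn_integral_cascade_integer_cube_le[OF AB_pos i, of "- One" "-1" 3 j] i
      by (simp add: ratio_def)
  qed auto
  finally show ?thesis .
qed

lemma h_integrable: "integrable lebesgue h"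
proof -
  have "integrable lborel h"
    using nn_integral_h by (intro integrableI_bounded) (auto simp: le_less_trans[OF _ ennreal_less_top])
  then show ?thesis by (simp add: integrable_completion)
qed

lemma h_L1_loc: "h \<in> L1_loc"
  by (rule L1_loc_integrable[OF h_integrable])

text \<open>
  The oscillation is compared with the constant \<open>cutoff q * S\<close>, where \<open>S\<close> is the partial sum of level
  \<open>k\<close> at the corner \<open>q\<close>.  Three errors arise: the tail of the series, whose average is at most a multiple
  of \<open>a w\<close>; the change of the partial sum to the next interval, which is also at most a multiple of
  \<open>a w\<close>; and the variation of the cutoff times \<open>S\<close>.  For the last one, \<open>S\<close> may be large, but it is at
  most \<open>a (k + 1) A\<^sup>k \<le> a 4\<^sup>k\<close>, which the side of the cube compensates.
\<close>

lemma osc_small_cube: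
  assumes l: "0 < l" "1 / 4 ^ Suc k < l" "l \<le> 1 / 4 ^ k"
    and Qdef: "Q = box q (q + l *\<^sub>R One)" and meets: "Q \<inter> box (- One) (2 *\<^sub>R One) \<noteq> {}"
  shows "osc Q h \<le> osc_const L DIM('a) * a * (weight A B k \<lfloor>4 ^ k * (q \<bullet> i)\<rfloor> + 1)"
proof -
  define m where "m = \<lfloor>4 ^ k * (q \<bullet> i)\<rfloor>"
  define w where "w = weight A B k m"
  define S where "S = cell_partial_sum A B c k m"
  have Q: "is_cube Q" unfolding is_cube_def Qdef using l(1) by blast
  have [measurable]: "Q \<in> sets borel" by (rule cube_borel[OF Q])
  have l1: "l \<le> 1" using l(3) by (rule order_trans) simp
  have near: "-2 \<le> q \<bullet> b \<and> q \<bullet> b \<le> 2" if b: "b \<in> Basis" for b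
  proof -
    obtain y where "y \<in> Q" "y \<in> box (- One) (2 *\<^sub>R One)" using meets by auto
    then have "q \<bullet> b < y \<bullet> b" "y \<bullet> b < q \<bullet> b + l" "-1 < y \<bullet> b" "y \<bullet> b < 2"
      using b by (auto simp: Qdef mem_box inner_add_left)
    with l1 show ?thesis by linarith
  qed
  have qbox: "q \<in> cbox (-2 *\<^sub>R One) (3 *\<^sub>R One)" using near by (fastforce simp: mem_box)
  have w: "0 < w" unfolding w_def by (rule weight_pos[OF AB_pos])
  have wle: "weight A B k (m + 1) \<le> A / B * w"
    unfolding w_def using A B by (intro weight_adjacent) auto
  have pa: "0 < B" "B < A" "1 < A" "0 \<le> a" using A B a_nonneg by auto
  have S: "0 \<le> S" "S \<le> a * (of_nat k + 1) * A ^ k"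
    unfolding S_def by (rule cell_partial_sum_bounds[OF pa c])+
  \<comment> \<open>since \<open>A < 2\<close>, the growth of the partial sums is slower than the decay of the side\<close>
  have kA: "(of_nat k + 1) * A ^ k \<le> 4 ^ k"
  proof -
    have "(of_nat k + 1 :: real) \<le> 2 ^ k" by (induction k) (auto simp: algebra_simps)
    moreover have "A ^ k \<le> 2 ^ k" using A by (intro power_mono) auto
    ultimately have "(of_nat k + 1) * A ^ k \<le> 2 ^ k * 2 ^ k" using A by (intro mult_mono) auto
    also have "(2::real) ^ k * 2 ^ k = 4 ^ k" by (simp flip: power_mult_distrib)
    finally show ?thesis .
  qed
  have lS: "l * S \<le> a"
  proof -
    have "l * S \<le> 1 / 4 ^ k * (a * ((of_nat k + 1) * A ^ k))"
      using l S by (intro mult_mono) (auto simp: mult.assoc)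
    also have "\<dots> \<le> 1 / 4 ^ k * (a * 4 ^ k)" using kA a_nonneg by (intro mult_left_mono) auto
    finally show ?thesis by simp
  qed
  define E where "E = a * (jump * w + L * DIM('a))"
  have E0: "0 \<le> E" using a_nonneg jump_pos w L(1) by (simp add: E_def)
  let ?tail = "\<lambda>x::'a. \<Sum>j. ennreal (c (j + Suc k) * cascade A B (j + Suc k) (x \<bullet> i))"
  have pt: "ennreal \<bar>h x - cutoff q * S\<bar> \<le> ?tail x + ennreal E" if x: "x \<in> Q" for x
  proof -
    define P where "P = cell_partial_sum A B c k \<lfloor>4 ^ k * (x \<bullet> i)\<rfloor>"
    have P: "P = (\<Sum>j<Suc k. c j * cascade A B j (x \<bullet> i))"
      by (simp only: P_def sum_cascade_eq_cell_partial_sum[symmetric] lessThan_Suc_atMost)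
    have xb: "q \<bullet> b < x \<bullet> b" "x \<bullet> b < q \<bullet> b + l" if "b \<in> Basis" for b
      using x that by (auto simp: Qdef mem_box inner_add_left)
    have xbox: "x \<in> cbox (-2 *\<^sub>R One) (3 *\<^sub>R One)" using near xb l1 by (fastforce simp: mem_box)
    have "norm (x - q) \<le> (\<Sum>b\<in>Basis. \<bar>(x - q) \<bullet> b\<bar>)" by (rule norm_le_l1)
    also have "\<dots> \<le> (\<Sum>b\<in>(Basis::'a set). l)"
    proof (rule sum_mono)
      fix b :: 'a assume "b \<in> Basis"
      then show "\<bar>(x - q) \<bullet> b\<bar> \<le> l" using xb[of b] by (simp add: inner_diff_left)
    qed
    finally have nxq: "norm (x - q) \<le> DIM('a) * l" by simp
    have "\<bar>cutoff x - cutoff q\<bar> \<le> L * (DIM('a) * l)"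
      using L(2)[OF xbox qbox] mult_left_mono[OF nxq L(1)] by linarith
    then have t3: "\<bar>cutoff x - cutoff q\<bar> * S \<le> L * DIM('a) * a"
      using mult_right_mono[of "\<bar>cutoff x - cutoff q\<bar>" "L * (DIM('a) * l)" S] S(1)
        mult_left_mono[OF lS, of "L * DIM('a)"] L(1) by (simp add: mult_ac)
    have "\<lfloor>4 ^ k * (x \<bullet> i)\<rfloor> = m \<or> \<lfloor>4 ^ k * (x \<bullet> i)\<rfloor> = m + 1"
    proof -
      have "4 ^ k * (q \<bullet> i) < 4 ^ k * (x \<bullet> i)" using xb[OF i] by simp
      moreover have "4 ^ k * (x \<bullet> i) < 4 ^ k * (q \<bullet> i + l)" using xb[OF i] by (intro mult_strict_left_mono) auto
      moreover have "4 ^ k * (q \<bullet> i + l) \<le> 4 ^ k * (q \<bullet> i) + 1" using l by (simp add: field_simps)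
      ultimately have "m \<le> \<lfloor>4 ^ k * (x \<bullet> i)\<rfloor>" "\<lfloor>4 ^ k * (x \<bullet> i)\<rfloor> \<le> m + 1" unfolding m_def by linarith+
      then show ?thesis by linarith
    qed
    then have "P = S \<or> P = cell_partial_sum A B c k (m + 1)" by (auto simp: P_def S_def)
    moreover have "\<bar>cell_partial_sum A B c k (m + 1) - S\<bar> \<le> jump * a * w"
      using cell_partial_sum_adjacent[where c = c and a = a and k = k and m = m, OF pa c]
      by (simp only: S_def w_def jump_def)
    moreover have "0 \<le> jump * a * w" using a_nonneg w jump_pos by simp
    ultimately have "\<bar>P - S\<bar> \<le> jump * a * w" by auto
    moreover have "\<bar>h x - cutoff q * S\<bar> \<le> \<bar>f (x \<bullet> i) - P\<bar> + \<bar>P - S\<bar> + \<bar>cutoff x - cutoff q\<bar> * S"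
    proof -
      have "h x - cutoff q * S = cutoff x * (f (x \<bullet> i) - P) + cutoff x * (P - S) + (cutoff x - cutoff q) * S"
        by (simp add: localized_def algebra_simps)
      moreover have "\<bar>cutoff x * y\<bar> \<le> \<bar>y\<bar>" for y
        using cutoff_bounds[of x] by (simp add: abs_mult mult_left_le_one_le)
      moreover have "\<bar>(cutoff x - cutoff q) * S\<bar> = \<bar>cutoff x - cutoff q\<bar> * S" using S by (simp add: abs_mult)
      ultimately show ?thesis by (smt (verit, best))
    qed
    ultimately have "\<bar>h x - cutoff q * S\<bar> \<le> \<bar>f (x \<bullet> i) - P\<bar> + E"
      using t3 by (simp add: E_def algebra_simps)
    then have "ennreal \<bar>h x - cutoff q * S\<bar> \<le> ennreal (\<bar>f (x \<bullet> i) - P\<bar> + E)" by (rule ennreal_leI)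
    also have "\<dots> = ennreal \<bar>f (x \<bullet> i) - P\<bar> + ennreal E" using E0 by (intro ennreal_plus) auto
    also have "ennreal \<bar>f (x \<bullet> i) - P\<bar> \<le> ?tail x" using f unfolding represents_def P by blast
    finally show ?thesis by (simp add: add_right_mono)
  qed
  define V where "V = l ^ DIM('a)"
  have V: "measure lebesgue Q = V" "0 < V" unfolding V_def Qdef by (rule measure_cube[OF l(1)]) (rule zero_less_power[OF l(1)])
  have Vl: "l ^ (DIM('a) - 1) * l = V" unfolding V_def using DIM_positive[where 'a='a] by (metis power_minus_mult)
  define X where "X = l ^ (DIM('a) - 1) * ((w + weight A B k (m + 1)) * ratio / 4 ^ k)"
  have X0: "0 \<le> X" unfolding X_def using l w weight_pos[OF AB_pos, of k "m + 1"] ratio_bounds by simp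
  have "1 / 4 ^ k \<le> 4 * l" using l(2) by simp
  then have X: "X \<le> 4 * (1 + A / B) * w * V"
  proof -
    have "(w + weight A B k (m + 1)) * ratio * (1 / 4 ^ k) \<le> (w + A / B * w) * 1 * (4 * l)"
      using wle w weight_pos[OF AB_pos, of k "m + 1"] ratio_bounds l AB_pos \<open>1 / 4 ^ k \<le> 4 * l\<close>
      by (intro mult_mono mult_nonneg_nonneg add_nonneg_nonneg) auto
    then have "X \<le> l ^ (DIM('a) - 1) * ((w + A / B * w) * 1 * (4 * l))"
      unfolding X_def using l by (intro mult_left_mono) auto
    also have "\<dots> = 4 * (1 + A / B) * w * (l ^ (DIM('a) - 1) * l)" by (simp add: algebra_simps)
    finally show ?thesis unfolding Vl .
  qed
  have tail: "(\<integral>\<^sup>+x. ?tail x * indicator Q x \<partial>lborel) \<le> ennreal (a * X / (1 - ratio))"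
  proof (rule nn_integral_series_le[OF _ _ X0 c])
    fix j
    have "(\<integral>\<^sup>+x. ennreal (cascade A B (k + Suc j) (x \<bullet> i)) * indicator Q x \<partial>lborel)
      \<le> ennreal (l ^ (DIM('a) - 1) * ((w + weight A B k (m + 1)) * ratio ^ Suc j / 4 ^ k))"
      unfolding Qdef w_def m_def ratio_def by (rule nn_integral_cascade_cube_le[OF AB_pos i l(1,3)])
    then show "(\<integral>\<^sup>+x. ennreal (cascade A B (j + Suc k) (x \<bullet> i)) * indicator Q x \<partial>lborel) \<le> ennreal (X * ratio ^ j)"
      by (simp add: X_def add.commute mult_ac)
  qed simp
  have iQ: "set_integrable lebesgue Q h" by (rule L1_loc_cube[OF h_L1_loc Q])
  have iQ': "set_integrable lebesgue Q (\<lambda>x. h x - cutoff q * S)"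
    using iQ set_integrable_cube_const[OF Q] by (rule set_integral_diff)
  have "ennreal (V * avg Q (\<lambda>x. \<bar>h x - cutoff q * S\<bar>)) = (\<integral>\<^sup>+x. ennreal \<bar>h x - cutoff q * S\<bar> * indicator Q x \<partial>lborel)"
    using measure_mult_avg_abs[OF Q iQ'] by (simp only: V)
  also have "\<dots> \<le> (\<integral>\<^sup>+x. ?tail x * indicator Q x + ennreal E * indicator Q x \<partial>lborel)"
    by (intro nn_integral_mono) (use pt in \<open>auto simp: indicator_def\<close>)
  also have "\<dots> = (\<integral>\<^sup>+x. ?tail x * indicator Q x \<partial>lborel) + (\<integral>\<^sup>+x. ennreal E * indicator Q x \<partial>lborel)"
    by (rule nn_integral_add) measurable
  also have "(\<integral>\<^sup>+x. ennreal E * indicator Q x \<partial>lborel) = ennreal (E * V)"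
    using E0 V l by (subst nn_integral_cmult_indicator) (auto simp: Qdef emeasure_cube V_def ennreal_mult)
  also have "(\<integral>\<^sup>+x. ?tail x * indicator Q x \<partial>lborel) + ennreal (E * V) \<le> ennreal (a * X / (1 - ratio)) + ennreal (E * V)"
    by (intro add_right_mono tail)
  also have "\<dots> = ennreal (a * X / (1 - ratio) + E * V)"
    using a_nonneg X0 ratio_bounds E0 V by (intro ennreal_plus[symmetric]) auto
  finally have "V * avg Q (\<lambda>x. \<bar>h x - cutoff q * S\<bar>) \<le> a * X / (1 - ratio) + E * V"
    using a_nonneg X0 ratio_bounds E0 V by (subst (asm) ennreal_le_iff) auto
  also have "a * X / (1 - ratio) + E * V \<le> a * (4 * (1 + A / B) * w * V) / (1 - ratio) + E * V"
    using X a_nonneg ratio_bounds by (intro add_right_mono divide_right_mono mult_left_mono) auto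
  also have "a * (4 * (1 + A / B) * w * V) / (1 - ratio) + E * V
      = V * (a * ((jump + 4 * (1 + A / B) / (1 - ratio)) * w + L * DIM('a)))"
    using ratio_bounds by (simp add: E_def field_simps)
  also have "\<dots> \<le> V * (a * ((jump + 4 * (1 + A / B) / (1 - ratio) + L * DIM('a)) * (w + 1)))"
  proof (intro mult_left_mono)
    have "0 \<le> L * DIM('a) * w" "0 \<le> jump + 4 * (1 + A / B) / (1 - ratio)"
      using L w jump_pos A B ratio_bounds by (auto intro!: add_nonneg_nonneg divide_nonneg_pos)
    then show "(jump + 4 * (1 + A / B) / (1 - ratio)) * w + L * DIM('a)
        \<le> (jump + 4 * (1 + A / B) / (1 - ratio) + L * DIM('a)) * (w + 1)"
      unfolding distrib_left distrib_right by linarith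
  qed (use V a_nonneg in auto)
  finally have "avg Q (\<lambda>x. \<bar>h x - cutoff q * S\<bar>)
      \<le> a * ((jump + 4 * (1 + A / B) / (1 - ratio) + L * DIM('a)) * (w + 1))"
    using V(2) by (rule mult_left_le_imp_le)
  then have "osc Q h \<le> 2 * (a * ((jump + 4 * (1 + A / B) / (1 - ratio) + L * DIM('a)) * (w + 1)))"
    using osc_le_avg_diff[OF Q iQ, of "cutoff q * S"] by linarith
  also have "\<dots> = osc_const L DIM('a) * a * (w + 1)" unfolding osc_const_def by (simp only: mult_ac)
  finally show ?thesis by (simp only: w_def m_def)
qed

lemma osc_powr_small_cube:
  assumes l: "0 < l" "1 / 4 ^ Suc k < l" "l \<le> 1 / 4 ^ k"
    and Qdef: "Q = box q (q + l *\<^sub>R One)" and meets: "Q \<inter> box (- One) (2 *\<^sub>R One) \<noteq> {}" and K: "k + 2 \<le> K"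
  shows "ennreal (measure lebesgue Q * osc Q h powr p) \<le> ennreal (density_const L DIM('a) * a powr p)
     * (\<integral>\<^sup>+x. (ennreal (cascade A B K (x \<bullet> i) powr p) + 1) * indicator Q x \<partial>lborel)"
proof -
  define w where "w = weight A B k \<lfloor>4 ^ k * (q \<bullet> i)\<rfloor>"
  define V where "V = l ^ DIM('a)"
  define D where "D = 16 * (A / B ^ 3) powr p"
  define I where "I = (\<integral>\<^sup>+x. ennreal (cascade A B K (x \<bullet> i) powr p) * indicator Q x \<partial>lborel)"
  define b where "b = (2 * osc_const L DIM('a) * a) powr p"
  have Q: "is_cube Q" unfolding is_cube_def Qdef using l(1) by blast
  have [measurable]: "Q \<in> sets borel" by (rule cube_borel[OF Q])
  have V: "measure lebesgue Q = V" "0 < V" unfolding V_def Qdef by (rule measure_cube[OF l(1)]) (rule zero_less_power[OF l(1)])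
  have w: "0 < w" unfolding w_def by (rule weight_pos[OF AB_pos])
  have D: "0 \<le> D" by (simp add: D_def)
  have c0: "0 \<le> osc_const L DIM('a) * a" using osc_const_pos[OF L(1)] a_nonneg by (simp add: less_imp_le)
  have "osc Q h powr p \<le> (osc_const L DIM('a) * a * (w + 1)) powr p"
    using p osc_nonneg[OF Q] osc_small_cube[OF l Qdef meets] unfolding w_def by (intro powr_mono2) auto
  also have "\<dots> = (osc_const L DIM('a) * a) powr p * (w + 1) powr p" using w c0 by (intro powr_mult)
  also have "\<dots> \<le> (osc_const L DIM('a) * a) powr p * (2 powr p * (w powr p + 1 powr p))"
    using w p by (intro mult_left_mono powr_add_le) auto
  also have "\<dots> = b * (w powr p + 1)"
    unfolding b_def mult.assoc[of 2] using c0 by (subst powr_mult[of 2]) (auto simp: mult_ac)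
  finally have "V * osc Q h powr p \<le> V * (b * (w powr p + 1))" using V by (intro mult_left_mono) auto
  then have "ennreal (V * osc Q h powr p) \<le> ennreal (b * (V * w powr p + V))"
    by (intro ennreal_leI) (simp add: algebra_simps)
  also have "\<dots> = ennreal b * (ennreal (V * w powr p) + ennreal V)"
    using V by (simp add: ennreal_mult ennreal_plus b_def)
  also have "\<dots> \<le> ennreal b * (ennreal D * I + ennreal V)"
    using cube_weight_powr_le[OF i l K, of q]
    unfolding D_def I_def Qdef w_def V_def by (intro mult_left_mono add_right_mono) auto
  also have "\<dots> \<le> ennreal b * (ennreal (D + 1) * I + ennreal (D + 1) * ennreal V)"
  proof -
    have D1: "ennreal D \<le> ennreal (D + 1)" "1 \<le> ennreal (D + 1)" using D ennreal_leI[of 1 "D + 1"] by (auto intro: ennreal_leI)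
    have "ennreal D * I \<le> ennreal (D + 1) * I" "1 * ennreal V \<le> ennreal (D + 1) * ennreal V"
      by (rule mult_right_mono[OF D1(1)], simp) (rule mult_right_mono[OF D1(2)], simp)
    then show ?thesis by (intro mult_left_mono add_mono) simp_all
  qed
  also have "\<dots> = ennreal b * ennreal (D + 1) * (I + ennreal V)"
    by (simp only: distrib_left mult.assoc)
  also have "ennreal b * ennreal (D + 1) = ennreal (b * (D + 1))"
    using D by (intro ennreal_mult[symmetric]) (auto simp: b_def)
  also have "I + ennreal V = (\<integral>\<^sup>+x. (ennreal (cascade A B K (x \<bullet> i) powr p) + 1) * indicator Q x \<partial>lborel)"
    unfolding distrib_right I_def using l
    by (subst nn_integral_add) (auto simp: Qdef emeasure_cube V_def)
  also have "b * (D + 1) = density_const L DIM('a) * a powr p"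
  proof -
    have "b = (2 * osc_const L DIM('a)) powr p * a powr p"
      unfolding b_def using osc_const_pos[OF L(1)] a_nonneg by (intro powr_mult)
    then show ?thesis by (simp add: density_const_def D_def)
  qed
  finally show ?thesis by (simp only: V)
qed

text \<open>
  For cubes of volume at least \<open>1\<close>, the power \<open>|Q| powr (1 - p)\<close> in front of the \<open>p\<close>-th power of the
  integral of \<open>|h|\<close> can be dropped.
\<close>

lemma osc_powr_large_cube:
  assumes Q: "is_cube Q" and V: "1 \<le> measure lebesgue Q"
  shows "ennreal (measure lebesgue Q * osc Q h powr p)
    \<le> ennreal (2 powr p * (a * 3 ^ DIM('a) / (1 - ratio)) powr (p - 1)) * (\<integral>\<^sup>+x. ennreal \<bar>h x\<bar> * indicator Q x \<partial>lborel)"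
proof -
  define H where "H = a * 3 ^ DIM('a) / (1 - ratio)"
  define V where "V = measure lebesgue Q"
  define s where "s = V * avg Q (\<lambda>x. \<bar>h x\<bar>)"
  have V1: "1 \<le> V" using V by (simp add: V_def)
  have iQ: "set_integrable lebesgue Q h" by (rule L1_loc_cube[OF h_L1_loc Q])
  have se: "ennreal s = (\<integral>\<^sup>+x. ennreal \<bar>h x\<bar> * indicator Q x \<partial>lborel)"
    unfolding s_def V_def by (rule measure_mult_avg_abs[OF Q iQ])
  have s0: "0 \<le> s" unfolding s_def using V1 avg_nonneg[OF Q, of "\<lambda>x. \<bar>h x\<bar>"] by simp
  have "ennreal s \<le> (\<integral>\<^sup>+x. ennreal \<bar>h x\<bar> \<partial>lborel)"
    unfolding se by (intro nn_integral_mono) (auto simp: indicator_def)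
  also have "\<dots> \<le> ennreal H" unfolding H_def by (rule nn_integral_h)
  finally have "s \<le> H" using a_nonneg ratio_bounds by (subst (asm) ennreal_le_iff) (auto simp: H_def)
  have osc_le: "osc Q h \<le> 2 * (s / V)"
    using osc_le_avg_diff[OF Q iQ, of 0] V1 by (simp add: s_def)
  have "V * osc Q h powr p \<le> V * (2 * (s / V)) powr p"
    using p osc_nonneg[OF Q] osc_le V1 by (intro mult_left_mono powr_mono2) auto
  also have "\<dots> \<le> 2 powr p * (H powr (p - 1) * s)"
  proof (cases "s = 0")
    case False
    then have s: "0 < s" using s0 by simp
    have "V * (2 * (s / V)) powr p = 2 powr p * (V * (s powr p / V powr p))"
      using s V1 by (simp add: powr_mult powr_divide)
    also have "V * (s powr p / V powr p) \<le> s powr p"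
    proof -
      have "V powr 1 \<le> V powr p" using V1 p by (intro powr_mono) auto
      then have "V * s powr p \<le> V powr p * s powr p" using V1 by (intro mult_right_mono) auto
      then show ?thesis using V1 by (simp add: field_simps)
    qed
    also have "s powr p = s powr (p - 1) * s" using s by (simp add: powr_diff)
    also have "s powr (p - 1) * s \<le> H powr (p - 1) * s"
      using s \<open>s \<le> H\<close> p by (intro mult_right_mono powr_mono2) auto
    finally show ?thesis by simp
  qed (use p in simp)
  finally have "ennreal (V * osc Q h powr p) \<le> ennreal (2 powr p * H powr (p - 1) * s)"
    by (intro ennreal_leI) (simp add: mult.assoc)
  also have "\<dots> = ennreal (2 powr p * H powr (p - 1)) * ennreal s" using s0 by (intro ennreal_mult) auto
  finally show ?thesis unfolding se V_def H_def .
qed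

text \<open>
  Small cubes are charged to the density \<open>W\<^sub>K\<^sup>p + 1\<close> on a fixed box, large ones to \<open>|h|\<close>.
\<close>

theorem JN_bound_h: "JN_bound p h (a * JN_const L DIM('a))"
proof (rule JN_bound_by_density)
  define H where "H = a * 3 ^ DIM('a) / (1 - ratio)"
  \<comment> \<open>every cube of side at most \<open>1\<close> that meets the support of the cutoff lies in this box\<close>
  let ?B = "box (-2 *\<^sub>R One) (-2 *\<^sub>R One + of_nat 5 *\<^sub>R One) :: 'a set"
  let ?C = "density_const L DIM('a) * a powr p" and ?G = "2 powr p * H powr (p - 1)"
  define u where "u K x = ennreal ?C * ((ennreal (cascade A B K (x \<bullet> i) powr p) + 1) * indicator ?B x)" for K :: nat and x
  define v where "v x = ennreal ?G * ennreal \<bar>h x\<bar>" for x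
  have [measurable]: "u K \<in> borel_measurable borel" "v \<in> borel_measurable borel" for K
    unfolding u_def v_def by measurable
  show "(\<lambda>x. u K x + v x) \<in> borel_measurable borel" for K by measurable
  have C0: "0 \<le> ?C" by (simp add: density_const_def)
  have H0: "0 \<le> H" using a_nonneg ratio_bounds by (simp add: H_def)
  show "0 \<le> a * JN_const L DIM('a)" using a_nonneg by (simp add: JN_const_def)
  show "(\<integral>\<^sup>+x. u K x + v x \<partial>lborel) \<le> ennreal ((a * JN_const L DIM('a)) powr p)" for K
  proof -
    have "(\<integral>\<^sup>+x. (ennreal (cascade A B K (x \<bullet> i) powr p) + 1) * indicator ?B x \<partial>lborel)
       = (\<integral>\<^sup>+x. ennreal (cascade (A powr p) (B powr p) K (x \<bullet> i)) * indicator ?B x + indicator ?B x \<partial>lborel)"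
      by (intro nn_integral_cong) (simp add: distrib_right cascade_powr[OF AB_pos])
    also have "\<dots> = (\<integral>\<^sup>+x. ennreal (cascade (A powr p) (B powr p) K (x \<bullet> i)) * indicator ?B x \<partial>lborel) + emeasure lborel ?B"
      by (subst nn_integral_add) auto
    also have "\<dots> \<le> ennreal (5 ^ DIM('a)) + ennreal (5 ^ DIM('a))"
    proof (intro add_mono)
      show "(\<integral>\<^sup>+x. ennreal (cascade (A powr p) (B powr p) K (x \<bullet> i)) * indicator ?B x \<partial>lborel) \<le> ennreal (5 ^ DIM('a))"
        using nn_integral_cascade_integer_cube_le[OF powr_pos i, of "-2 *\<^sub>R One" "-2" 5 K] i
        by (simp add: mean_powr)
      show "emeasure lborel ?B \<le> ennreal (5 ^ DIM('a))"
        using emeasure_cube[of "of_nat 5" "-2 *\<^sub>R One :: 'a"] by simp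
    qed
    also have "\<dots> = ennreal (2 * 5 ^ DIM('a))" by (subst ennreal_plus[symmetric]) auto
    finally have "(\<integral>\<^sup>+x. u K x \<partial>lborel) \<le> ennreal ?C * ennreal (2 * 5 ^ DIM('a))"
      unfolding u_def by (subst nn_integral_cmult) (auto intro: mult_left_mono)
    also have "\<dots> = ennreal (?C * (2 * 5 ^ DIM('a)))" using C0 by (intro ennreal_mult[symmetric]) auto
    finally have 1: "(\<integral>\<^sup>+x. u K x \<partial>lborel) \<le> ennreal (?C * (2 * 5 ^ DIM('a)))" .
    have "(\<integral>\<^sup>+x. v x \<partial>lborel) = ennreal ?G * (\<integral>\<^sup>+x. ennreal \<bar>h x\<bar> \<partial>lborel)"
      unfolding v_def by (rule nn_integral_cmult) measurable
    also have "\<dots> \<le> ennreal ?G * ennreal H" unfolding H_def by (intro mult_left_mono nn_integral_h) auto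
    also have "\<dots> = ennreal (?G * H)" using H0 by (intro ennreal_mult[symmetric]) auto
    also have "?G * H = 2 powr p * H powr p" using H0 by (cases "H = 0") (auto simp: powr_diff)
    finally have 2: "(\<integral>\<^sup>+x. v x \<partial>lborel) \<le> ennreal (2 powr p * H powr p)" .
    have "(\<integral>\<^sup>+x. u K x + v x \<partial>lborel) = (\<integral>\<^sup>+x. u K x \<partial>lborel) + (\<integral>\<^sup>+x. v x \<partial>lborel)"
      by (rule nn_integral_add) measurable
    also have "\<dots> \<le> ennreal (?C * (2 * 5 ^ DIM('a))) + ennreal (2 powr p * H powr p)" by (intro add_mono 1 2)
    also have "\<dots> = ennreal (?C * (2 * 5 ^ DIM('a)) + 2 powr p * H powr p)"
      using C0 by (intro ennreal_plus[symmetric]) auto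
    also have "?C * (2 * 5 ^ DIM('a)) + 2 powr p * H powr p
        = a powr p * (density_const L DIM('a) * (2 * 5 ^ DIM('a)) + 2 powr p * (3 ^ DIM('a) / (1 - ratio)) powr p)"
    proof -
      have "H powr p = (a * (3 ^ DIM('a) / (1 - ratio))) powr p" by (simp add: H_def)
      also have "\<dots> = a powr p * (3 ^ DIM('a) / (1 - ratio)) powr p"
        using a_nonneg ratio_bounds by (intro powr_mult)
      finally show ?thesis by (simp add: algebra_simps)
    qed
    also have "\<dots> = (a * JN_const L DIM('a)) powr p"
    proof -
      have "0 \<le> density_const L DIM('a)" by (simp add: density_const_def)
      then have "JN_const L DIM('a) powr p = density_const L DIM('a) * (2 * 5 ^ DIM('a)) + 2 powr p * (3 ^ DIM('a) / (1 - ratio)) powr p"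
        unfolding JN_const_def using p by (simp add: powr_powr)
      moreover have "(a * JN_const L DIM('a)) powr p = a powr p * JN_const L DIM('a) powr p"
        by (rule powr_mult)
      ultimately show ?thesis by simp
    qed
    finally show ?thesis .
  qed
  fix Q :: "'a set" assume Q: "is_cube Q"
  have [measurable]: "Q \<in> sets borel" by (rule cube_borel[OF Q])
  obtain q l where l: "0 < l" and Qdef: "Q = box q (q + l *\<^sub>R One)" using Q by (auto elim: is_cubeE)
  show "\<exists>K\<^sub>0. \<forall>K\<ge>K\<^sub>0. ennreal (measure lebesgue Q * osc Q h powr p) \<le> (\<integral>\<^sup>+x. (u K x + v x) * indicator Q x \<partial>lborel)"
  proof (cases "l \<le> 1")
    case False
    have "1 \<le> measure lebesgue Q"
      unfolding Qdef measure_cube[OF l] using False by (intro one_le_power) auto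
    from osc_powr_large_cube[OF Q this]
    have "ennreal (measure lebesgue Q * osc Q h powr p) \<le> (\<integral>\<^sup>+x. v x * indicator Q x \<partial>lborel)"
      unfolding v_def H_def by (simp add: mult.assoc nn_integral_cmult)
    also have "\<dots> \<le> (\<integral>\<^sup>+x. (u K x + v x) * indicator Q x \<partial>lborel)" for K
      by (intro nn_integral_mono mult_right_mono) auto
    finally show ?thesis by auto
  next
    case True
    show ?thesis
    proof (cases "Q \<inter> box (- One) (2 *\<^sub>R One) = {}")
      case True
      then have h0: "h x = 0" if "x \<in> Q" for x
        using cutoff_eq_0[of x] that by (auto simp: localized_def)
      then have "(\<lambda>x. indicat_real Q x *\<^sub>R h x) = (\<lambda>x. 0)" "(\<lambda>x. indicat_real Q x *\<^sub>R \<bar>h x\<bar>) = (\<lambda>x. 0)"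
        by (auto simp: indicator_def)
      then have "avg Q h = 0" "avg Q (\<lambda>x. \<bar>h x\<bar>) = 0"
        by (simp_all only: avg_def set_lebesgue_integral_def) simp_all
      then have "osc Q h = 0" unfolding osc_def by (simp add: avg_const[OF Q])
      then show ?thesis using p by simp
    next
      case False
      obtain k where k: "1 / 4 ^ Suc k < l" "l \<le> 1 / 4 ^ k" using obtain_scale[OF l True] .
      have sub: "Q \<subseteq> ?B"
      proof
        fix x assume x: "x \<in> Q"
        obtain y where y: "y \<in> Q" "y \<in> box (- One) (2 *\<^sub>R One)" using False by auto
        show "x \<in> ?B" unfolding mem_box
        proof
          fix b :: 'a assume b: "b \<in> Basis"
          have "q \<bullet> b < y \<bullet> b" "y \<bullet> b < q \<bullet> b + l" "-1 < y \<bullet> b" "y \<bullet> b < 2" "q \<bullet> b < x \<bullet> b" "x \<bullet> b < q \<bullet> b + l"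
            using x y b by (auto simp: Qdef mem_box inner_add_left)
          then show "(-2 *\<^sub>R One) \<bullet> b < x \<bullet> b \<and> x \<bullet> b < (-2 *\<^sub>R One + of_nat 5 *\<^sub>R One) \<bullet> b"
            using b True by (auto simp: inner_diff_left inner_add_left)
        qed
      qed
      have "ennreal (measure lebesgue Q * osc Q h powr p) \<le> (\<integral>\<^sup>+x. (u K x + v x) * indicator Q x \<partial>lborel)"
        if K: "k + 2 \<le> K" for K
      proof -
        have "ennreal (measure lebesgue Q * osc Q h powr p)
          \<le> ennreal ?C * (\<integral>\<^sup>+x. (ennreal (cascade A B K (x \<bullet> i) powr p) + 1) * indicator Q x \<partial>lborel)"
          by (rule osc_powr_small_cube[OF l k Qdef False K])
        also have "\<dots> = (\<integral>\<^sup>+x. ennreal ?C * ((ennreal (cascade A B K (x \<bullet> i) powr p) + 1) * indicator Q x) \<partial>lborel)"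
          by (rule nn_integral_cmult[symmetric]) measurable
        also have "\<dots> \<le> (\<integral>\<^sup>+x. (u K x + v x) * indicator Q x \<partial>lborel)"
          using sub by (intro nn_integral_mono) (auto simp: u_def indicator_def)
        finally show ?thesis .
      qed
      then show ?thesis by blast
    qed
  qed
qed

end
end

section \<open>Membership in the CJN space without integrability\<close>

text \<open>
  A bounded measurable function is an almost everywhere limit of continuous ones, which may be
  truncated to the same bound.  Dominated convergence makes them close in \<open>L\<^sup>1\<close> on \<open>S\<close>, and the
  Stone-Weierstrass theorem replaces them by polynomials.
\<close>

lemma polynomial_approx_L1:
  fixes u :: "'a::euclidean_space \<Rightarrow> real"
  assumes [measurable]: "u \<in> borel_measurable borel" and M: "\<And>x. \<bar>u x\<bar> \<le> M" and S: "compact S" and e: "0 < e"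
  obtains P where "real_polynomial_function P" "\<And>x. x \<in> S \<Longrightarrow> \<bar>P x\<bar> \<le> M + 1"
    "(\<integral>\<^sup>+x. ennreal \<bar>u x - P x\<bar> * indicator S x \<partial>lborel) \<le> ennreal e"
proof -
  have M0: "0 \<le> M" using M[of 0] by linarith
  have [measurable]: "S \<in> sets borel" using S by (rule borel_compact)
  have Sfin: "emeasure lborel S < \<infinity>" using emeasure_compact_finite[OF S] by simp
  have "u \<in> borel_measurable lebesgue" by (simp add: measurable_completion)
  then have "u measurable_on UNIV" by (rule lebesgue_measurable_imp_measurable_on_real) simp
  then obtain N g where N: "negligible N" and g: "\<And>n. continuous_on UNIV (g n)"
    and lim: "\<And>x. x \<notin> N \<Longrightarrow> (\<lambda>n. g n x) \<longlonglongrightarrow> u x"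
    unfolding measurable_on_def by auto
  define G where "G n x = max (- M) (min M (g n x))" for n :: nat and x
  have G: "continuous_on UNIV (G n)" for n
    unfolding G_def[abs_def] by (intro continuous_intros g)
  have [measurable]: "G n \<in> borel_measurable borel" for n using G by (rule borel_measurable_continuous_onI)
  have GM: "\<bar>G n x\<bar> \<le> M" for n x using M0 by (auto simp: G_def)
  have Glim: "(\<lambda>n. G n x) \<longlonglongrightarrow> u x" if "x \<notin> N" for x
  proof -
    have "(\<lambda>n. G n x) \<longlonglongrightarrow> max (- M) (min M (u x))"
      unfolding G_def by (intro tendsto_intros lim that)
    moreover have "max (- M) (min M (u x)) = u x" using M[of x] by auto
    ultimately show ?thesis by simp
  qed
  have AE: "AE x in lebesgue. x \<notin> N"
    using N by (intro AE_not_in) (simp add: negligible_iff_null_sets)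
  have "(\<lambda>n. \<integral>\<^sup>+x. ennreal \<bar>u x - G n x\<bar> * indicator S x \<partial>lebesgue) \<longlonglongrightarrow> (\<integral>\<^sup>+x. 0 \<partial>(lebesgue :: 'a measure))"
  proof (rule nn_integral_dominated_convergence[where w = "\<lambda>x. ennreal (2 * M) * indicator S x"])
    show "(\<lambda>x. ennreal \<bar>u x - G n x\<bar> * indicator S x) \<in> borel_measurable lebesgue" for n
      by (rule measurable_completion) measurable
    show "(\<lambda>x. ennreal (2 * M) * indicator S x) \<in> borel_measurable lebesgue"
      by (rule measurable_completion) measurable
    show "AE x in lebesgue. ennreal \<bar>u x - G j x\<bar> * indicator S x \<le> ennreal (2 * M) * indicator S x" for j
    proof (rule AE_I2)
      fix x
      have "\<bar>u x - G j x\<bar> \<le> 2 * M" using M[of x] GM[of j x] by linarith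
      then show "ennreal \<bar>u x - G j x\<bar> * indicator S x \<le> ennreal (2 * M) * indicator S x"
        by (intro mult_right_mono ennreal_leI) auto
    qed
    show "(\<integral>\<^sup>+x. ennreal (2 * M) * indicator S x \<partial>lebesgue) < \<infinity>"
      unfolding nn_integral_completion using Sfin
      by (subst nn_integral_cmult_indicator) (auto simp: ennreal_mult_less_top)
    show "AE x in lebesgue. (\<lambda>n. ennreal \<bar>u x - G n x\<bar> * indicator S x) \<longlonglongrightarrow> 0"
      using AE
    proof eventually_elim
      fix x assume "x \<notin> N"
      then have "(\<lambda>n. \<bar>u x - G n x\<bar>) \<longlonglongrightarrow> \<bar>u x - u x\<bar>" by (intro tendsto_intros Glim)
      then have "(\<lambda>n. ennreal \<bar>u x - G n x\<bar>) \<longlonglongrightarrow> ennreal 0" by (intro tendsto_ennrealI) simp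
      then show "(\<lambda>n. ennreal \<bar>u x - G n x\<bar> * indicator S x) \<longlonglongrightarrow> 0"
        by (cases "x \<in> S") auto
    qed
  qed simp
  then have "(\<lambda>n. \<integral>\<^sup>+x. ennreal \<bar>u x - G n x\<bar> * indicator S x \<partial>lborel) \<longlonglongrightarrow> 0"
    by (simp add: nn_integral_completion)
  then have "eventually (\<lambda>n. (\<integral>\<^sup>+x. ennreal \<bar>u x - G n x\<bar> * indicator S x \<partial>lborel) < ennreal (e / 2)) sequentially"
    using e by (intro order_tendstoD) auto
  then obtain n where n: "(\<integral>\<^sup>+x. ennreal \<bar>u x - G n x\<bar> * indicator S x \<partial>lborel) < ennreal (e / 2)"
    by (auto simp: eventually_sequentially)
  define V where "V = measure lborel S"
  have V: "emeasure lborel S = ennreal V" "0 \<le> V"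
    unfolding V_def using Sfin by (auto intro!: emeasure_eq_ennreal_measure)
  define d where "d = min 1 (e / (2 * (V + 1)))"
  have d: "0 < d" "d \<le> 1" "d * V \<le> e / 2"
  proof -
    show "0 < d" "d \<le> 1" using e V by (auto simp: d_def)
    have "d * V \<le> e / (2 * (V + 1)) * (V + 1)" using e V by (intro mult_mono) (auto simp: d_def)
    also have "\<dots> = e / 2" using V by (simp add: field_simps)
    finally show "d * V \<le> e / 2" .
  qed
  obtain P where P: "real_polynomial_function P" "\<And>x. x \<in> S \<Longrightarrow> \<bar>G n x - P x\<bar> < d"
    using Stone_Weierstrass_real_polynomial_function[OF S continuous_on_subset[OF G subset_UNIV] d(1)] by metis
  have [measurable]: "P \<in> borel_measurable borel"
    using P(1) by (intro borel_measurable_continuous_onI continuous_on_polymonial_function) (simp add: real_polynomial_function_eq)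
  show thesis
  proof (rule that[OF P(1)])
    show "\<bar>P x\<bar> \<le> M + 1" if "x \<in> S" for x using P(2)[OF that] GM[of n x] d(2) by linarith
    have "(\<integral>\<^sup>+x. ennreal \<bar>u x - P x\<bar> * indicator S x \<partial>lborel)
        \<le> (\<integral>\<^sup>+x. ennreal \<bar>u x - G n x\<bar> * indicator S x + ennreal d * indicator S x \<partial>lborel)"
    proof (rule nn_integral_mono)
      fix x
      show "ennreal \<bar>u x - P x\<bar> * indicator S x \<le> ennreal \<bar>u x - G n x\<bar> * indicator S x + ennreal d * indicator S x"
      proof (cases "x \<in> S")
        case True
        have "ennreal \<bar>u x - P x\<bar> \<le> ennreal (\<bar>u x - G n x\<bar> + d)"
          using P(2)[OF True] by (intro ennreal_leI) linarith
        then show ?thesis using True d(1) by simp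
      qed simp
    qed
    also have "\<dots> = (\<integral>\<^sup>+x. ennreal \<bar>u x - G n x\<bar> * indicator S x \<partial>lborel) + (\<integral>\<^sup>+x. ennreal d * indicator S x \<partial>lborel)"
      by (rule nn_integral_add) measurable
    also have "(\<integral>\<^sup>+x. ennreal d * indicator S x \<partial>lborel) = ennreal (d * V)"
      using V d(1) by (subst nn_integral_cmult_indicator) (auto simp: ennreal_mult)
    also have "(\<integral>\<^sup>+x. ennreal \<bar>u x - G n x\<bar> * indicator S x \<partial>lborel) + ennreal (d * V) \<le> ennreal (e / 2) + ennreal (e / 2)"
      using n d(3) by (intro add_mono ennreal_leI) auto
    also have "\<dots> = ennreal e" using e by (simp add: ennreal_plus[symmetric] del: ennreal_plus)
    finally show "(\<integral>\<^sup>+x. ennreal \<bar>u x - P x\<bar> * indicator S x \<partial>lborel) \<le> ennreal e" .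
  qed
qed

lemma bounded_compact_support_JN:
  fixes u :: "'a::euclidean_space \<Rightarrow> real"
  assumes p: "1 < p" and [measurable]: "u \<in> borel_measurable borel" and M: "\<And>x. \<bar>u x\<bar> \<le> M"
    and S: "compact S" "\<And>x. x \<notin> S \<Longrightarrow> u x = 0"
  shows "u \<in> JN_space p"
proof -
  have [measurable]: "S \<in> sets borel" using S by (intro borel_compact)
  have M0: "0 \<le> M" using M[of 0] by linarith
  have Sfin: "emeasure lborel S < \<infinity>" using emeasure_compact_finite[OF S(1)] by simp
  define V where "V = measure lborel S"
  have V: "emeasure lborel S = ennreal V" "0 \<le> V"
    unfolding V_def using Sfin by (auto intro!: emeasure_eq_ennreal_measure)
  have "(\<integral>\<^sup>+x. ennreal \<bar>u x\<bar> \<partial>lborel) \<le> (\<integral>\<^sup>+x. ennreal M * indicator S x \<partial>lborel)"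
    using M S(2) by (intro nn_integral_mono) (auto simp: indicator_def ennreal_leI)
  also have "\<dots> = ennreal (M * V)" using V M0 by (subst nn_integral_cmult_indicator) (auto simp: ennreal_mult)
  finally have i: "(\<integral>\<^sup>+x. ennreal \<bar>u x\<bar> \<partial>lborel) \<le> ennreal (M * V)" .
  have "JN_bound p u ((2 * (2 * (M + 1)) powr (p - 1) * (M * V)) powr (1 / p))"
    by (rule JN_bound_bounded_integrable[OF p]) (use M M0 V i in \<open>auto intro: order_trans[OF M]\<close>)
  moreover have "integrable lborel u"
    using i by (intro integrableI_bounded) (auto simp: le_less_trans[OF _ ennreal_less_top])
  then have "u \<in> L1_loc" by (intro L1_loc_integrable) (simp add: integrable_completion)
  ultimately show ?thesis unfolding JN_space_def by blast
qed

text \<open>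
  Approximation in \<open>L\<^sup>1\<close> by polynomials that stay bounded on the support of the cutoff is
  approximation in \<open>JN\<close> norm.
\<close>

lemma smooth_approx_cutoff:
  fixes u :: "'a::euclidean_space \<Rightarrow> real"
  assumes p: "1 < p" and [measurable]: "u \<in> borel_measurable borel" and M: "\<And>x. \<bar>u x\<bar> \<le> M" and e: "0 < e"
  obtains g where "g \<in> C_inf_c" "g \<in> JN_space p" "(\<lambda>x. cutoff x * u x - g x) \<in> L1_loc"
    "JN_bound p (\<lambda>x. cutoff x * u x - g x) e"
proof -
  let ?S = "cbox (- One) (2 *\<^sub>R One) :: 'a set"
  have M0: "0 \<le> M" using M[of 0] by linarith
  define N where "N = 2 * M + 1"
  \<comment> \<open>chosen so that the bound for functions with values up to \<open>N\<close> and integral \<open>s\<close> is \<open>e\<close>\<close>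
  define s where "s = e powr p / (2 * (2 * N) powr (p - 1))"
  have N: "0 < N" using M0 by (simp add: N_def)
  have s: "0 < s" "2 * (2 * N) powr (p - 1) * s = e powr p" using e N by (auto simp: s_def)
  obtain P where P: "real_polynomial_function P" "\<And>x. x \<in> ?S \<Longrightarrow> \<bar>P x\<bar> \<le> M + 1"
    "(\<integral>\<^sup>+x. ennreal \<bar>u x - P x\<bar> * indicator ?S x \<partial>lborel) \<le> ennreal s"
    using polynomial_approx_L1[OF assms(2) M compact_cbox s(1)] by blast
  have [measurable]: "P \<in> borel_measurable borel"
    using P(1) by (intro borel_measurable_continuous_onI continuous_on_polymonial_function) (simp add: real_polynomial_function_eq)
  have out: "cutoff x = 0" if "x \<notin> ?S" for x using cutoff_eq_0[of x] that box_subset_cbox by blast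
  have in': "\<bar>cutoff x * y\<bar> \<le> \<bar>y\<bar>" for x :: 'a and y
    using cutoff_bounds[of x] by (simp add: abs_mult mult_left_le_one_le)
  let ?g = "\<lambda>x. cutoff x * P x"
  let ?v = "\<lambda>x. cutoff x * u x - ?g x"
  have v: "?v x = cutoff x * (u x - P x)" for x by (simp add: right_diff_distrib)
  have vN: "\<bar>?v x\<bar> \<le> N" for x
  proof (cases "x \<in> ?S")
    case True
    then have "\<bar>u x - P x\<bar> \<le> N" using M[of x] P(2)[OF True] by (simp add: N_def)
    then show ?thesis unfolding v using in'[of x "u x - P x"] by linarith
  qed (use out N in auto)
  have "(\<integral>\<^sup>+x. ennreal \<bar>?v x\<bar> \<partial>lborel) \<le> (\<integral>\<^sup>+x. ennreal \<bar>u x - P x\<bar> * indicator ?S x \<partial>lborel)"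
    unfolding v using in' out by (intro nn_integral_mono) (auto simp: indicator_def ennreal_leI)
  also note P(3)
  finally have vs: "(\<integral>\<^sup>+x. ennreal \<bar>?v x\<bar> \<partial>lborel) \<le> ennreal s" .
  have "JN_bound p ?v ((2 * (2 * N) powr (p - 1) * s) powr (1 / p))"
    by (rule JN_bound_bounded_integrable[OF p _ N vN vs]) (use s in auto)
  then have "JN_bound p ?v e" using s e p by (simp add: powr_powr)
  moreover have "?v \<in> L1_loc"
  proof -
    have "?v \<in> JN_space p"
      by (rule bounded_compact_support_JN[OF p _ vN compact_cbox[of "- One" "2 *\<^sub>R One"]]) (use out in auto)
    then show ?thesis by (simp add: JN_space_def)
  qed
  moreover have "?g \<in> C_inf_c" using real_polynomial_function_C_k[OF P(1)] by (rule C_inf_c_cutoff_mult)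
  moreover have "?g \<in> JN_space p"
  proof (rule bounded_compact_support_JN[OF p _ _ compact_cbox[of "- One" "2 *\<^sub>R One"]])
    show "\<bar>?g x\<bar> \<le> M + 1" for x
    proof (cases "x \<in> ?S")
      case True
      then show ?thesis using P(2)[OF True] in'[of x "P x"] by linarith
    qed (use out M0 in auto)
  qed (use out in auto)
  ultimately show thesis using that by blast
qed

context cascade_factors
begin

text \<open>
  The constant depends on the Lipschitz constant of the cutoff, but neither on the coefficients nor
  on the representative \<open>f\<close>.  So it applies to all tails of a series.
\<close>

lemma JN_uniform:
  fixes i :: "'a::euclidean_space"
  assumes i: "i \<in> Basis"
  obtains C where "0 \<le> C"
    "\<And>a c f. (\<And>j. 0 \<le> c j \<and> c j \<le> a) \<Longrightarrow> represents A B c f \<Longrightarrow>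
       localized i f \<in> L1_loc \<and> JN_bound p (localized i f) (a * C)"
proof -
  obtain L where L: "L \<ge> 0" "\<And>x y::'a. x \<in> cbox (-2 *\<^sub>R One) (3 *\<^sub>R One) \<Longrightarrow>
     y \<in> cbox (-2 *\<^sub>R One) (3 *\<^sub>R One) \<Longrightarrow> \<bar>cutoff x - cutoff y\<bar> \<le> L * norm (x - y)"
    using cutoff_Lipschitz by blast
  show thesis
  proof (rule that[of "JN_const L DIM('a)"])
    show "0 \<le> JN_const L DIM('a)" by (simp add: JN_const_def)
    fix a c f assume c: "\<And>j. 0 \<le> c j \<and> c j \<le> (a::real)" and f: "represents A B c f"
    show "localized i f \<in> L1_loc \<and> JN_bound p (localized i f) (a * JN_const L DIM('a))"
      using h_L1_loc[OF i c f L] JN_bound_h[OF i c f L] by blast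
  qed
qed

text \<open>
  The tail from \<open>m\<close> on has coefficients bounded by \<open>c m\<close>, hence small \<open>JN\<close> norm; the remaining partial
  sum is bounded.
\<close>

lemma localized_in_CJN:
  fixes i :: "'a::euclidean_space"
  assumes i: "i \<in> Basis" and c: "\<And>j. 0 \<le> c j" and lim: "c \<longlonglongrightarrow> 0" and f: "represents A B c f" and dec: "decseq c"
  shows "localized i f \<in> CJN_space p"
proof -
  obtain C where C: "0 \<le> C"
    "\<And>a c f. (\<And>j. 0 \<le> c j \<and> c j \<le> a) \<Longrightarrow> represents A B c f \<Longrightarrow>
       localized i f \<in> L1_loc \<and> JN_bound p (localized i f) (a * C)" using JN_uniform[OF i] by blast
  have c0: "0 \<le> c j \<and> c j \<le> c 0" for j using c decseqD[OF dec, of 0 j] by simp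
  have JN: "localized i f \<in> JN_space p" using C(2)[OF c0 f] by (auto simp: JN_space_def)
  have "\<exists>g\<in>C_inf_c \<inter> JN_space p. JN_norm p (\<lambda>x. localized i f x - g x) < e" if e: "0 < e" for e
  proof -
    have "(\<lambda>m. c m * C) \<longlonglongrightarrow> 0 * C" by (intro tendsto_intros lim)
    then have "eventually (\<lambda>m. c m * C < e / 8) sequentially" using e by (intro order_tendstoD) auto
    then obtain m where m: "c m * C < e / 8" by (auto simp: eventually_sequentially)
    define c' where "c' j = (if j < m then 0 else c j)" for j
    define F where "F t = (\<Sum>j<m. c j * cascade A B j t)" for t
    define t where "t = localized i (\<lambda>t. f t - F t)"
    have "represents A B c' (\<lambda>t. f t - F t)"
      unfolding c'_def F_def by (rule represents_tail[OF AB_pos c f])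
    moreover have "0 \<le> c' j \<and> c' j \<le> c m" for j
      using c decseqD[OF dec, of m j] by (auto simp: c'_def)
    ultimately have t: "t \<in> L1_loc" "JN_bound p t (c m * C)" using C(2) unfolding t_def by blast+
    have [measurable]: "F \<in> borel_measurable borel" unfolding F_def by measurable
    have FM: "\<bar>F (x \<bullet> i)\<bar> \<le> (\<Sum>j<m. c j * A ^ j)" for x
    proof -
      have "\<bar>F (x \<bullet> i)\<bar> = F (x \<bullet> i)"
        unfolding F_def using c cascade_pos[OF AB_pos] by (simp add: sum_nonneg less_imp_le)
      also have "\<dots> \<le> (\<Sum>j<m. c j * A ^ j)"
        unfolding F_def cascade_def using c A B by (intro sum_mono mult_left_mono weight_le_power) auto
      finally show ?thesis .
    qed
    have e8: "0 < e / 8" using e by simp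
    obtain g where g: "g \<in> C_inf_c" "g \<in> JN_space p" "(\<lambda>x. cutoff x * F (x \<bullet> i) - g x) \<in> L1_loc"
      "JN_bound p (\<lambda>x. cutoff x * F (x \<bullet> i) - g x) (e / 8)"
      using smooth_approx_cutoff[OF p, of "\<lambda>x. F (x \<bullet> i)", OF _ FM e8] by (auto simp: measurable_compose)
    have "JN_bound p (\<lambda>x. t x + (cutoff x * F (x \<bullet> i) - g x)) (2 * (c m * C + e / 8))"
      by (rule JN_bound_add[OF p t(1) g(3) t(2) g(4)])
    moreover have "t x + (cutoff x * F (x \<bullet> i) - g x) = localized i f x - g x" for x
      by (simp add: t_def localized_def algebra_simps)
    ultimately have "JN_bound p (\<lambda>x. localized i f x - g x) (2 * (c m * C + e / 8))" by simp
    then have "JN_norm p (\<lambda>x. localized i f x - g x) < e" by (rule JN_norm_less) (use m e in auto)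
    with g show ?thesis by blast
  qed
  then show ?thesis unfolding CJN_space_def JN_closure_def using JN by blast
qed

lemma series_AE_finite:
  fixes i :: "'a::euclidean_space"
  assumes i: "i \<in> Basis" and c: "\<And>j. 0 \<le> c j \<and> c j \<le> a"
  shows "AE x::'a in lborel. x \<in> box 0 One \<longrightarrow> (\<Sum>j. ennreal (c j * cascade A B j (x \<bullet> i))) \<noteq> \<infinity>"
proof -
  let ?Q = "box 0 (0 + of_nat 1 *\<^sub>R One) :: 'a set"
  have "(\<integral>\<^sup>+x. (\<Sum>j. ennreal (c (j + 0) * cascade A B (j + 0) (x \<bullet> i))) * indicator ?Q x \<partial>lborel) \<le> ennreal (a * 1 / (1 - ratio))"
  proof (rule nn_integral_series_le[OF _ _ _ c])
    show "(\<integral>\<^sup>+x. ennreal (cascade A B (j + 0) (x \<bullet> i)) * indicator ?Q x \<partial>lborel) \<le> ennreal (1 * ratio ^ j)" for j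
      using nn_integral_cascade_integer_cube_le[OF AB_pos i, of 0 0 1 j] by (simp add: ratio_def)
  qed auto
  then have "(\<integral>\<^sup>+x. (\<Sum>j. ennreal (c j * cascade A B j (x \<bullet> i))) * indicator ?Q x \<partial>lborel) \<noteq> \<infinity>"
    using neq_top_trans[OF ennreal_neq_top] by simp
  then have "AE x in lborel. (\<Sum>j. ennreal (c j * cascade A B j (x \<bullet> i))) * indicator ?Q x \<noteq> \<infinity>"
    by (intro nn_integral_noteq_infinite) auto
  then show ?thesis by eventually_elim auto
qed

lemma sum_powr_le_powr_sum:
  assumes "finite I" "\<And>j. j \<in> I \<Longrightarrow> 0 \<le> (x j :: real)" "1 \<le> q"
  shows "(\<Sum>j\<in>I. x j powr q) \<le> (\<Sum>j\<in>I. x j) powr q"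
  using assms(1,2)
proof (induction I rule: finite_induct)
  case (insert j I)
  then have "(\<Sum>j\<in>insert j I. x j powr q) \<le> x j powr q + (\<Sum>j\<in>I. x j) powr q" by simp
  also have "\<dots> \<le> (x j + (\<Sum>j\<in>I. x j)) powr q" using insert assms(3) by (intro powr_superadditive sum_nonneg) auto
  finally show ?case using insert by simp
qed simp

lemma nn_integral_localized_powr_ge:
  fixes i :: "'a::euclidean_space"
  assumes i: "i \<in> Basis" and c: "\<And>j. 0 \<le> c j \<and> c j \<le> a"
  shows "ennreal (\<Sum>j<K. c j powr p) \<le> (\<integral>\<^sup>+x. ennreal (\<bar>localized i (cascade_sum A B c) x\<bar> powr p) \<partial>(lborel :: 'a measure))"
proof -
  let ?Q = "box 0 (0 + (1 / 4 ^ 0) *\<^sub>R One) :: 'a set"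
  have one: "(\<integral>\<^sup>+x. ennreal (cascade A B j (x \<bullet> i) powr p) * indicator ?Q x \<partial>lborel) = 1" for j
    using nn_integral_cascade_cell_cube[OF powr_pos i, of 0 0 0 j] by (simp add: cascade_powr[OF AB_pos] mean_powr)
  have "ennreal (\<Sum>j<K. c j powr p) = (\<Sum>j<K. ennreal (c j powr p) * 1)"
    by (simp add: sum_ennreal)
  also have "\<dots> = (\<Sum>j<K. \<integral>\<^sup>+x. ennreal (c j powr p) * (ennreal (cascade A B j (x \<bullet> i) powr p) * indicator ?Q x) \<partial>lborel)"
    by (intro sum.cong refl) (subst nn_integral_cmult, simp_all only: one, measurable)
  also have "\<dots> = (\<integral>\<^sup>+x. (\<Sum>j<K. ennreal (c j powr p) * (ennreal (cascade A B j (x \<bullet> i) powr p) * indicator ?Q x)) \<partial>lborel)"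
    by (rule nn_integral_sum[symmetric]) measurable
  also have "\<dots> \<le> (\<integral>\<^sup>+x. ennreal (\<bar>localized i (cascade_sum A B c) x\<bar> powr p) \<partial>lborel)"
  proof (rule nn_integral_mono_AE)
    show "AE x in lborel. (\<Sum>j<K. ennreal (c j powr p) * (ennreal (cascade A B j (x \<bullet> i) powr p) * indicator ?Q x))
        \<le> ennreal (\<bar>localized i (cascade_sum A B c) x\<bar> powr p)"
      using series_AE_finite[OF i c]
    proof eventually_elim
      fix x :: 'a assume fin: "x \<in> box 0 One \<longrightarrow> (\<Sum>j. ennreal (c j * cascade A B j (x \<bullet> i))) \<noteq> \<infinity>"
      show "(\<Sum>j<K. ennreal (c j powr p) * (ennreal (cascade A B j (x \<bullet> i) powr p) * indicator ?Q x))
        \<le> ennreal (\<bar>localized i (cascade_sum A B c) x\<bar> powr p)"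
      proof (cases "x \<in> ?Q")
        case True
        then have x: "x \<in> box 0 One" by simp
        define t where "t j = c j * cascade A B j (x \<bullet> i)" for j
        have t0: "0 \<le> t j" for j using c cascade_pos[OF AB_pos] by (simp add: t_def less_imp_le)
        have "cutoff x = 1" using x box_subset_cbox by (intro cutoff_eq_1) blast
        then have hx: "localized i (cascade_sum A B c) x = enn2real (\<Sum>j. ennreal (t j))"
          by (simp add: localized_def cascade_sum_def t_def)
        have "ennreal (\<Sum>j<K. t j) = (\<Sum>j<K. ennreal (t j))" using t0 by (intro sum_ennreal[symmetric])
        also have "\<dots> \<le> (\<Sum>j. ennreal (t j))" by (rule sum_le_suminf) (simp_all add: summableI)
        finally have "ennreal (\<Sum>j<K. t j) \<le> (\<Sum>j. ennreal (t j))" .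
        then have "(\<Sum>j<K. t j) \<le> enn2real (\<Sum>j. ennreal (t j))"
        proof -
          have "(\<Sum>j. ennreal (t j)) \<noteq> \<infinity>" using fin x unfolding t_def by blast
          then obtain r where "(\<Sum>j. ennreal (t j)) = ennreal r" "0 \<le> r" by (cases "\<Sum>j. ennreal (t j)") auto
          with \<open>ennreal (\<Sum>j<K. t j) \<le> (\<Sum>j. ennreal (t j))\<close> show ?thesis by (simp only: ennreal_le_iff enn2real_ennreal)
        qed
        then have ge: "(\<Sum>j<K. t j) \<le> localized i (cascade_sum A B c) x" by (simp add: hx)
        have "(\<Sum>j<K. t j powr p) \<le> (\<Sum>j<K. t j) powr p" using t0 p by (intro sum_powr_le_powr_sum) auto
        also have "\<dots> \<le> \<bar>localized i (cascade_sum A B c) x\<bar> powr p"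
          using ge t0 p by (intro powr_mono2 sum_nonneg) auto
        finally have "ennreal (\<Sum>j<K. t j powr p) \<le> ennreal (\<bar>localized i (cascade_sum A B c) x\<bar> powr p)" by (rule ennreal_leI)
        moreover have tp: "t j powr p = c j powr p * cascade A B j (x \<bullet> i) powr p" for j
          unfolding t_def by (rule powr_mult)
        have "(\<Sum>j<K. ennreal (c j powr p) * (ennreal (cascade A B j (x \<bullet> i) powr p) * indicator ?Q x))
            = (\<Sum>j<K. ennreal (t j powr p))"
          using True by (intro sum.cong refl) (simp add: tp ennreal_mult)
        moreover have "\<dots> = ennreal (\<Sum>j<K. t j powr p)" by (rule sum_ennreal) simp
        ultimately show ?thesis by simp
      qed simp
    qed
  qed
  finally show ?thesis .
qed

text \<open>
  The function vanishes off a bounded set, so no constant except \<open>0\<close> can be subtracted.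
\<close>

lemma localized_not_in_L_space_mod_const:
  fixes i :: "'a::euclidean_space"
  assumes i: "i \<in> Basis" and c: "\<And>j. 0 \<le> c j \<and> c j \<le> a" and div: "\<not> summable (\<lambda>j. c j powr p)"
  shows "localized i (cascade_sum A B c) \<notin> L_space_mod_const p"
proof
  let ?h = "localized i (cascade_sum A B c)"
  assume "?h \<in> L_space_mod_const p"
  then obtain b where "integrable lebesgue (\<lambda>x. \<bar>?h x - b\<bar> powr p)"
    by (auto simp: L_space_mod_const_def L_space_def)
  then have "(\<integral>\<^sup>+x. ennreal (norm (\<bar>?h x - b\<bar> powr p)) \<partial>lebesgue) < \<infinity>" by (simp only: integrable_iff_bounded)
  then have fin: "(\<integral>\<^sup>+x. ennreal (\<bar>?h x - b\<bar> powr p) \<partial>lborel) < \<infinity>" by (simp add: nn_integral_completion)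
  have "b = 0"
  proof (rule ccontr)
    assume b: "b \<noteq> 0"
    let ?B = "box (- One) (2 *\<^sub>R One) :: 'a set"
    have "emeasure lborel (UNIV :: 'a set) \<le> emeasure lborel ?B + emeasure lborel (- ?B)"
      using emeasure_subadditive[of ?B lborel "- ?B"] by simp
    moreover have "emeasure lborel ?B < \<infinity>" using emeasure_lborel_box_finite by simp
    ultimately have inf: "emeasure lborel (- ?B) = \<infinity>" by (auto simp: top_unique)
    have "(\<integral>\<^sup>+x. ennreal (\<bar>b\<bar> powr p) * indicator (- ?B) x \<partial>lborel) \<le> (\<integral>\<^sup>+x. ennreal (\<bar>?h x - b\<bar> powr p) \<partial>lborel)"
    proof (rule nn_integral_mono)
      fix x :: 'a
      show "ennreal (\<bar>b\<bar> powr p) * indicator (- ?B) x \<le> ennreal (\<bar>?h x - b\<bar> powr p)"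
        using cutoff_eq_0[of x] by (cases "x \<in> ?B") (simp_all add: localized_def)
    qed
    moreover have "(\<integral>\<^sup>+x. ennreal (\<bar>b\<bar> powr p) * indicator (- ?B) x \<partial>lborel) = \<infinity>"
      using b inf by (subst nn_integral_cmult_indicator) (auto simp: ennreal_mult_top)
    ultimately show False using fin by simp
  qed
  define T where "T = (\<integral>\<^sup>+x. ennreal (\<bar>?h x\<bar> powr p) \<partial>(lborel :: 'a measure))"
  have "T < \<infinity>" using fin \<open>b = 0\<close> by (simp add: T_def)
  then obtain r where r: "T = ennreal r" "0 \<le> r" by (cases T) auto
  have "(\<Sum>j<K. c j powr p) \<le> r" for K
    using nn_integral_localized_powr_ge[where c = c and K = K, OF i c] r unfolding T_def[symmetric] by (simp add: ennreal_le_iff)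
  then have "(\<Sum>j\<le>K. c j powr p) \<le> r" for K by (simp only: lessThan_Suc_atMost[symmetric])
  then have "summable (\<lambda>j. c j powr p)" by (intro bounded_imp_summable) auto
  with div show False by simp
qed

theorem CJN_not_L_space_mod_const:
  "\<exists>g :: 'a::euclidean_space \<Rightarrow> real. g \<in> CJN_space p \<and> g \<notin> L_space_mod_const p"
proof -
  obtain i :: 'a where i: "i \<in> Basis" using nonempty_Basis by blast
  define c where "c j = inverse (real (Suc j)) powr (1 / p)" for j
  have c: "0 \<le> c j \<and> c j \<le> 1" for j
    using powr_mono2[of "1 / p" "inverse (real (Suc j))" 1] p by (simp add: c_def field_simps)
  have "decseq c" unfolding c_def decseq_def using p by (auto intro!: powr_mono2 simp: field_simps)
  moreover have "c \<longlonglongrightarrow> 0"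
  proof -
    have "(\<lambda>j. inverse (real (Suc j)) powr (1 / p)) \<longlonglongrightarrow> 0 powr (1 / p)"
      using p LIMSEQ_inverse_real_of_nat by (intro tendsto_powr2) auto
    then show ?thesis using p by (simp add: c_def[abs_def])
  qed
  moreover have cp: "c j powr p = inverse (real (Suc j))" for j using p by (simp add: c_def powr_powr)
  have "\<not> summable (\<lambda>j. c j powr p)"
    unfolding cp using not_summable_harmonic[where 'a = real] summable_Suc_iff[of "\<lambda>n. inverse (real n)"] by simp
  then have "localized i (cascade_sum A B c) \<notin> L_space_mod_const p"
    by (rule localized_not_in_L_space_mod_const[where c = c, OF i c])
  moreover have "represents A B c (cascade_sum A B c)" using c by (intro represents_cascade_sum AB_pos) auto
  ultimately have "localized i (cascade_sum A B c) \<in> CJN_space p"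
    using c by (intro localized_in_CJN[OF i]) auto
  with \<open>localized i (cascade_sum A B c) \<notin> L_space_mod_const p\<close> show ?thesis by blast
qed

end

section \<open>Oscillation persisting at small scales\<close>

text \<open>
  The grid cubes are indexed by all points with integer coordinates, not only by those whose cubes lie
  in the unit cube: the \<open>JN\<close> condition is about infinite sequences of disjoint cubes.
\<close>

definition lattice :: "'a::euclidean_space set" where
  "lattice = {z. \<forall>b\<in>Basis. z \<bullet> b \<in> \<int>}"

definition grid_cube :: "nat \<Rightarrow> 'a::euclidean_space \<Rightarrow> 'a set" where
  "grid_cube m z = box ((1 / 4 ^ m) *\<^sub>R z) ((1 / 4 ^ m) *\<^sub>R z + (1 / 4 ^ m) *\<^sub>R One)"

lemma countable_lattice: "countable (lattice :: 'a::euclidean_space set)"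
proof -
  have "(lattice :: 'a set) \<subseteq> (\<lambda>g. \<Sum>b\<in>Basis. of_int (g b) *\<^sub>R b) ` (PiE Basis (\<lambda>_. UNIV :: int set))"
  proof
    fix z :: 'a assume z: "z \<in> lattice"
    show "z \<in> (\<lambda>g. \<Sum>b\<in>Basis. of_int (g b) *\<^sub>R b) ` (PiE Basis (\<lambda>_. UNIV :: int set))"
    proof (rule image_eqI[where x = "restrict (\<lambda>b. \<lfloor>z \<bullet> b\<rfloor>) Basis"])
      have "(\<Sum>b\<in>Basis. of_int (restrict (\<lambda>b. \<lfloor>z \<bullet> b\<rfloor>) Basis b) *\<^sub>R b) = (\<Sum>b\<in>Basis. (z \<bullet> b) *\<^sub>R b)"
        using z by (intro sum.cong refl) (auto simp: lattice_def)
      then show "z = (\<Sum>b\<in>Basis. of_int (restrict (\<lambda>b. \<lfloor>z \<bullet> b\<rfloor>) Basis b) *\<^sub>R b)"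
        by (simp only: euclidean_representation)
    qed simp
  qed
  then show ?thesis
    by (rule countable_subset) (intro countable_image countable_PiE, auto)
qed

lemma infinite_lattice: "infinite (lattice :: 'a::euclidean_space set)"
proof -
  obtain i :: 'a where i: "i \<in> Basis" using nonempty_Basis by blast
  have "range (\<lambda>k::nat. of_nat k *\<^sub>R i) \<subseteq> lattice"
    using i by (auto simp: lattice_def inner_Basis)
  moreover have "inj (\<lambda>k::nat. of_nat k *\<^sub>R i :: 'a)"
    using i by (auto intro!: injI dest: nonzero_Basis)
  ultimately show ?thesis using finite_subset range_inj_infinite by blast
qed

lemma grid_cube_is_cube: "is_cube (grid_cube m z)"
  unfolding is_cube_def grid_cube_def by (rule exI, rule exI[of _ "1 / 4 ^ m"]) simp

lemma mem_grid_cube: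
  "x \<in> grid_cube m z \<longleftrightarrow> (\<forall>b\<in>Basis. z \<bullet> b < 4 ^ m * (x \<bullet> b) \<and> 4 ^ m * (x \<bullet> b) < z \<bullet> b + 1)"
  unfolding grid_cube_def mem_box
  by (intro ball_cong refl) (auto simp: inner_add_left field_simps)

lemma grid_cube_disjoint:
  assumes "z \<in> lattice" "z' \<in> lattice" "z \<noteq> z'"
  shows "grid_cube m z \<inter> grid_cube m z' = {}"
proof -
  obtain b where b: "b \<in> Basis" "z \<bullet> b \<noteq> z' \<bullet> b" using assms(3) euclidean_eqI by blast
  have "z \<bullet> b \<in> \<int>" "z' \<bullet> b \<in> \<int>" using assms b(1) by (auto simp: lattice_def)
  then obtain k k' where k: "z \<bullet> b = of_int k" "z' \<bullet> b = of_int k'" by (elim Ints_cases)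
  have "False" if x: "x \<in> grid_cube m z" "x \<in> grid_cube m z'" for x
  proof -
    have "of_int k < 4 ^ m * (x \<bullet> b)" "4 ^ m * (x \<bullet> b) < of_int k + 1"
      "of_int k' < 4 ^ m * (x \<bullet> b)" "4 ^ m * (x \<bullet> b) < of_int k' + 1"
      using x b(1) k by (auto simp: mem_grid_cube)
    then have "(of_int k :: real) < of_int (k' + 1)" "(of_int k' :: real) < of_int (k + 1)" by simp_all
    then have "k = k'" by (simp only: of_int_less_iff)
    with b(2) k show False by simp
  qed
  then show ?thesis by blast
qed

context cascade_factors
begin

text \<open>
  The last denominator is the quotient of the volumes of a grid cube and of one with a quarter of its
  side.
\<close>

definition contrast :: "nat \<Rightarrow> real" where
  "contrast n = (A - B) / (1 - ratio) / 4 ^ n"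

lemma contrast_pos: "0 < contrast n"
  using A B ratio_bounds by (auto simp: contrast_def)

lemma nn_integral_tail_cell_cube:
  fixes q :: "'a::euclidean_space"
  assumes i: "i \<in> Basis" and q: "q \<bullet> i = of_int M / 4 ^ k"
  shows "(\<integral>\<^sup>+x. (\<Sum>j. ennreal (cascade A B (j + k) (x \<bullet> i))) * indicator (box q (q + (1 / 4 ^ k) *\<^sub>R One)) x \<partial>lborel)
    = ennreal (weight A B k M * (1 / 4 ^ k) ^ DIM('a) / (1 - ratio))"
proof -
  let ?Q = "box q (q + (1 / 4 ^ k) *\<^sub>R One)"
  have "(\<integral>\<^sup>+x. (\<Sum>j. ennreal (cascade A B (j + k) (x \<bullet> i))) * indicator ?Q x \<partial>lborel)
      = (\<integral>\<^sup>+x. (\<Sum>j. ennreal (cascade A B (k + j) (x \<bullet> i)) * indicator ?Q x) \<partial>lborel)"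
    by (simp add: ennreal_suminf_multc add.commute)
  also have "\<dots> = (\<Sum>j. \<integral>\<^sup>+x. ennreal (cascade A B (k + j) (x \<bullet> i)) * indicator ?Q x \<partial>lborel)"
    by (rule nn_integral_suminf) measurable
  also have "\<dots> = (\<Sum>j. ennreal (weight A B k M * (1 / 4 ^ k) ^ DIM('a) * ratio ^ j))"
    by (simp only: nn_integral_cascade_cell_cube[OF AB_pos i q] ratio_def[symmetric] mult_ac)
  also have "\<dots> = ennreal (weight A B k M * (1 / 4 ^ k) ^ DIM('a) * (1 / (1 - ratio)))"
    using weight_pos[OF AB_pos, of k M] ratio_bounds
    by (intro suminf_ennreal_eq sums_mult geometric_sums) auto
  finally show ?thesis by simp
qed

text \<open>
  Compare two subcubes \<open>R 0\<close> and \<open>R 1\<close> of a quarter of the side, one in the outer quarter with factor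
  \<open>A\<close> and one in the inner quarter with factor \<open>B\<close>.  The partial sum up to level \<open>m\<close> is the same constant
  \<open>P\<close> on both.  The integrals of the remaining terms are \<open>A w V / (1 - r)\<close> and \<open>B w V / (1 - r)\<close>, and
  their difference is a lower bound for the integral of \<open>|g - \<alpha>|\<close>, whatever the constant \<open>\<alpha>\<close>.
\<close>

lemma osc_grid_cube_ge:
  fixes i z :: "'a::euclidean_space"
  assumes i: "i \<in> Basis" and z: "z \<in> lattice" "z \<bullet> i = of_int k" and sub: "grid_cube m z \<subseteq> box 0 One"
    and L1: "localized i (cascade_sum A B (\<lambda>_. 1)) \<in> L1_loc"
  shows "contrast DIM('a) * weight A B m k \<le> osc (grid_cube m z) (localized i (cascade_sum A B (\<lambda>_. 1)))"
proof -
  let ?g = "localized i (cascade_sum A B (\<lambda>_. 1))" and ?Q = "grid_cube m z"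
  define w where "w = weight A B m k"
  have w: "0 < w" unfolding w_def by (rule weight_pos[OF AB_pos])
  define al where "al = avg ?Q ?g"
  define P where "P = cell_partial_sum A B (\<lambda>_. 1) m k"
  \<comment> \<open>the remaining terms are nonnegative, so moving a negative constant to \<open>0\<close> only reduces distances\<close>
  define be where "be = max 0 (al - P)"
  define q where "q e = (1 / 4 ^ m) *\<^sub>R z + (e / 4 ^ Suc m) *\<^sub>R i" for e :: real
  define R where "R e = box (q e) (q e + (1 / 4 ^ Suc m) *\<^sub>R One)" for e :: real
  define V where "V = (1 / 4 ^ Suc m :: real) ^ DIM('a)"
  define T where "T x = (\<Sum>j. ennreal (cascade A B (j + Suc m) (x \<bullet> i)))" for x :: 'a
  have [measurable]: "T \<in> borel_measurable borel" unfolding T_def[abs_def] by measurable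
  have [measurable]: "R e \<in> sets borel" for e unfolding R_def by simp
  have [measurable]: "?Q \<in> sets borel" unfolding grid_cube_def by simp
  have [measurable]: "?g \<in> borel_measurable borel"
    unfolding localized_def[abs_def] cascade_sum_def[abs_def] by measurable
  have Q: "is_cube ?Q" by (rule grid_cube_is_cube)
  have qi: "q e \<bullet> i = (4 * of_int k + e) / 4 ^ Suc m" for e
    using i z by (simp add: q_def inner_add_left field_simps)
  have IR: "(\<integral>\<^sup>+x. T x * indicator (R e) x \<partial>lborel) = ennreal (weight A B (Suc m) (4 * k + d) * V / (1 - ratio))"
    if "e = of_int d" for e d
    unfolding T_def R_def V_def
    by (rule nn_integral_tail_cell_cube[OF i]) (use that qi in simp)
  have w0: "weight A B (Suc m) (4 * k + 0) = A * w" and w1: "weight A B (Suc m) (4 * k + 1) = B * w"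
    by (simp_all add: digit_def w_def)
  have I0: "(\<integral>\<^sup>+x. T x * indicator (R 0) x \<partial>lborel) = ennreal (A * w * V / (1 - ratio))"
    using IR[of 0 0] unfolding w0 by simp
  have I1: "(\<integral>\<^sup>+x. T x * indicator (R 1) x \<partial>lborel) = ennreal (B * w * V / (1 - ratio))"
    using IR[of 1 1] unfolding w1 by simp
  have V0: "0 < V" by (simp add: V_def)
  have EV: "emeasure lborel (R e) = ennreal V" for e unfolding R_def V_def by (rule emeasure_cube) simp
  have sub': "R e \<subseteq> ?Q" if e: "e = 0 \<or> e = 1" for e
  proof
    fix x assume x: "x \<in> R e"
    show "x \<in> ?Q" unfolding mem_grid_cube
    proof
      fix b :: 'a assume b: "b \<in> Basis"
      have "q e \<bullet> b < x \<bullet> b" "x \<bullet> b < q e \<bullet> b + 1 / 4 ^ Suc m"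
        using x b by (auto simp: R_def mem_box inner_add_left)
      moreover have "i \<bullet> b = 0 \<or> i \<bullet> b = 1" using i b by (auto simp: inner_Basis)
      ultimately show "z \<bullet> b < 4 ^ m * (x \<bullet> b) \<and> 4 ^ m * (x \<bullet> b) < z \<bullet> b + 1"
        using e by (auto simp: q_def inner_add_left field_simps)
    qed
  qed
  have disj: "R 0 \<inter> R 1 = {}"
  proof -
    have "q 0 \<bullet> i + 1 / 4 ^ Suc m = q 1 \<bullet> i" unfolding qi by (simp add: add_divide_distrib)
    moreover have "x \<bullet> i < q 0 \<bullet> i + 1 / 4 ^ Suc m" if "x \<in> R 0" for x
      using that i unfolding R_def mem_box by (simp add: inner_add_left)
    moreover have "q 1 \<bullet> i < x \<bullet> i" if "x \<in> R 1" for x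
      using that i unfolding R_def mem_box by simp
    ultimately show ?thesis by fastforce
  qed
  have ae: "AE x in lborel. x \<in> ?Q \<longrightarrow> (\<exists>t\<ge>0. T x = ennreal t \<and> ?g x = P + t)"
    using series_AE_finite[OF i, of "\<lambda>_. 1" 1, simplified]
  proof eventually_elim
    fix x :: 'a assume fin: "x \<in> box 0 One \<longrightarrow> (\<Sum>j. ennreal (cascade A B j (x \<bullet> i))) \<noteq> top"
    show "x \<in> ?Q \<longrightarrow> (\<exists>t\<ge>0. T x = ennreal t \<and> ?g x = P + t)"
    proof
      assume x: "x \<in> ?Q"
      then have "x \<in> box 0 One" using sub by blast
      then have c1: "cutoff x = 1" using box_subset_cbox by (intro cutoff_eq_1) blast
      have "\<lfloor>4 ^ m * (x \<bullet> i)\<rfloor> = k" using x i z by (auto simp: mem_grid_cube floor_eq_iff)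
      then have "P = (\<Sum>j\<le>m. 1 * cascade A B j (x \<bullet> i))" unfolding P_def sum_cascade_eq_cell_partial_sum by simp
      then have PP: "P = (\<Sum>j<Suc m. cascade A B j (x \<bullet> i))" by (simp add: lessThan_Suc_atMost)
      have P0: "0 \<le> P" unfolding PP using cascade_pos[OF AB_pos] by (intro sum_nonneg) (simp add: less_imp_le)
      have "(\<Sum>j. ennreal (cascade A B j (x \<bullet> i))) = (\<Sum>j<Suc m. ennreal (cascade A B j (x \<bullet> i))) + T x"
        unfolding T_def by (rule suminf_split_ennreal)
      also have "(\<Sum>j<Suc m. ennreal (cascade A B j (x \<bullet> i))) = ennreal P"
        unfolding PP using cascade_pos[OF AB_pos] by (intro sum_ennreal) (simp add: less_imp_le)
      finally have split: "(\<Sum>j. ennreal (cascade A B j (x \<bullet> i))) = ennreal P + T x" .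
      with fin \<open>x \<in> box 0 One\<close> have "T x \<noteq> top" by auto
      then obtain t where t: "T x = ennreal t" "0 \<le> t" by (cases "T x") auto
      have "?g x = enn2real (ennreal P + ennreal t)"
        unfolding localized_def cascade_sum_def c1 t(1)[symmetric] split[symmetric] by simp
      also have "\<dots> = P + t" using P0 t(2) by (simp add: ennreal_plus[symmetric] del: ennreal_plus)
      finally show "\<exists>t\<ge>0. T x = ennreal t \<and> ?g x = P + t" using t by blast
    qed
  qed
  have be0: "0 \<le> be" by (simp add: be_def)
  let ?D = "\<lambda>x. ennreal \<bar>?g x - al\<bar>"
  have up0: "(\<integral>\<^sup>+x. T x * indicator (R 0) x \<partial>lborel)
      \<le> (\<integral>\<^sup>+x. ?D x * indicator (R 0) x + ennreal be * indicator (R 0) x \<partial>lborel)"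
  proof (rule nn_integral_mono_AE)
    show "AE x in lborel. T x * indicator (R 0) x \<le> ?D x * indicator (R 0) x + ennreal be * indicator (R 0) x"
      using ae
    proof eventually_elim
      fix x assume h: "x \<in> ?Q \<longrightarrow> (\<exists>t\<ge>0. T x = ennreal t \<and> ?g x = P + t)"
      show "T x * indicator (R 0) x \<le> ?D x * indicator (R 0) x + ennreal be * indicator (R 0) x"
      proof (cases "x \<in> R 0")
        case True
        then obtain t where t: "t \<ge> 0" "T x = ennreal t" "?g x = P + t" using h sub' by blast
        have "t \<le> \<bar>?g x - al\<bar> + be" unfolding t(3) be_def by linarith
        then have "ennreal t \<le> ennreal (\<bar>?g x - al\<bar> + be)" by (rule ennreal_leI)
        then show ?thesis using True be0 t(2) by simp
      qed simp
    qed
  qed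
  have up1: "(\<integral>\<^sup>+x. ennreal be * indicator (R 1) x \<partial>lborel)
      \<le> (\<integral>\<^sup>+x. ?D x * indicator (R 1) x + T x * indicator (R 1) x \<partial>lborel)"
  proof (rule nn_integral_mono_AE)
    show "AE x in lborel. ennreal be * indicator (R 1) x \<le> ?D x * indicator (R 1) x + T x * indicator (R 1) x"
      using ae
    proof eventually_elim
      fix x assume h: "x \<in> ?Q \<longrightarrow> (\<exists>t\<ge>0. T x = ennreal t \<and> ?g x = P + t)"
      show "ennreal be * indicator (R 1) x \<le> ?D x * indicator (R 1) x + T x * indicator (R 1) x"
      proof (cases "x \<in> R 1")
        case True
        then obtain t where t: "t \<ge> 0" "T x = ennreal t" "?g x = P + t" using h sub' by blast
        have "be \<le> \<bar>?g x - al\<bar> + t" unfolding t(3) be_def using t(1) by linarith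
        then have "ennreal be \<le> ennreal (\<bar>?g x - al\<bar> + t)" by (rule ennreal_leI)
        then show ?thesis using True t by simp
      qed simp
    qed
  qed
  have beV: "(\<integral>\<^sup>+x. ennreal be * indicator (R e) x \<partial>lborel) = ennreal (be * V)" for e
    using be0 V0 by (subst nn_integral_cmult_indicator) (auto simp: EV ennreal_mult)
  have iQ: "set_integrable lebesgue ?Q (\<lambda>x. ?g x - al)"
    using L1_loc_cube[OF L1 Q] set_integrable_cube_const[OF Q] by (rule set_integral_diff)
  define Y where "Y = measure lebesgue ?Q * osc ?Q ?g"
  have Y: "ennreal Y = (\<integral>\<^sup>+x. ?D x * indicator ?Q x \<partial>lborel)"
    unfolding Y_def osc_def al_def[symmetric] by (rule measure_mult_avg_abs[OF Q iQ])
  have Y0: "0 \<le> Y" unfolding Y_def using osc_nonneg[OF Q] by simp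
  have "ennreal (A * w * V / (1 - ratio)) \<le> (\<integral>\<^sup>+x. ?D x * indicator (R 0) x \<partial>lborel) + ennreal (be * V)"
    using up0 unfolding I0 by (subst (asm) nn_integral_add) (measurable, simp only: beV)
  also have "\<dots> \<le> (\<integral>\<^sup>+x. ?D x * indicator (R 0) x \<partial>lborel)
      + ((\<integral>\<^sup>+x. ?D x * indicator (R 1) x \<partial>lborel) + ennreal (B * w * V / (1 - ratio)))"
    using up1 unfolding beV by (intro add_left_mono) (subst (asm) nn_integral_add, measurable, simp only: I1)
  also have "\<dots> = (\<integral>\<^sup>+x. ?D x * indicator (R 0) x + ?D x * indicator (R 1) x \<partial>lborel) + ennreal (B * w * V / (1 - ratio))"
    by (subst nn_integral_add) (simp_all add: add.assoc)
  also have "\<dots> \<le> ennreal Y + ennreal (B * w * V / (1 - ratio))"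
    unfolding Y using disj sub'[of 0] sub'[of 1]
    by (intro add_right_mono nn_integral_mono) (auto simp: indicator_def)
  also have "\<dots> = ennreal (Y + B * w * V / (1 - ratio))"
    using Y0 w V0 B ratio_bounds by (intro ennreal_plus[symmetric]) auto
  finally have "A * w * V / (1 - ratio) \<le> Y + B * w * V / (1 - ratio)"
    using Y0 w V0 B ratio_bounds by (subst (asm) ennreal_le_iff) auto
  then have main: "(A - B) / (1 - ratio) * w * V \<le> Y"
    by (simp add: left_diff_distrib diff_divide_distrib)
  define U where "U = measure lebesgue ?Q"
  have U: "U = (1 / 4 ^ m) ^ DIM('a)" unfolding U_def grid_cube_def by (rule measure_cube) simp
  have "V = U / 4 ^ DIM('a)" unfolding U V_def by (simp add: power_divide power_mult_distrib)
  then have "U * (contrast DIM('a) * w) \<le> U * osc ?Q ?g"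
    using main unfolding Y_def U_def[symmetric] contrast_def by (simp add: mult_ac)
  moreover have "0 < U" unfolding U by simp
  ultimately show ?thesis unfolding w_def by (simp only: mult_le_cancel_left_pos)
qed

text \<open>
  The integral of \<open>W\<^sub>m\<^sup>p\<close> over the unit cube is \<open>1\<close>, and the closed grid cubes cover the unit cube.
\<close>

lemma grid_sum_weights_ge:
  fixes i :: "'a::euclidean_space" and Z :: "nat \<Rightarrow> 'a"
  assumes i: "i \<in> Basis" and Z: "bij_betw Z UNIV lattice"
  shows "1 \<le> (\<Sum>n. ennreal (if grid_cube m (Z n) \<subseteq> box 0 One
      then measure lebesgue (grid_cube m (Z n)) * weight A B m \<lfloor>Z n \<bullet> i\<rfloor> powr p else 0))"
proof -
  define good where "good n = (grid_cube m (Z n) \<subseteq> box 0 One)" for n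
  define W where "W n = weight A B m \<lfloor>Z n \<bullet> i\<rfloor> powr p" for n
  define C where "C n = cbox ((1 / 4 ^ m) *\<^sub>R Z n) ((1 / 4 ^ m) *\<^sub>R Z n + (1 / 4 ^ m) *\<^sub>R One)" for n
  have [measurable]: "C n \<in> sets borel" for n by (simp add: C_def)
  have mem_C: "x \<in> C n \<longleftrightarrow> (\<forall>b\<in>Basis. Z n \<bullet> b \<le> 4 ^ m * (x \<bullet> b) \<and> 4 ^ m * (x \<bullet> b) \<le> Z n \<bullet> b + 1)" for x n
    unfolding C_def mem_box by (intro ball_cong refl) (auto simp: inner_add_left field_simps)
  let ?B = "box 0 (0 + (1 / 4 ^ 0) *\<^sub>R One) :: 'a set"
  have "1 = (\<integral>\<^sup>+x. ennreal (cascade A B m (x \<bullet> i) powr p) * indicator ?B x \<partial>lborel)"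
    using nn_integral_cascade_cell_cube[OF powr_pos i, of 0 0 0 m] by (simp add: cascade_powr[OF AB_pos] mean_powr)
  also have "\<dots> \<le> (\<integral>\<^sup>+x. (\<Sum>n. ennreal (if good n then W n else 0) * indicator (C n) x) \<partial>lborel)"
  proof (rule nn_integral_mono)
    fix x :: 'a
    show "ennreal (cascade A B m (x \<bullet> i) powr p) * indicator ?B x \<le> (\<Sum>n. ennreal (if good n then W n else 0) * indicator (C n) x)"
    proof (cases "x \<in> ?B")
      case True
      define z where "z = (\<Sum>b\<in>Basis. of_int \<lfloor>4 ^ m * (x \<bullet> b)\<rfloor> *\<^sub>R b)"
      have zb: "z \<bullet> b = of_int \<lfloor>4 ^ m * (x \<bullet> b)\<rfloor>" if "b \<in> Basis" for b
        using that by (simp add: z_def)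
      then have "z \<in> lattice" by (simp add: lattice_def)
      then obtain n where n: "Z n = z" using Z by (metis bij_betw_imp_surj_on rangeE)
      have "x \<in> C n" unfolding mem_C n using zb by (auto simp: less_imp_le real_of_int_floor_add_one_gt)
      have "grid_cube m z \<subseteq> box 0 One"
      proof
        fix y assume y: "y \<in> grid_cube m z"
        show "y \<in> box 0 One" unfolding mem_box
        proof
          fix b :: 'a assume b: "b \<in> Basis"
          have "0 < x \<bullet> b" "x \<bullet> b < 1" using True b by (auto simp: mem_box)
          then have "0 \<le> \<lfloor>4 ^ m * (x \<bullet> b)\<rfloor>" "\<lfloor>4 ^ m * (x \<bullet> b)\<rfloor> < 4 ^ m" by (auto simp: floor_less_iff)
          then have "0 \<le> z \<bullet> b" "z \<bullet> b + 1 \<le> 4 ^ m" using zb[OF b]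
            by (simp, metis add1_zle_eq of_int_1 of_int_add of_int_le_iff of_int_numeral of_int_power)
          moreover have "z \<bullet> b < 4 ^ m * (y \<bullet> b)" "4 ^ m * (y \<bullet> b) < z \<bullet> b + 1"
            using y b by (auto simp: mem_grid_cube)
          ultimately have "0 < 4 ^ m * (y \<bullet> b)" "4 ^ m * (y \<bullet> b) < 4 ^ m * 1" by linarith+
          then show "0 \<bullet> b < y \<bullet> b \<and> y \<bullet> b < One \<bullet> b"
            using b by (auto simp: zero_less_mult_iff)
        qed
      qed
      then have "good n" by (simp add: good_def n)
      have "ennreal (cascade A B m (x \<bullet> i) powr p) = ennreal (if good n then W n else 0) * indicator (C n) x"
        using \<open>good n\<close> \<open>x \<in> C n\<close> zb[OF i] by (simp add: W_def n cascade_def)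
      also have "F n \<le> (\<Sum>n. F n)" for F :: "nat \<Rightarrow> ennreal"
        using sum_le_suminf[of F "{n}"] by (simp add: summableI)
      finally show ?thesis using True by simp
    qed simp
  qed
  also have "\<dots> = (\<Sum>n. \<integral>\<^sup>+x. ennreal (if good n then W n else 0) * indicator (C n) x \<partial>lborel)"
    by (rule nn_integral_suminf) measurable
  also have "\<dots> = (\<Sum>n. ennreal (if good n then measure lebesgue (grid_cube m (Z n)) * W n else 0))"
  proof (rule suminf_cong)
    fix n
    have "emeasure lborel (C n) = ennreal ((1 / 4 ^ m) ^ DIM('a))"
      unfolding C_def by (subst emeasure_lborel_cbox_eq) (simp add: inner_add_left)
    moreover have "measure lebesgue (grid_cube m (Z n)) = (1 / 4 ^ m) ^ DIM('a)"
      unfolding grid_cube_def by (rule measure_cube) simp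
    ultimately show "(\<integral>\<^sup>+x. ennreal (if good n then W n else 0) * indicator (C n) x \<partial>lborel)
        = ennreal (if good n then measure lebesgue (grid_cube m (Z n)) * W n else 0)"
      by (subst nn_integral_cmult_indicator) (auto simp: ennreal_mult mult.commute W_def)
  qed
  finally show ?thesis unfolding good_def W_def .
qed

lemma grid_sum_volume_le:
  fixes Z :: "nat \<Rightarrow> 'a::euclidean_space"
  assumes Z: "bij_betw Z UNIV lattice"
  shows "(\<Sum>n. ennreal (if grid_cube m (Z n) \<subseteq> box 0 One then measure lebesgue (grid_cube m (Z n)) else 0)) \<le> 1"
proof -
  define G where "G n = (if grid_cube m (Z n) \<subseteq> box 0 One then grid_cube m (Z n) else {})" for n
  have bor: "range G \<subseteq> sets lborel" by (auto simp: G_def grid_cube_def)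
  have disj: "disjoint_family G"
  proof (unfold disjoint_family_on_def, intro ballI impI)
    fix n n' :: nat assume "n \<noteq> n'"
    then have "Z n \<noteq> Z n'" "Z n \<in> lattice" "Z n' \<in> lattice"
      using Z by (auto simp: bij_betw_def inj_def)
    then show "G n \<inter> G n' = {}" using grid_cube_disjoint[of "Z n" "Z n'" m] by (auto simp: G_def)
  qed
  have "ennreal (if grid_cube m (Z n) \<subseteq> box 0 One then measure lebesgue (grid_cube m (Z n)) else 0) = emeasure lborel (G n)" for n
    using measure_cube[of "1 / 4 ^ m" "(1 / 4 ^ m) *\<^sub>R Z n"] emeasure_cube[of "1 / 4 ^ m" "(1 / 4 ^ m) *\<^sub>R Z n"]
    by (simp add: G_def grid_cube_def)
  then have "(\<Sum>n. ennreal (if grid_cube m (Z n) \<subseteq> box 0 One then measure lebesgue (grid_cube m (Z n)) else 0)) = emeasure lborel (\<Union>n. G n)"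
    using suminf_emeasure[OF bor disj] by simp
  also have "\<dots> \<le> emeasure lborel (box 0 One :: 'a set)"
    by (rule emeasure_mono) (auto simp: G_def split: if_splits)
  also have "\<dots> = 1" using emeasure_cube[of 1 "0 :: 'a"] by simp
  finally show ?thesis .
qed

text \<open>
  If \<open>u\<close> is within \<open>e\<close> of the function in \<open>JN\<close> norm, then on the grid cubes in the unit cube the
  oscillation of the function is at most that of the difference plus that of \<open>u\<close>.  The \<open>p\<close>-th powers
  of the former sum to at most \<open>e\<^sup>p\<close>, and the latter is below \<open>e\<close> once the grid is fine, because \<open>u\<close> is
  Lipschitz on the unit cube.  The sum for the function itself does not tend to \<open>0\<close>.
\<close>

theorem localized_cascade_in_JN_not_VJN:
  fixes i :: "'a::euclidean_space"
  assumes i: "i \<in> Basis"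
  shows "localized i (cascade_sum A B (\<lambda>_. 1)) \<in> JN_space p - VJN_space p"
proof -
  let ?g = "localized i (cascade_sum A B (\<lambda>_. 1))"
  let ?n = "DIM('a)"
  obtain C where C: "0 \<le> C" "\<And>a c f. (\<And>j. 0 \<le> c j \<and> c j \<le> a) \<Longrightarrow> represents A B c f \<Longrightarrow>
       localized i f \<in> L1_loc \<and> JN_bound p (localized i f) (a * C)" using JN_uniform[OF i] by blast
  have "represents A B (\<lambda>_. 1) (cascade_sum A B (\<lambda>_. 1))" by (intro represents_cascade_sum AB_pos) simp
  then have g: "?g \<in> L1_loc" "?g \<in> JN_space p"
    using C(2)[of "\<lambda>_. 1" 1 "cascade_sum A B (\<lambda>_. 1)"] by (auto simp: JN_space_def)
  have "?g \<notin> VJN_space p"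
  proof
    assume "?g \<in> VJN_space p"
    define d where "d = contrast ?n"
    have d: "0 < d" unfolding d_def by (rule contrast_pos)
    \<comment> \<open>so that \<open>2 powr p * (e powr p + e powr p)\<close> is half of \<open>d powr p\<close>\<close>
    define e where "e = d / (2 * 4 powr (1 / p))"
    have e: "0 < e" using d by (simp add: e_def)
    have ep: "2 powr p * (e powr p + e powr p) < d powr p"
    proof -
      have "e powr p = d powr p / (2 powr p * 4)"
        unfolding e_def using d p by (simp add: powr_divide powr_mult powr_powr)
      then show ?thesis using d by simp
    qed
    obtain u where u: "u \<in> D_space p" "u \<in> JN_space p" and ue: "JN_norm p (\<lambda>x. ?g x - u x) < e"
      using \<open>?g \<in> VJN_space p\<close> e by (auto simp: VJN_space_def JN_closure_def)
    have "(\<lambda>x. ?g x - u x) \<in> JN_space p" by (rule JN_space_diff[OF p g(2) u(2)])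
    then obtain K where K: "JN_bound p (\<lambda>x. ?g x - u x) K" "K < e" using ue by (rule JN_norm_lessD)
    have K0: "0 \<le> K" using K by (simp add: JN_bound_def)
    have uL: "u \<in> L1_loc" using u by (simp add: JN_space_def)
    have "u \<in> C_k (Suc 0)" using u(1) by (auto simp: D_space_def C_inf_def simp del: C_k.simps)
    then obtain L where L: "0 \<le> L" "\<And>x y. x \<in> cbox 0 One \<Longrightarrow> y \<in> cbox 0 One \<Longrightarrow> \<bar>u x - u y\<bar> \<le> L * norm (x - y)"
      using C_k_Lipschitz_on_compact_convex[OF _ compact_cbox convex_box(1)] by metis
    have "(\<lambda>m. 2 * (L * ?n) * (1 / 4) ^ m) \<longlonglongrightarrow> 2 * (L * ?n) * 0"
      by (intro tendsto_intros LIMSEQ_power_zero) simp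
    then have "eventually (\<lambda>m. 2 * (L * ?n) * (1 / 4) ^ m < e) sequentially" using e by (intro order_tendstoD) auto
    then obtain m where m: "2 * (L * ?n) * (1 / 4) ^ m < e" by (auto simp: eventually_sequentially)
    obtain Z :: "nat \<Rightarrow> 'a" where Z: "bij_betw Z UNIV lattice"
      using bij_betw_from_nat_into[OF countable_lattice infinite_lattice] by blast
    define Q where "Q n = grid_cube m (Z n)" for n
    define good where "good n = (Q n \<subseteq> box 0 One)" for n
    define V where "V n = measure lebesgue (Q n)" for n
    have Zl: "Z n \<in> lattice" for n using Z by (auto simp: bij_betw_def)
    have cube: "is_cube (Q n)" for n by (simp add: Q_def grid_cube_is_cube)
    have V0: "0 < V n" for n unfolding V_def by (rule measure_cube_pos[OF cube])
    have disj: "disjoint_family Q"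
    proof (unfold disjoint_family_on_def, intro ballI impI)
      fix n n' :: nat assume "n \<noteq> n'"
      then have "Z n \<noteq> Z n'" using Z by (auto simp: bij_betw_def inj_def)
      then show "Q n \<inter> Q n' = {}" using grid_cube_disjoint[OF Zl Zl] by (simp add: Q_def)
    qed
    have osc_u: "osc (Q n) u \<le> e" if "good n" for n
    proof -
      define x0 where "x0 = (1 / 4 ^ m) *\<^sub>R Z n + (1 / 2 / 4 ^ m) *\<^sub>R One"
      have x0: "x0 \<in> Q n" unfolding Q_def mem_grid_cube
        by (auto simp: x0_def inner_add_left field_simps)
      have bd: "\<bar>u x - u x0\<bar> \<le> L * (?n * (1 / 4) ^ m)" if x: "x \<in> Q n" for x
      proof -
        have "x \<in> cbox 0 One" "x0 \<in> cbox 0 One" using x x0 \<open>good n\<close> box_subset_cbox unfolding good_def by blast+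
        then have "\<bar>u x - u x0\<bar> \<le> L * norm (x - x0)" by (rule L(2))
        also have "norm (x - x0) \<le> (\<Sum>b\<in>Basis. \<bar>(x - x0) \<bullet> b\<bar>)" by (rule norm_le_l1)
        also have "\<dots> \<le> (\<Sum>b\<in>(Basis::'a set). (1 / 4) ^ m)"
        proof (rule sum_mono)
          fix b :: 'a assume b: "b \<in> Basis"
          have "Z n \<bullet> b < 4 ^ m * (x \<bullet> b)" "4 ^ m * (x \<bullet> b) < Z n \<bullet> b + 1"
            "Z n \<bullet> b < 4 ^ m * (x0 \<bullet> b)" "4 ^ m * (x0 \<bullet> b) < Z n \<bullet> b + 1"
            using x x0 b by (auto simp: Q_def mem_grid_cube)
          then have "4 ^ m * (x \<bullet> b) - 4 ^ m * (x0 \<bullet> b) \<le> 1" "4 ^ m * (x0 \<bullet> b) - 4 ^ m * (x \<bullet> b) \<le> 1" by linarith+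
          then have "4 ^ m * \<bar>x \<bullet> b - x0 \<bullet> b\<bar> \<le> 1" by (auto simp: abs_if right_diff_distrib)
          then show "\<bar>(x - x0) \<bullet> b\<bar> \<le> (1 / 4) ^ m" by (simp add: inner_diff_left field_simps)
        qed
        finally show ?thesis using L(1) by (simp add: mult_left_mono)
      qed
      have iu: "set_integrable lebesgue (Q n) u" by (rule L1_loc_cube[OF uL cube])
      have "osc (Q n) u \<le> 2 * avg (Q n) (\<lambda>x. \<bar>u x - u x0\<bar>)" by (rule osc_le_avg_diff[OF cube iu])
      also have "avg (Q n) (\<lambda>x. \<bar>u x - u x0\<bar>) \<le> avg (Q n) (\<lambda>x. L * (?n * (1 / 4) ^ m))"
        using bd iu set_integrable_cube_const[OF cube]
        by (intro avg_mono[OF cube] set_integrable_abs set_integral_diff) auto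
      also have "\<dots> = L * (?n * (1 / 4) ^ m)" by (rule avg_const[OF cube])
      finally show ?thesis using m by (simp add: mult_ac)
    qed
    have pt: "ennreal (d powr p) * ennreal (if good n then V n * weight A B m \<lfloor>Z n \<bullet> i\<rfloor> powr p else 0)
        \<le> ennreal (2 powr p) * ennreal (V n * osc (Q n) (\<lambda>x. ?g x - u x) powr p)
          + ennreal (2 powr p * e powr p) * ennreal (if good n then V n else 0)" for n
    proof (cases "good n")
      case True
      let ?o = "osc (Q n) (\<lambda>x. ?g x - u x)" and ?w = "weight A B m \<lfloor>Z n \<bullet> i\<rfloor>"
      have o0: "0 \<le> ?o" by (rule osc_nonneg[OF cube])
      have "Z n \<bullet> i = of_int \<lfloor>Z n \<bullet> i\<rfloor>" using Zl[of n] i by (auto simp: lattice_def elim!: Ints_cases)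
      then have "d * ?w \<le> osc (Q n) ?g"
        using osc_grid_cube_ge[OF i Zl _ _ g(1)] True unfolding d_def Q_def good_def by blast
      also have "\<dots> = osc (Q n) (\<lambda>x. (?g x - u x) + u x)" by simp
      also have "\<dots> \<le> ?o + osc (Q n) u"
        by (intro osc_add_le[OF cube] L1_loc_cube[OF _ cube] L1_loc_diff g uL)
      also have "\<dots> \<le> ?o + e" using osc_u[OF True] by simp
      finally have "(d * ?w) powr p \<le> (?o + e) powr p"
        using p d weight_pos[OF AB_pos, of m] by (intro powr_mono2) (auto simp: less_imp_le)
      also have "\<dots> \<le> 2 powr p * (?o powr p + e powr p)" using p e o0 by (intro powr_add_le) auto
      finally have "d powr p * ?w powr p \<le> 2 powr p * (?o powr p + e powr p)" by (simp only: powr_mult)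
      then have "V n * (d powr p * ?w powr p) \<le> V n * (2 powr p * (?o powr p + e powr p))"
        using V0[of n] by (intro mult_left_mono) auto
      then have "d powr p * (V n * ?w powr p) \<le> 2 powr p * (V n * ?o powr p) + 2 powr p * e powr p * V n"
        by (simp add: algebra_simps)
      then have "ennreal (d powr p * (V n * ?w powr p)) \<le> ennreal (2 powr p * (V n * ?o powr p) + 2 powr p * e powr p * V n)"
        by (rule ennreal_leI)
      then show ?thesis using True V0[of n] by (simp add: ennreal_mult ennreal_plus mult.assoc)
    qed simp
    have "ennreal (d powr p) * 1 \<le> ennreal (d powr p) * (\<Sum>n. ennreal (if good n then V n * weight A B m \<lfloor>Z n \<bullet> i\<rfloor> powr p else 0))"
      unfolding good_def V_def Q_def by (intro mult_left_mono grid_sum_weights_ge[OF i Z]) simp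
    also have "\<dots> = (\<Sum>n. ennreal (d powr p) * ennreal (if good n then V n * weight A B m \<lfloor>Z n \<bullet> i\<rfloor> powr p else 0))"
      by (simp only: ennreal_suminf_cmult)
    also have "\<dots> \<le> (\<Sum>n. ennreal (2 powr p) * ennreal (V n * osc (Q n) (\<lambda>x. ?g x - u x) powr p)
          + ennreal (2 powr p * e powr p) * ennreal (if good n then V n else 0))"
      by (intro suminf_le summableI pt)
    also have "\<dots> = ennreal (2 powr p) * (\<Sum>n. ennreal (V n * osc (Q n) (\<lambda>x. ?g x - u x) powr p))
          + ennreal (2 powr p * e powr p) * (\<Sum>n. ennreal (if good n then V n else 0))"
      by (simp only: suminf_add[OF summableI summableI, symmetric] ennreal_suminf_cmult)
    also have "\<dots> \<le> ennreal (2 powr p) * ennreal (e powr p) + ennreal (2 powr p * e powr p) * 1"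
    proof (intro add_mono mult_left_mono)
      have "(\<Sum>n. ennreal (V n * osc (Q n) (\<lambda>x. ?g x - u x) powr p)) \<le> ennreal (K powr p)"
        using K(1) cube disj unfolding JN_bound_alt V_def by blast
      also have "\<dots> \<le> ennreal (e powr p)" using K K0 p by (intro ennreal_leI powr_mono2) auto
      finally show "(\<Sum>n. ennreal (V n * osc (Q n) (\<lambda>x. ?g x - u x) powr p)) \<le> ennreal (e powr p)" .
      show "(\<Sum>n. ennreal (if good n then V n else 0)) \<le> 1"
        unfolding good_def V_def Q_def by (rule grid_sum_volume_le[OF Z])
    qed auto
    also have "\<dots> = ennreal (2 powr p * (e powr p + e powr p))"
      by (simp add: ennreal_mult[symmetric] ennreal_plus[symmetric] distrib_left del: ennreal_plus)
    finally have "d powr p \<le> 2 powr p * (e powr p + e powr p)" by (simp add: ennreal_le_iff)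
    with ep show False by simp
  qed
  with g show ?thesis by blast
qed

end

theorem corollary5p11:
  fixes p :: real
  assumes "1 < p"
  shows "(\<exists>g :: real ^ 'n \<Rightarrow> real. g \<in> JN_space p \<and> g \<notin> VJN_space p) \<and>
         (\<exists>g\<^sub>0 :: real ^ 'n \<Rightarrow> real. g\<^sub>0 \<in> CJN_space p \<and> g\<^sub>0 \<notin> L_space_mod_const p)"
proof -
  obtain A B where "0 < B" "B < 1" "1 < A" "A < 2" "A + B < 2" "A powr p + B powr p = 2"
    using obtain_factors[OF assms] .
  with assms interpret cascade_factors p A B by unfold_locales
  obtain i :: "real ^ 'n" where i: "i \<in> Basis" using nonempty_Basis by blast
  show ?thesis using localized_cascade_in_JN_not_VJN[OF i] CJN_not_L_space_mod_const by blast
qed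

end
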